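(* Let $(S_n)$ be a sequence of centered real random variables with $\sigma_n=\|S_n\|_{L^2}\to\infty$. Let $(A_n)$ be a bounded real sequence, let $B_n=\sigma_n+O(1)$, and set $W_n=(S_n-A_n)/B_n$. Let $m\ge 2$ be an integer and suppose that $(S_n)$ satisfies the growth condition of order $m$ (defined in the context). Let $h:\mathbb R\to\mathbb R$ be an a.e. differentiable function such that $$H_m=H_m(h)=\int_{\mathbb R}\frac{|h'(x)|}{(1+|x|)^m}\,dx<\infty .$$ Then there is a constant $R>0$ which does not depend on $h$ (nor on $n$) such that $$\left|\mathbb E[h(W_n)]-\int_{\mathbb R} h(x)\varphi(x)\,dx\right|\le R\,H_m\,\sigma_n^{-1}.$$ In particular, for every $q<m$, $$\left|\mathbb E[W_n^q]-\int_{\mathbb R} x^q\varphi(x)\,dx\right|\le R\,H_m\,\sigma_n^{-1} \quad\text{and}\quad \left|\mathbb E[|W_n|^q]-\int_{\mathbb R} |x|^q\varphi(x)\,dx\right|\le R\,H_m\,\sigma_n^{-1},$$ where $H_m$ is the quantity above for $h(x)=x^q$ and for $h(x)=|x|^q$, respectively.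
   Context: $\varphi(x)=\frac1{\sqrt{2\pi}}e^{-x^2/2}$ is the standard normal density. Growth condition of order $m$ ($m\ge2$ an integer): put $\Lambda_n(t)=\ln\mathbb E[e^{itS_n/\sigma_n}]+t^2/2$. For all $3\le j\le m+1$ there exist constants $C_j,\varepsilon_j>0$ (independent of $n$) such that $$\sup_{t\in[-\varepsilon_j\sigma_n,\varepsilon_j\sigma_n]}|\Lambda_n^{(j)}(t)|\le C_j\sigma_n^{-(j-2)}.$$
   Formalization: The a.e. differentiable function h is additionally assumed locally absolutely continuous; without this the claim fails, e.g. for the indicator of (0,∞), where H_m = 0. The bounds are stated for those n with σ_n > 0 and B_n ≠ 0. *)

theory Defs
  imports "HOL-Probability.Probability" "HOL-Library.Landau_Symbols"
begin

text \<open>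
  Continuous branch on \<open>I\<close> of the logarithm of the characteristic function of \<open>X\<close>,
  normalised to vanish at the origin. On an interval around \<open>0\<close> it is unique if it exists, and it
  agrees with the principal logarithm as long as the latter is continuous there.
\<close>

definition log_char_on :: "'a measure \<Rightarrow> ('a \<Rightarrow> real) \<Rightarrow> real set \<Rightarrow> (real \<Rightarrow> complex) \<Rightarrow> bool" where
  "log_char_on M X I L \<longleftrightarrow>
     continuous_on I L \<and> L 0 = 0 \<and> (\<forall>t\<in>I. exp (L t) = char (distr M borel X) t)"

text \<open>
  \<open>D 0, \<dots>, D k\<close> are the derivatives of \<open>f\<close> on \<open>I\<close> of orders \<open>0, \<dots>, k\<close>. On a nondegenerate
  interval they are uniquely determined by \<open>f\<close>; at the end points of a closed interval they
  are one-sided.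
\<close>

definition derivatives_on ::
    "nat \<Rightarrow> (real \<Rightarrow> complex) \<Rightarrow> real set \<Rightarrow> (nat \<Rightarrow> real \<Rightarrow> complex) \<Rightarrow> bool" where
  "derivatives_on k f I D \<longleftrightarrow>
     (\<forall>t\<in>I. D 0 t = f t) \<and>
     (\<forall>i<k. \<forall>t\<in>I. (D i has_vector_derivative D (Suc i) t) (at t within I))"

text \<open>
  In the application \<open>\<sigma> n\<close> is the \<open>L\<^sup>2\<close>-norm of \<open>S n\<close>. The indices with \<open>\<sigma> n = 0\<close>, for which
  \<open>S n / \<sigma> n\<close> is meaningless, are skipped. The logarithm \<open>L\<close> and the derivatives \<open>D\<close> are
  unique on \<open>I\<close>, so that the inner existential quantifier says that the derivatives of
  \<open>\<Lambda>\<^sub>n(t) = L(t) + t\<^sup>2/2\<close> up to order \<open>j\<close> exist on \<open>I\<close>, and that the one of order \<open>j\<close>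
  satisfies the stated bound.
\<close>

definition growth_condition ::
    "'a measure \<Rightarrow> (nat \<Rightarrow> 'a \<Rightarrow> real) \<Rightarrow> (nat \<Rightarrow> real) \<Rightarrow> nat \<Rightarrow> bool" where
  "growth_condition M S \<sigma> m \<longleftrightarrow>
     (\<forall>j. 3 \<le> j \<and> j \<le> m + 1 \<longrightarrow>
       (\<exists>C>0. \<exists>\<epsilon>>0. \<forall>n. \<sigma> n > 0 \<longrightarrow>
         (let I = {- (\<epsilon> * \<sigma> n) .. \<epsilon> * \<sigma> n} in
          \<exists>L D. log_char_on M (\<lambda>\<omega>. S n \<omega> / \<sigma> n) I L \<and>
                derivatives_on j (\<lambda>t. L t + complex_of_real (t\<^sup>2 / 2)) I D \<and>
                (\<forall>t\<in>I. cmod (D j t) \<le> C / \<sigma> n ^ (j - 2)))))"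

text \<open>Absolute continuity on every compact interval.\<close>

definition locally_abs_continuous :: "(real \<Rightarrow> real) \<Rightarrow> bool" where
  "locally_abs_continuous h \<longleftrightarrow>
     (\<forall>a b. \<forall>e>0. \<exists>d>0. \<forall>P :: (real \<times> real) set.
        finite P \<and> (\<forall>(u, v)\<in>P. a \<le> u \<and> u \<le> v \<and> v \<le> b) \<and>
        disjoint_family_on (\<lambda>(u, v). {u<..<v}) P \<and> (\<Sum>(u, v)\<in>P. v - u) < d
        \<longrightarrow> (\<Sum>(u, v)\<in>P. \<bar>h v - h u\<bar>) < e)"

text \<open>The values of \<^const>\<open>deriv\<close> at points of non-differentiability are arbitrary; the definition
  is only meant for functions that are differentiable almost everywhere.\<close>

definition H :: "nat \<Rightarrow> (real \<Rightarrow> real) \<Rightarrow> ennreal" where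
  "H m h = (\<integral>\<^sup>+ x. ennreal (\<bar>deriv h x\<bar> / (1 + \<bar>x\<bar>) ^ m) \<partial>lebesgue)"

text \<open>
  \<open>E[h(W)]\<close> is within \<open>r\<close> of the integral of \<open>h\<close> against the standard normal density. Existence
  of both integrals is required explicitly, as the Bochner integral of a function that is not
  integrable is \<open>0\<close> by convention.
\<close>

definition normal_approx ::
    "'a measure \<Rightarrow> ('a \<Rightarrow> real) \<Rightarrow> (real \<Rightarrow> real) \<Rightarrow> real \<Rightarrow> bool" where
  "normal_approx M W h r \<longleftrightarrow>
     integrable M (\<lambda>\<omega>. h (W \<omega>)) \<and>
     integrable lborel (\<lambda>x. h x * std_normal_density x) \<and>
     \<bar>(\<integral>\<omega>. h (W \<omega>) \<partial>M) - (\<integral>x. h x * std_normal_density x \<partial>lborel)\<bar> \<le> r"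

end

theory Submission
  imports Defs
begin

text \<open>
  Writing \<open>E[h(W)] - \<integral> h \<phi> = \<integral> h' (\<Phi> - F)\<close>, where \<open>F\<close> is the distribution function of \<open>W\<close>, reduces the
  theorem to the nonuniform estimate \<open>\<bar>F(x) - \<Phi>(x)\<bar> \<le> R \<sigma>\<^sup>-\<^sup>1 (1 + \<bar>x\<bar>)\<^sup>-\<^sup>m\<close>, and the affine change from
  \<open>S / \<sigma>\<close> to \<open>W\<close> costs only a further term of that size.

  By the growth condition, \<open>f = E[exp(i t S / \<sigma>)]\<close> satisfies \<open>f = exp(\<Lambda> - t\<^sup>2/2)\<close> on \<open>[-T, T]\<close> with \<open>T = \<epsilon> \<sigma>\<close>,
  and \<open>d = f - exp(-t\<^sup>2/2)\<close> solves \<open>d' = - t d + \<Lambda>' f\<close>; hence its derivatives up to order \<open>m + 1\<close> are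
  \<open>O(\<sigma>\<^sup>-\<^sup>1)\<close> times a rapidly decaying weight. Convolving with a kernel \<open>K\<close> at scale \<open>1/T\<close> whose
  Fourier transform has compact support and integrating by parts \<open>m + 1\<close> times, the smoothed
  densities differ by \<open>O(\<sigma>\<^sup>-\<^sup>1 (1 + \<bar>x\<bar>)\<^sup>-\<^sup>m\<^sup>-\<^sup>1)\<close>; integrating once from \<open>\<plusminus>\<infinity>\<close> gives the estimate for the
  smoothed distribution functions. The smoothing is undone without any a priori moment bound: since
  \<open>K \<ge> 0\<close>, the bound on the smoothed density of \<open>S / \<sigma>\<close> controls its mass near \<open>x\<close> at scale \<open>1/T\<close>.
\<close>

section \<open>Functions with weighted bounds on their derivatives\<close>

text \<open>The growth condition bounds \<open>\<Lambda>\<close> from order 3 on. Orders 1 and 2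
  vanish at 0 because the mean is 0 and the variance 1, and integrating the third-order bound gives
  a cubic bound on \<open>\<Lambda>\<close>. If \<open>\<epsilon>\<close> is small, this cubic stays
  below \<open>t\<^sup>2 / 4\<close> on the whole interval, so half of the Gaussian exponent
  survives and absorbs every polynomial factor. The differential equation replaces explicit formulas
  for the derivatives of \<open>exp \<Lambda>\<close>: each one is bounded through the lower ones.
  Nothing is known beyond frequency \<open>T\<close>, whence the demand for a band-limited kernel;
  the resolution lost is of the order of the error allowed. One order more than the final exponent
  is spent because passing from densities to distribution functions costs one power. Polynomial
  weights pass through convolutions by Peetre's inequality, at a uniform price because the scales
  \<open>1 / T\<close> are bounded.\<close>

text \<open>\<open>u\<close> and its derivatives up to order \<open>k\<close> are bounded by \<open>w\<close> on \<open>I\<close>, and those of order less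
  than \<open>k\<close> vanish on \<open>Z\<close>, so that integration by parts leaves no boundary terms when \<open>Z\<close> consists
  of the end points.\<close>

fun smooth_bound ::
    "real set \<Rightarrow> real set \<Rightarrow> nat \<Rightarrow> (real \<Rightarrow> real) \<Rightarrow> (real \<Rightarrow> complex) \<Rightarrow> bool" where
  "smooth_bound I Z 0 w u \<longleftrightarrow> (\<forall>t\<in>I. cmod (u t) \<le> w t)"
| "smooth_bound I Z (Suc k) w u \<longleftrightarrow>
     (\<forall>t\<in>I. cmod (u t) \<le> w t) \<and> (\<forall>t\<in>Z. u t = 0) \<and>
     (\<exists>u'. (\<forall>t\<in>I. (u has_vector_derivative u' t) (at t within I)) \<and> smooth_bound I Z k w u')"

lemma smooth_bound_le: "smooth_bound I Z k w u \<Longrightarrow> t \<in> I \<Longrightarrow> cmod (u t) \<le> w t"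
  by (cases k) auto

lemma smooth_bound_mono:
  assumes "smooth_bound I Z k w u" "\<And>t. t \<in> I \<Longrightarrow> w t \<le> w' t"
  shows "smooth_bound I Z k w' u"
  using assms(1)
proof (induction k arbitrary: u)
  case 0
  then show ?case using assms(2) by (auto intro: order_trans)
next
  case (Suc k)
  then obtain u' where "\<forall>t\<in>I. (u has_vector_derivative u' t) (at t within I)" "smooth_bound I Z k w u'"
    by auto
  with Suc show ?case using assms(2) by (auto intro: order_trans intro!: exI[of _ u'])
qed

lemma smooth_bound_SucD: "smooth_bound I Z (Suc k) w u \<Longrightarrow> smooth_bound I Z k w u"
proof (induction k arbitrary: u)
  case (Suc k)
  then obtain u' where "\<forall>t\<in>I. (u has_vector_derivative u' t) (at t within I)" "smooth_bound I Z (Suc k) w u'"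
    by auto
  moreover from this Suc.IH have "smooth_bound I Z k w u'" by blast
  ultimately show ?case using Suc.prems by auto
qed auto

lemma smooth_bound_add:
  assumes "smooth_bound I Z k w u" "smooth_bound I Z k w' v"
  shows "smooth_bound I Z k (\<lambda>t. w t + w' t) (\<lambda>t. u t + v t)"
  using assms
proof (induction k arbitrary: u v)
  case 0
  then show ?case by (auto intro!: norm_triangle_mono)
next
  case (Suc k)
  then obtain u' v' where d: "\<forall>t\<in>I. (u has_vector_derivative u' t) (at t within I)" "smooth_bound I Z k w u'"
    "\<forall>t\<in>I. (v has_vector_derivative v' t) (at t within I)" "smooth_bound I Z k w' v'" by auto
  show ?case using Suc.prems d Suc.IH[OF d(2,4)]
    by (auto intro!: norm_triangle_mono exI[of _ "\<lambda>t. u' t + v' t"] has_vector_derivative_add)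
qed

lemma smooth_bound_scale:
  assumes "smooth_bound I Z k w u"
  shows "smooth_bound I Z k (\<lambda>t. cmod c * w t) (\<lambda>t. c * u t)"
  using assms
proof (induction k arbitrary: u)
  case 0
  then show ?case by (auto simp: norm_mult intro: mult_left_mono)
next
  case (Suc k)
  then obtain u' where d: "\<forall>t\<in>I. (u has_vector_derivative u' t) (at t within I)" "smooth_bound I Z k w u'"
    by auto
  show ?case using Suc.prems d Suc.IH[OF d(2)]
    by (auto simp: norm_mult intro: mult_left_mono intro!: exI[of _ "\<lambda>t. c * u' t"] has_vector_derivative_mult_right)
qed

text \<open>Leibniz: a derivative of order \<open>i\<close> has \<open>2 ^ i\<close> terms counted
  with multiplicity, each at most \<open>w * w'\<close>. It is enough that one factor vanishes on
  \<open>Z\<close> to the required order.\<close>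

lemma smooth_bound_mult:
  assumes "smooth_bound I Z k w u" "smooth_bound I {} k w' v"
  shows "smooth_bound I Z k (\<lambda>t. 2 ^ k * (w t * w' t)) (\<lambda>t. u t * v t)"
  using assms
proof (induction k arbitrary: u v)
  case 0
  then show ?case
    by (auto simp: norm_mult intro!: mult_mono intro: order_trans[OF norm_ge_zero])
next
  case (Suc k)
  then obtain u' v' where d: "\<forall>t\<in>I. (u has_vector_derivative u' t) (at t within I)" "smooth_bound I Z k w u'"
    "\<forall>t\<in>I. (v has_vector_derivative v' t) (at t within I)" "smooth_bound I {} k w' v'" by auto
  have b: "cmod (u t * v t) \<le> 2 ^ Suc k * (w t * w' t)" if "t \<in> I" for t
  proof -
    have uv: "cmod (u t) \<le> w t" "cmod (v t) \<le> w' t" using Suc.prems that by auto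
    then have "cmod (u t * v t) \<le> w t * w' t"
      unfolding norm_mult by (intro mult_mono) (auto intro: order_trans[OF norm_ge_zero])
    moreover have "0 \<le> w t * w' t" using uv by (meson mult_nonneg_nonneg norm_ge_zero order_trans)
    moreover have "(1::real) \<le> 2 ^ Suc k" by (rule one_le_power) simp
    ultimately show ?thesis by (meson mult_le_cancel_right1 order_trans not_less)
  qed
  have "smooth_bound I Z k (\<lambda>t. 2 ^ k * (w t * w' t) + 2 ^ k * (w t * w' t)) (\<lambda>t. u t * v' t + u' t * v t)"
    by (intro smooth_bound_add Suc.IH smooth_bound_SucD[OF Suc.prems(1)] smooth_bound_SucD[OF Suc.prems(2)] d)
  then have s: "smooth_bound I Z k (\<lambda>t. 2 ^ Suc k * (w t * w' t)) (\<lambda>t. u t * v' t + u' t * v t)"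
    by (simp add: mult_2 [symmetric] mult.assoc)
  show ?case using Suc.prems d b s
    by (auto intro!: exI[of _ "\<lambda>t. u t * v' t + u' t * v t"] has_vector_derivative_mult)
qed

lemma smooth_bound_shift:
  assumes "smooth_bound I {} k w u" "\<And>t. t \<in> J \<Longrightarrow> t - a \<in> I"
  shows "smooth_bound J {} k (\<lambda>t. w (t - a)) (\<lambda>t. u (t - a))"
  using assms(1)
proof (induction k arbitrary: u)
  case 0
  then show ?case using assms by auto
next
  case (Suc k)
  then obtain u' where d: "\<forall>t\<in>I. (u has_vector_derivative u' t) (at t within I)" "smooth_bound I {} k w u'"
    by auto
  have "((\<lambda>t. u (t - a)) has_vector_derivative u' (t - a)) (at t within J)" if t: "t \<in> J" for t
  proof -
    have "(u has_vector_derivative u' (t - a)) (at (t - a) within (\<lambda>t. t - a) ` J)"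
      using d(1) assms(2) t by (blast intro: has_vector_derivative_within_subset)
    moreover have "((\<lambda>t. t - a) has_vector_derivative 1) (at t within J)"
      by (auto intro!: derivative_eq_intros)
    ultimately show ?thesis
      using vector_diff_chain_within[of "\<lambda>t. t - a" 1 t J u "u' (t - a)"] by (simp add: o_def)
  qed
  then show ?case using Suc.prems Suc.IH[OF d(2)] assms
    by (auto intro!: exI[of _ "\<lambda>t. u' (t - a)"])
qed

lemma smooth_bound_const: "(\<And>t. t \<in> I \<Longrightarrow> cmod c \<le> w t) \<Longrightarrow> smooth_bound I {} k w (\<lambda>t. c)"
proof (induction k arbitrary: c)
  case (Suc k)
  have "smooth_bound I {} k w (\<lambda>_. 0)"
    by (rule Suc.IH) (use Suc.prems in \<open>auto intro: order_trans[OF norm_ge_zero]\<close>)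
  with Suc.prems show ?case
    by (auto intro!: exI[of _ "\<lambda>_. 0"])
qed auto

lemma smooth_bound_of_real:
  assumes "\<And>t. t \<in> I \<Longrightarrow> 1 + \<bar>t\<bar> \<le> w t"
  shows "smooth_bound I {} k w complex_of_real"
proof (cases k)
  case 0
  then show ?thesis using assms by fastforce
next
  case (Suc l)
  have "smooth_bound I {} l w (\<lambda>_. 1)"
    by (rule smooth_bound_const) (use assms in fastforce)
  moreover have "cmod (complex_of_real t) \<le> w t" if "t \<in> I" for t
    using assms[OF that] by simp
  moreover have "(complex_of_real has_vector_derivative 1) (at t within I)" for t
    using has_vector_derivative_of_real[OF DERIV_ident] by simp
  ultimately show ?thesis unfolding Suc by (auto intro!: exI[of _ "\<lambda>_. 1"])
qed

lemma smooth_bound_derivatives: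
  assumes "\<And>j t. l \<le> j \<Longrightarrow> j < l + k \<Longrightarrow> t \<in> I \<Longrightarrow> (D j has_vector_derivative D (Suc j) t) (at t within I)"
    and "\<And>j t. l \<le> j \<Longrightarrow> j \<le> l + k \<Longrightarrow> t \<in> I \<Longrightarrow> cmod (D j t) \<le> w t"
  shows "smooth_bound I {} k w (D l)"
  using assms
proof (induction k arbitrary: l)
  case (Suc k)
  have "smooth_bound I {} k w (D (Suc l))"
    by (rule Suc.IH) (use Suc.prems in auto)
  with Suc.prems show ?case by (auto intro!: exI[of _ "D (Suc l)"])
qed auto

text \<open>Each integration by parts trades a factor \<open>x\<close> for a derivative; the
  boundary terms disappear because the derivatives of order below \<open>k\<close> vanish at
  \<open>0\<close> and \<open>T\<close>.\<close>

lemma smooth_bound_fourier: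
  assumes "smooth_bound {0..T} {0, T} k w u" "0 \<le> T"
    and "(\<lambda>t. u t * iexp (- (x * t))) integrable_on {0..T}" and "w integrable_on {0..T}"
  shows "\<bar>x\<bar> ^ k * cmod (integral {0..T} (\<lambda>t. u t * iexp (- (x * t)))) \<le> integral {0..T} w"
  using assms(1,3)
proof (induction k arbitrary: u)
  case 0
  have "cmod (integral {0..T} (\<lambda>t. u t * iexp (- (x * t)))) \<le> integral {0..T} w"
    by (rule integral_norm_bound_integral) (use 0 assms in \<open>auto simp: norm_mult\<close>)
  then show ?case by simp
next
  case (Suc k)
  then obtain u' where d: "\<forall>t\<in>{0..T}. (u has_vector_derivative u' t) (at t within {0..T})"
    "smooth_bound {0..T} {0, T} k w u'" and z: "u 0 = 0" "u T = 0" by auto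
  let ?e = "\<lambda>t. iexp (- (x * t))"
  have e: "(?e has_vector_derivative - \<i> * x * ?e t) (at t within S)" for t S
  proof -
    have "((\<lambda>t. - x * t) has_vector_derivative - x) (at t within S)"
      by (auto intro!: derivative_eq_intros)
    from vector_diff_chain_within[OF this has_vector_derivative_iexp]
    show ?thesis by (simp add: o_def scaleR_conv_of_real mult_ac)
  qed
  have "((\<lambda>t. u t * (- \<i> * x * ?e t) + u' t * ?e t) has_integral (u T * ?e T - u 0 * ?e 0)) {0..T}"
    by (rule fundamental_theorem_of_calculus, fact) (intro has_vector_derivative_mult d(1)[rule_format] e)
  then have 1: "((\<lambda>t. u t * (- \<i> * x * ?e t) + u' t * ?e t) has_integral 0) {0..T}"
    using z by simp
  have 2: "((\<lambda>t. u t * (- \<i> * x * ?e t)) has_integral (- \<i> * x * integral {0..T} (\<lambda>t. u t * ?e t))) {0..T}"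
    using has_integral_mult_right[OF integrable_integral[OF Suc.prems(2)], of "- \<i> * x"]
    by (simp add: mult_ac)
  \<comment> \<open>Integrability of the new integrand is an output: the fundamental theorem for the
    gauge integral supplies it for the sum, and the induction hypothesis on integrability for the
    other summand.\<close>
  have 3: "((\<lambda>t. u' t * ?e t) has_integral (\<i> * x * integral {0..T} (\<lambda>t. u t * ?e t))) {0..T}"
    using has_integral_diff[OF 1 2] by simp
  have "\<bar>x\<bar> ^ k * cmod (integral {0..T} (\<lambda>t. u' t * ?e t)) \<le> integral {0..T} w"
    by (rule Suc.IH[OF d(2)]) (use 3 in auto)
  then show ?case using integral_unique[OF 3] by (simp add: norm_mult mult_ac)
qed

text \<open>Packaged as a predicate so that \<open>C\<close> and \<open>N\<close> are fixed before
  the interval and the size \<open>\<eta>\<close>, which later depend on the index of the sequence.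
  \<open>E\<close> stands for a Gaussian factor; \<open>\<eta>\<close> is 1 for a characteristic
  function and of order \<open>1 / \<sigma>\<close> for its distance to the normal one.\<close>

definition linear_ode_bound :: "nat \<Rightarrow> real \<Rightarrow> nat \<Rightarrow> real \<Rightarrow> nat \<Rightarrow> bool" where
  "linear_ode_bound k c a C N \<longleftrightarrow> (\<forall>I E \<eta> u v r. \<eta> \<ge> 0 \<longrightarrow> (\<forall>t\<in>I. 0 \<le> E t) \<longrightarrow>
    (\<forall>t\<in>I. cmod (u t) \<le> \<eta> * (c * (1 + \<bar>t\<bar>) ^ a * E t)) \<longrightarrow>
    (\<forall>t\<in>I. (u has_vector_derivative v t * u t + r t) (at t within I)) \<longrightarrow>
    smooth_bound I {} k (\<lambda>t. c * (1 + \<bar>t\<bar>) ^ a) v \<longrightarrow>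
    smooth_bound I {} k (\<lambda>t. \<eta> * (c * (1 + \<bar>t\<bar>) ^ a * E t)) r \<longrightarrow>
    smooth_bound I {} (Suc k) (\<lambda>t. \<eta> * (C * (1 + \<bar>t\<bar>) ^ N * E t)) u)"

lemma linear_ode_boundD:
  assumes "linear_ode_bound k c a C N" "\<eta> \<ge> 0" "\<forall>t\<in>I. 0 \<le> E t"
    "\<forall>t\<in>I. cmod (u t) \<le> \<eta> * (c * (1 + \<bar>t\<bar>) ^ a * E t)"
    "\<forall>t\<in>I. (u has_vector_derivative v t * u t + r t) (at t within I)"
    "smooth_bound I {} k (\<lambda>t. c * (1 + \<bar>t\<bar>) ^ a) v"
    "smooth_bound I {} k (\<lambda>t. \<eta> * (c * (1 + \<bar>t\<bar>) ^ a * E t)) r"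
  shows "smooth_bound I {} (Suc k) (\<lambda>t. \<eta> * (C * (1 + \<bar>t\<bar>) ^ N * E t)) u"
  using assms unfolding linear_ode_bound_def by blast

text \<open>Bootstrap along \<open>u' = v u + r\<close>: bounds for \<open>u\<close> up to some
  order bound the right-hand side up to that order, hence \<open>u\<close> up to the next one. The
  weight \<open>E\<close> enters only linearly because \<open>v\<close> is bounded without
  it.\<close>

lemma linear_ode_bound_exists:
  fixes c :: real and a k :: nat
  assumes "c \<ge> 0"
  shows "\<exists>C\<ge>0. \<exists>N. linear_ode_bound k c a C N"
proof (induction k)
  case 0
  have "linear_ode_bound 0 c a (c * c + c) (a + a)"
    unfolding linear_ode_bound_def
  proof (intro allI impI)
    fix I :: "real set" and E :: "real \<Rightarrow> real" and \<eta> :: real and u v r :: "real \<Rightarrow> complex"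
    assume h: "\<eta> \<ge> 0" "\<forall>t\<in>I. 0 \<le> E t"
      "\<forall>t\<in>I. cmod (u t) \<le> \<eta> * (c * (1 + \<bar>t\<bar>) ^ a * E t)"
      "\<forall>t\<in>I. (u has_vector_derivative v t * u t + r t) (at t within I)"
      "smooth_bound I {} 0 (\<lambda>t. c * (1 + \<bar>t\<bar>) ^ a) v"
      "smooth_bound I {} 0 (\<lambda>t. \<eta> * (c * (1 + \<bar>t\<bar>) ^ a * E t)) r"
    have le: "\<eta> * (c * (1 + \<bar>t\<bar>) ^ a * E t) \<le> \<eta> * (c * (1 + \<bar>t\<bar>) ^ (a + a) * E t)" if "t \<in> I" for t
      using that h assms by (intro mult_left_mono mult_right_mono power_increasing) auto
    have nn: "0 \<le> \<eta> * (c * c * (1 + \<bar>t\<bar>) ^ (a + a) * E t)" if "t \<in> I" for t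
      using that h assms by auto
    show "smooth_bound I {} (Suc 0) (\<lambda>t. \<eta> * ((c * c + c) * (1 + \<bar>t\<bar>) ^ (a + a) * E t)) u"
      unfolding smooth_bound.simps
    proof (intro conjI ballI exI[of _ "\<lambda>t. v t * u t + r t"])
      fix t assume t: "t \<in> I"
      show "cmod (u t) \<le> \<eta> * ((c * c + c) * (1 + \<bar>t\<bar>) ^ (a + a) * E t)"
      proof -
        have "cmod (u t) \<le> \<eta> * (c * c * (1 + \<bar>t\<bar>) ^ (a + a) * E t) + \<eta> * (c * (1 + \<bar>t\<bar>) ^ (a + a) * E t)"
          using h(3)[rule_format, OF t] le[OF t] nn[OF t] by linarith
        then show ?thesis by (simp add: distrib_left distrib_right mult.assoc)
      qed
      have "cmod (v t) * cmod (u t) \<le> (c * (1 + \<bar>t\<bar>) ^ a) * (\<eta> * (c * (1 + \<bar>t\<bar>) ^ a * E t))"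
        using h t assms by (intro mult_mono) auto
      also have "\<dots> = \<eta> * (c * c * (1 + \<bar>t\<bar>) ^ (a + a) * E t)" by (simp add: power_add mult_ac)
      finally have "cmod (v t * u t + r t) \<le> \<eta> * (c * c * (1 + \<bar>t\<bar>) ^ (a + a) * E t) + \<eta> * (c * (1 + \<bar>t\<bar>) ^ (a + a) * E t)"
        using h(6) t le[OF t] by (intro norm_triangle_mono) (auto simp: norm_mult intro: order_trans)
      then show "cmod (v t * u t + r t) \<le> \<eta> * ((c * c + c) * (1 + \<bar>t\<bar>) ^ (a + a) * E t)"
        by (simp add: algebra_simps)
    qed (use h in auto)
  qed
  moreover have "c * c + c \<ge> 0" using assms by simp
  ultimately show ?case by blast
next
  case (Suc k)
  then obtain C N where C: "C \<ge> 0" and IH: "linear_ode_bound k c a C N" by blast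
  \<comment> \<open>The first summand is the Leibniz bound for \<open>v u\<close>, in which the
    exponents \<open>a\<close> and \<open>N\<close> add; the second accounts for
    \<open>r\<close>.\<close>
  define C' where "C' = 2 ^ Suc k * (c * C) + c"
  have "linear_ode_bound (Suc k) c a C' (a + N)"
    unfolding linear_ode_bound_def
  proof (intro allI impI)
    fix I :: "real set" and E :: "real \<Rightarrow> real" and \<eta> :: real and u v r :: "real \<Rightarrow> complex"
    assume h: "\<eta> \<ge> 0" "\<forall>t\<in>I. 0 \<le> E t"
      "\<forall>t\<in>I. cmod (u t) \<le> \<eta> * (c * (1 + \<bar>t\<bar>) ^ a * E t)"
      "\<forall>t\<in>I. (u has_vector_derivative v t * u t + r t) (at t within I)"
      "smooth_bound I {} (Suc k) (\<lambda>t. c * (1 + \<bar>t\<bar>) ^ a) v"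
      "smooth_bound I {} (Suc k) (\<lambda>t. \<eta> * (c * (1 + \<bar>t\<bar>) ^ a * E t)) r"
    have le: "\<eta> * (c * (1 + \<bar>t\<bar>) ^ a * E t) \<le> \<eta> * (c * (1 + \<bar>t\<bar>) ^ (a + N) * E t)" if "t \<in> I" for t
      using that h assms by (intro mult_left_mono mult_right_mono power_increasing) auto
    have le': "\<eta> * (c * (1 + \<bar>t\<bar>) ^ (a + N) * E t) \<le> \<eta> * (C' * (1 + \<bar>t\<bar>) ^ (a + N) * E t)" if "t \<in> I" for t
      using that h assms C by (intro mult_left_mono mult_right_mono) (auto simp: C'_def)
    have "smooth_bound I {} (Suc k) (\<lambda>t. \<eta> * (C * (1 + \<bar>t\<bar>) ^ N * E t)) u"
      by (rule linear_ode_boundD[OF IH h(1-4) smooth_bound_SucD[OF h(5)] smooth_bound_SucD[OF h(6)]])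
    from smooth_bound_add[OF smooth_bound_mult[OF h(5) this] h(6)]
    have s: "smooth_bound I {} (Suc k) (\<lambda>t. \<eta> * (C' * (1 + \<bar>t\<bar>) ^ (a + N) * E t)) (\<lambda>t. v t * u t + r t)"
    proof (rule smooth_bound_mono)
      fix t assume t: "t \<in> I"
      show "2 ^ Suc k * (c * (1 + \<bar>t\<bar>) ^ a * (\<eta> * (C * (1 + \<bar>t\<bar>) ^ N * E t))) + \<eta> * (c * (1 + \<bar>t\<bar>) ^ a * E t)
        \<le> \<eta> * (C' * (1 + \<bar>t\<bar>) ^ (a + N) * E t)"
        using le[OF t] by (simp add: C'_def power_add algebra_simps)
    qed
    have b: "\<forall>t\<in>I. cmod (u t) \<le> \<eta> * (C' * (1 + \<bar>t\<bar>) ^ (a + N) * E t)"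
      using h(3) le le' by (meson order_trans)
    show "smooth_bound I {} (Suc (Suc k)) (\<lambda>t. \<eta> * (C' * (1 + \<bar>t\<bar>) ^ (a + N) * E t)) u"
      by (subst smooth_bound.simps(2), intro conjI exI[of _ "\<lambda>t. v t * u t + r t"] b h(4) s) simp
  qed
  moreover have "C' \<ge> 0" using assms C by (simp add: C'_def)
  ultimately show ?case by blast
qed

section \<open>A nonuniform smoothing inequality\<close>

lemma power_le_fact_exp: "0 \<le> (x::real) \<Longrightarrow> x ^ k \<le> fact k * exp x"
proof -
  assume x: "0 \<le> x"
  have "(\<Sum>n\<in>{k}. x ^ n /\<^sub>R fact n) \<le> (\<Sum>n. x ^ n /\<^sub>R fact n)"
    by (rule sum_le_suminf) (use x summable_exp_generic[of x] in auto)
  then have "x ^ k / fact k \<le> exp x"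
    by (simp add: exp_def divide_inverse mult.commute)
  then show ?thesis by (simp add: field_simps)
qed

text \<open>The source of every constant \<open>fact k * exp 2\<close> below: \<open>x ^ k\<close>
  is at most \<open>fact k * exp x\<close> for \<open>x = 1 + |r|\<close>, and completing a square
  bounds the remaining exponent by 2.\<close>

lemma power_mult_exp_le: "(1 + \<bar>r\<bar>) ^ k * exp (- (r\<^sup>2 / 4)) \<le> fact k * exp (2::real)"
proof -
  have "0 \<le> (\<bar>r\<bar> / 2 - 1)\<^sup>2" by simp
  then have r: "1 + \<bar>r\<bar> \<le> 2 + r\<^sup>2 / 4" by (simp add: power2_diff power_divide)
  have "(1 + \<bar>r\<bar>) ^ k * exp (- (r\<^sup>2 / 4)) \<le> fact k * exp (1 + \<bar>r\<bar>) * exp (- (r\<^sup>2 / 4))"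
    by (intro mult_right_mono power_le_fact_exp) auto
  also have "\<dots> = fact k * exp (1 + \<bar>r\<bar> - r\<^sup>2 / 4)"
    unfolding mult.assoc mult_exp_exp by simp
  also have "\<dots> \<le> fact k * exp 2" using r by simp
  finally show ?thesis .
qed

abbreviation std_normal_cdf :: "real \<Rightarrow> real" where
  "std_normal_cdf \<equiv> cdf std_normal_distribution"

lemma std_normal_density_le: "std_normal_density z \<le> fact k * exp 2 / (1 + \<bar>z\<bar>) ^ k"
proof -
  have "1 \<le> sqrt (2 * pi)" using pi_gt3 by simp
  then have "std_normal_density z \<le> exp (- (z\<^sup>2 / 2))"
    by (simp add: std_normal_density_def divide_le_eq mult_le_cancel_left1)
  also have "\<dots> \<le> exp (- (z\<^sup>2 / 4))" by simp
  finally have "(1 + \<bar>z\<bar>) ^ k * std_normal_density z \<le> (1 + \<bar>z\<bar>) ^ k * exp (- (z\<^sup>2 / 4))"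
    by (intro mult_left_mono) auto
  also note power_mult_exp_le
  finally show ?thesis by (subst pos_le_divide_eq) (auto simp: mult.commute)
qed

text \<open>Peetre's inequality. It moves a polynomial weight from one argument of a convolution to
  the other.\<close>

lemma peetre: "1 + \<bar>x\<bar> \<le> (1 + \<bar>y\<bar>) * (1 + \<bar>x - y\<bar> :: real)"
proof -
  have "1 + \<bar>x\<bar> \<le> 1 + \<bar>y\<bar> + \<bar>x - y\<bar>" by linarith
  also have "\<dots> \<le> 1 + \<bar>y\<bar> + \<bar>x - y\<bar> + \<bar>y\<bar> * \<bar>x - y\<bar>" by simp
  finally show ?thesis by (simp add: algebra_simps)
qed

lemma one_plus_power_le: "0 \<le> (a::real) \<Longrightarrow> (1 + a) ^ k \<le> 2 ^ k * (1 + a ^ k)"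
proof -
  assume a: "0 \<le> a"
  have "(1 + a) ^ k \<le> (2 * max 1 a) ^ k" using a by (intro power_mono) auto
  also have "\<dots> \<le> 2 ^ k * (1 + a ^ k)" using a by (auto simp: power_mult_distrib max_def)
  finally show ?thesis .
qed

text \<open>With \<open>u = T |x - y|\<close>, the distance \<open>|x - y|\<close> is at most
  \<open>\<tau> u\<close>; the price of a shift, measured in units of the scale
  \<open>1 / T\<close>, is therefore uniform in \<open>T\<close>.\<close>

lemma peetre_scaled:
  fixes x y T \<tau> :: real
  assumes T: "T > 0" "1 / T \<le> \<tau>"
  shows "(1 + \<bar>x\<bar>) ^ k \<le> (1 + \<tau>) ^ k * (1 + T * \<bar>x - y\<bar>) ^ k * (1 + \<bar>y\<bar>) ^ k"
proof -
  have 1: "1 \<le> \<tau> * T" using T by (metis pos_divide_le_eq)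
  have \<tau>: "0 \<le> \<tau>" using T by (smt (verit) divide_pos_pos)
  define u where "u = T * \<bar>x - y\<bar>"
  have u: "0 \<le> u" using T by (simp add: u_def)
  have "1 * \<bar>x - y\<bar> \<le> \<tau> * T * \<bar>x - y\<bar>" using 1 by (intro mult_right_mono) auto
  then have "1 + \<bar>x - y\<bar> \<le> 1 + \<tau> * u" by (simp add: u_def mult.assoc)
  also have "\<dots> \<le> (1 + \<tau>) * (1 + u)" using u \<tau> by (simp add: algebra_simps)
  finally have "(1 + \<bar>y\<bar>) * (1 + \<bar>x - y\<bar>) \<le> (1 + \<bar>y\<bar>) * ((1 + \<tau>) * (1 + u))"
    by (intro mult_left_mono) auto
  with peetre[of x y] have "(1 + \<bar>x\<bar>) ^ k \<le> ((1 + \<bar>y\<bar>) * ((1 + \<tau>) * (1 + u))) ^ k"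
    by (intro power_mono) auto
  then show ?thesis by (simp add: power_mult_distrib u_def mult_ac)
qed

lemma nn_integral_envelope_tail:
  fixes x :: real
  assumes "m \<ge> 1" "0 \<le> x"
  shows "(\<integral>\<^sup>+y. ennreal (1 / (1 + \<bar>y\<bar>) ^ (m + 1)) * indicator {x..} y \<partial>lborel) = ennreal (1 / (real m * (1 + x) ^ m))"
proof -
  have "(\<integral>\<^sup>+y. ennreal (1 / (1 + \<bar>y\<bar>) ^ (m + 1)) * indicator {x..} y \<partial>lborel) =
      ennreal (0 - (- 1 / (real m * (1 + x) ^ m)))"
  proof (rule nn_integral_FTC_atLeast)
    fix y assume y: "x \<le> y"
    obtain k where m: "m = Suc k" using assms by (cases m) auto
    have "((\<lambda>y. inverse (1 + y)) has_real_derivative - (inverse (1 + y) ^ 2)) (at y)"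
      using y assms by (auto intro!: derivative_eq_intros simp: power2_eq_square)
    moreover have "- ((1 + real k) * (- (r\<^sup>2) * r ^ k)) / real m = r ^ (m + 1)" for r :: real
      by (simp add: m power2_eq_square[of r])
    ultimately have "((\<lambda>y. - (inverse (1 + y) ^ m) / real m) has_real_derivative inverse (1 + y) ^ (m + 1)) (at y)"
      using DERIV_cdivide[OF DERIV_minus[OF DERIV_power_Suc[of "\<lambda>y. inverse (1 + y)" "- (inverse (1 + y) ^ 2)" y UNIV k]], of "real m"]
      unfolding m by (simp add: power2_eq_square[of "inverse (1 + y)"] mult.assoc)
    moreover have "inverse (1 + y) ^ (m + 1) = 1 / (1 + \<bar>y\<bar>) ^ (m + 1)"
      using y assms by (simp add: power_inverse inverse_eq_divide power_one_over)
    moreover have "(\<lambda>y. - (inverse (1 + y) ^ m) / real m) = (\<lambda>y. - 1 / (real m * (1 + y) ^ m))"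
      by (simp add: fun_eq_iff power_inverse divide_inverse mult.commute)
    ultimately show "((\<lambda>y. - 1 / (real m * (1 + y) ^ m)) has_real_derivative 1 / (1 + \<bar>y\<bar>) ^ (m + 1)) (at y)"
      by simp
  next
    have "((\<lambda>y::real. inverse (1 + y)) \<longlongrightarrow> 0) at_top" by real_asymp
    from tendsto_divide[OF tendsto_minus[OF tendsto_power[OF this, of m]] tendsto_const[of "real m"]]
    have "((\<lambda>y::real. - (inverse (1 + y) ^ m) / real m) \<longlongrightarrow> 0) at_top"
      using assms by (simp add: power_0_left)
    then show "((\<lambda>y. - 1 / (real m * (1 + y) ^ m)) \<longlongrightarrow> 0) at_top"
      by (simp add: power_inverse divide_inverse mult.commute)
  qed auto
  then show ?thesis by simp
qed

lemma envelope_integral_atLeast: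
  fixes x :: real
  assumes "m \<ge> 1" "0 \<le> x"
  shows "integrable lborel (\<lambda>y. indicator {x..} y / (1 + \<bar>y\<bar>) ^ (m + 1))"
    and "(\<integral>y. indicator {x..} y / (1 + \<bar>y\<bar>) ^ (m + 1) \<partial>lborel) \<le> 1 / (1 + \<bar>x\<bar>) ^ m"
proof -
  have e: "(\<integral>\<^sup>+y. ennreal (indicator {x..} y / (1 + \<bar>y\<bar>) ^ (m + 1)) \<partial>lborel) = ennreal (1 / (real m * (1 + x) ^ m))"
    unfolding nn_integral_envelope_tail[OF assms, symmetric]
    by (rule nn_integral_cong) (auto simp: indicator_def)
  show "integrable lborel (\<lambda>y. indicator {x..} y / (1 + \<bar>y\<bar>) ^ (m + 1))"
  proof (rule integrableI_nonneg)
    show "(\<integral>\<^sup>+y. ennreal (indicator {x..} y / (1 + \<bar>y\<bar>) ^ (m + 1)) \<partial>lborel) < \<infinity>" unfolding e by simp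
  qed auto
  have "(\<integral>y. indicator {x..} y / (1 + \<bar>y\<bar>) ^ (m + 1) \<partial>lborel) = 1 / (real m * (1 + x) ^ m)"
    using integral_eq_nn_integral[of "\<lambda>y. indicator {x..} y / (1 + \<bar>y\<bar>) ^ (m + 1)" lborel, unfolded e] assms by simp
  also have "\<dots> \<le> 1 / (1 * (1 + x) ^ m)"
    using assms by (intro divide_left_mono mult_right_mono) auto
  finally show "(\<integral>y. indicator {x..} y / (1 + \<bar>y\<bar>) ^ (m + 1) \<partial>lborel) \<le> 1 / (1 + \<bar>x\<bar>) ^ m"
    using assms by simp
qed

lemma envelope_integral_atMost:
  fixes x :: real
  assumes "m \<ge> 1" "x \<le> 0"
  shows "integrable lborel (\<lambda>y. indicator {..x} y / (1 + \<bar>y\<bar>) ^ (m + 1))"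
    and "(\<integral>y. indicator {..x} y / (1 + \<bar>y\<bar>) ^ (m + 1) \<partial>lborel) \<le> 1 / (1 + \<bar>x\<bar>) ^ m"
proof -
  have eq: "(\<lambda>y. indicator {- x..} (0 + (-1) * y) / (1 + \<bar>0 + (-1) * y\<bar>) ^ (m + 1)) = (\<lambda>y. indicator {..x} y / (1 + \<bar>y\<bar>) ^ (m + 1))"
    for x :: real
    by (auto simp: indicator_def fun_eq_iff)
  have 1: "integrable lborel (\<lambda>y. indicator {-x..} y / (1 + \<bar>y\<bar>) ^ (m + 1))"
    and 2: "(\<integral>y. indicator {-x..} y / (1 + \<bar>y\<bar>) ^ (m + 1) \<partial>lborel) \<le> 1 / (1 + \<bar>x\<bar>) ^ m"
    using envelope_integral_atLeast[of m "- x"] assms by auto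
  show "integrable lborel (\<lambda>y. indicator {..x} y / (1 + \<bar>y\<bar>) ^ (m + 1))"
    using lborel_integrable_real_affine[OF 1, of "-1" 0] unfolding eq by simp
  show "(\<integral>y. indicator {..x} y / (1 + \<bar>y\<bar>) ^ (m + 1) \<partial>lborel) \<le> 1 / (1 + \<bar>x\<bar>) ^ m"
    using 2 lborel_integral_real_affine[of "-1" "\<lambda>y. indicator {-x..} y / (1 + \<bar>y\<bar>) ^ (m + 1)" 0]
    unfolding eq by simp
qed

lemma envelope_integrable:
  assumes "m \<ge> 1"
  shows "integrable lborel (\<lambda>y::real. 1 / (1 + \<bar>y\<bar>) ^ (m + 1))"
proof (rule Bochner_Integration.integrable_bound)
  show "integrable lborel (\<lambda>y::real. indicator {0..} y / (1 + \<bar>y\<bar>) ^ (m + 1) + indicator {..0} y / (1 + \<bar>y\<bar>) ^ (m + 1))"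
    using assms by (intro Bochner_Integration.integrable_add envelope_integral_atLeast envelope_integral_atMost) auto
qed (auto simp: indicator_def)

section \<open>Convolution with a kernel at scale 1/T, and its removal\<close>

lemma inverse_one_plus_power_le_one: "0 \<le> (a::real) \<Longrightarrow> \<bar>1 / (1 + a) ^ M\<bar> \<le> 1"
  by (simp add: divide_le_eq)

definition envelope_mass :: real where
  "envelope_mass = (\<integral>v. 1 / (1 + \<bar>v\<bar>) ^ 2 \<partial>lborel)"

lemma envelope_mass_nonneg: "0 \<le> envelope_mass"
  unfolding envelope_mass_def by (rule integral_nonneg_AE) auto

lemma envelope_scaled:
  assumes "T > 0"
  shows "integrable lborel (\<lambda>y. T / (1 + \<bar>T * (y - z)\<bar>) ^ 2)"
    and "(\<integral>y. T / (1 + \<bar>T * (y - z)\<bar>) ^ 2 \<partial>lborel) = envelope_mass"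
proof -
  have i: "integrable lborel (\<lambda>v::real. 1 / (1 + \<bar>v\<bar>) ^ 2)"
    using envelope_integrable[of 1] by (simp add: numeral_2_eq_2)
  have eq: "(\<lambda>y. 1 / (1 + \<bar>(- T * z) + T * y\<bar>) ^ 2) = (\<lambda>y. 1 / (1 + \<bar>T * (y - z)\<bar>) ^ 2)"
    by (simp add: algebra_simps)
  have "integrable lborel (\<lambda>y. T * (1 / (1 + \<bar>T * (y - z)\<bar>) ^ 2))"
    using lborel_integrable_real_affine[OF i, of T "- T * z"] assms
    unfolding eq by (intro integrable_mult_right) auto
  then show "integrable lborel (\<lambda>y. T / (1 + \<bar>T * (y - z)\<bar>) ^ 2)" by simp
  have "envelope_mass = \<bar>T\<bar> *\<^sub>R (\<integral>y. 1 / (1 + \<bar>(- T * z) + T * y\<bar>) ^ 2 \<partial>lborel)"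
    unfolding envelope_mass_def by (rule lborel_integral_real_affine) (use assms in auto)
  also have "\<dots> = (\<integral>y. T * (1 / (1 + \<bar>T * (y - z)\<bar>) ^ 2) \<partial>lborel)"
    unfolding eq using assms by (subst integral_mult_right_zero) simp
  finally show "(\<integral>y. T / (1 + \<bar>T * (y - z)\<bar>) ^ 2 \<partial>lborel) = envelope_mass" by simp
qed

text \<open>The density of the convolution of \<open>\<mu>\<close> with the rescaled kernel. It is
  left unnormalised: its total mass is the integral of \<open>K\<close>, called
  \<open>\<kappa>\<close> below.\<close>

definition smoothed :: "(real \<Rightarrow> real) \<Rightarrow> real \<Rightarrow> real measure \<Rightarrow> real \<Rightarrow> real" where
  "smoothed K T \<mu> y = (\<integral>z. T * K (T * (y - z)) \<partial>\<mu>)"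

text \<open>Of the \<open>M + 2\<close> powers of decay, \<open>M\<close> carry polynomial weights
  and 2 ensure integrability. The lower bound near the origin lets the smoothed density control the
  mass of intervals of length comparable with \<open>1 / T\<close>.\<close>

locale smoothing_kernel =
  fixes K :: "real \<Rightarrow> real" and M :: nat and C c :: real
  assumes K_borel [measurable]: "K \<in> borel_measurable borel"
    and K_nonneg: "0 \<le> K v"
    and K_decay: "K v \<le> C / (1 + \<bar>v\<bar>) ^ (M + 2)"
    and c_pos: "0 < c"
    and K_lower: "\<bar>v\<bar> \<le> 1 \<Longrightarrow> c \<le> K v"
begin

definition \<kappa> :: real where "\<kappa> = (\<integral>v. K v \<partial>lborel)"

lemma C_nonneg: "0 \<le> C"
  using K_nonneg[of 0] K_decay[of 0] by simp

lemma K_le: "K v * (1 + \<bar>v\<bar>) ^ M \<le> C / (1 + \<bar>v\<bar>) ^ 2"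
proof -
  have "K v * (1 + \<bar>v\<bar>) ^ M \<le> C / (1 + \<bar>v\<bar>) ^ (M + 2) * (1 + \<bar>v\<bar>) ^ M"
    by (intro mult_right_mono K_decay) auto
  also have "\<dots> = C / (1 + \<bar>v\<bar>) ^ 2" by (simp add: power_add power2_eq_square)
  finally show ?thesis .
qed

lemma K_le2: "K v \<le> C / (1 + \<bar>v\<bar>) ^ 2"
proof -
  have "K v * 1 \<le> K v * (1 + \<bar>v\<bar>) ^ M"
    by (intro mult_left_mono K_nonneg one_le_power) auto
  with K_le[of v] show ?thesis by simp
qed

lemma K_scaled:
  assumes "T > 0"
  shows "integrable lborel (\<lambda>y. T * K (T * (y - z)))"
    and "(\<integral>y. T * K (T * (y - z)) \<partial>lborel) = \<kappa>"
proof -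
  show "integrable lborel (\<lambda>y. T * K (T * (y - z)))"
  proof (rule Bochner_Integration.integrable_bound)
    show "integrable lborel (\<lambda>y. C * (T / (1 + \<bar>T * (y - z)\<bar>) ^ 2))"
      by (intro integrable_mult_right envelope_scaled assms)
    show "AE y in lborel. norm (T * K (T * (y - z))) \<le> norm (C * (T / (1 + \<bar>T * (y - z)\<bar>) ^ 2))"
    proof (rule AE_I2)
      fix y
      have "T * K (T * (y - z)) \<le> T * (C / (1 + \<bar>T * (y - z)\<bar>) ^ 2)"
        using assms by (intro mult_left_mono K_le2) auto
      then show "norm (T * K (T * (y - z))) \<le> norm (C * (T / (1 + \<bar>T * (y - z)\<bar>) ^ 2))"
        using assms K_nonneg[of "T * (y - z)"] C_nonneg by (simp add: mult.commute)
    qed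
  qed measurable
  have "\<kappa> = \<bar>T\<bar> *\<^sub>R (\<integral>y. K ((- T * z) + T * y) \<partial>lborel)"
    unfolding \<kappa>_def by (rule lborel_integral_real_affine) (use assms in auto)
  also have "\<dots> = (\<integral>y. T * K (T * (y - z)) \<partial>lborel)"
    using assms by (simp add: algebra_simps)
  finally show "(\<integral>y. T * K (T * (y - z)) \<partial>lborel) = \<kappa>" by simp
qed

lemma bounded_K_scaled:
  assumes "T > 0" and [measurable]: "g \<in> borel_measurable borel" and "\<And>y. \<bar>g y\<bar> \<le> 1"
  shows "integrable lborel (\<lambda>y. g y * (T * K (T * (y - z))))"
    and "\<bar>\<integral>y. g y * (T * K (T * (y - z))) \<partial>lborel\<bar> \<le> \<kappa>"
proof -
  have b: "\<bar>g y * (T * K (T * (y - z)))\<bar> \<le> T * K (T * (y - z))" for y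
    using assms(3)[of y] K_nonneg[of "T * (y - z)"] assms(1) by (auto simp: abs_mult intro: mult_left_le_one_le)
  show i: "integrable lborel (\<lambda>y. g y * (T * K (T * (y - z))))"
    by (rule Bochner_Integration.integrable_bound[OF K_scaled(1)[OF assms(1), of z]])
      (auto intro!: AE_I2 order_trans[OF b] abs_ge_self)
  have "\<bar>\<integral>y. g y * (T * K (T * (y - z))) \<partial>lborel\<bar> \<le> (\<integral>y. \<bar>g y * (T * K (T * (y - z)))\<bar> \<partial>lborel)"
    by (rule integral_abs_bound)
  also have "\<dots> \<le> (\<integral>y. T * K (T * (y - z)) \<partial>lborel)"
    by (rule integral_mono) (use i b K_scaled[OF assms(1)] in auto)
  finally show "\<bar>\<integral>y. g y * (T * K (T * (y - z))) \<partial>lborel\<bar> \<le> \<kappa>" unfolding K_scaled(2)[OF assms(1)] .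
qed

text \<open>Applied with \<open>g\<close> the indicator of a half-line and with \<open>g\<close> a
  decaying weight; boundedness of \<open>g\<close> makes the double integral finite.\<close>

lemma smoothed_Fubini:
  assumes "real_distribution \<mu>" "T > 0"
    and [measurable]: "g \<in> borel_measurable borel" and g: "\<And>y. \<bar>g y\<bar> \<le> 1"
  shows "integrable lborel (\<lambda>y. g y * smoothed K T \<mu> y)"
    and "(\<integral>y. g y * smoothed K T \<mu> y \<partial>lborel) = (\<integral>z. (\<integral>y. g y * (T * K (T * (y - z))) \<partial>lborel) \<partial>\<mu>)"
    and "integrable \<mu> (\<lambda>z. \<integral>y. g y * (T * K (T * (y - z))) \<partial>lborel)"
proof -
  interpret real_distribution \<mu> by fact
  interpret P: pair_sigma_finite \<mu> lborel ..
  have b: "\<bar>\<integral>y. g y * (T * K (T * (y - z))) \<partial>lborel\<bar> \<le> \<kappa>" "\<bar>\<integral>y. \<bar>g y\<bar> * (T * K (T * (y - z))) \<partial>lborel\<bar> \<le> \<kappa>"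
    for z using bounded_K_scaled[of T g] bounded_K_scaled[of T "\<lambda>y. \<bar>g y\<bar>"] assms by auto
  have i: "integrable (\<mu> \<Otimes>\<^sub>M lborel) (\<lambda>(z, y). g y * (T * K (T * (y - z))))"
  proof (rule P.Fubini_integrable)
    have "(\<lambda>z. \<integral>y. norm (case (z, y) of (z, y) \<Rightarrow> g y * (T * K (T * (y - z)))) \<partial>lborel) =
        (\<lambda>z. \<integral>y. \<bar>g y\<bar> * (T * K (T * (y - z))) \<partial>lborel)"
      using assms K_nonneg by (simp add: abs_mult)
    moreover have "integrable \<mu> (\<lambda>z. \<integral>y. \<bar>g y\<bar> * (T * K (T * (y - z))) \<partial>lborel)"
      by (rule integrable_const_bound[of _ \<kappa>]) (use b in auto)
    ultimately show "integrable \<mu> (\<lambda>z. \<integral>y. norm (case (z, y) of (z, y) \<Rightarrow> g y * (T * K (T * (y - z)))) \<partial>lborel)"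
      by simp
  qed (use bounded_K_scaled(1)[OF assms(2-4)] in auto)
  have eq: "(\<integral>z. g y * (T * K (T * (y - z))) \<partial>\<mu>) = g y * smoothed K T \<mu> y" for y
    unfolding smoothed_def by simp
  show "integrable lborel (\<lambda>y. g y * smoothed K T \<mu> y)"
    using P.integrable_snd[OF i] unfolding eq .
  show "(\<integral>y. g y * smoothed K T \<mu> y \<partial>lborel) = (\<integral>z. (\<integral>y. g y * (T * K (T * (y - z))) \<partial>lborel) \<partial>\<mu>)"
    using P.Fubini_integral[OF i] unfolding eq .
  show "integrable \<mu> (\<lambda>z. \<integral>y. g y * (T * K (T * (y - z))) \<partial>lborel)"
    using P.integrable_fst[OF i] .
qed

text \<open>On \<open>S\<close> the distance to \<open>z\<close> is at least \<open>|x - z|\<close>,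
  so \<open>M\<close> powers of the decay of \<open>K\<close> leave the integral, and the remaining
  two are integrated over the whole line.\<close>

lemma K_scaled_tail:
  assumes T: "T > 0" and S [measurable]: "S \<in> sets borel"
    and far: "\<And>y. y \<in> S \<Longrightarrow> \<bar>x - z\<bar> \<le> \<bar>y - z\<bar>"
  shows "(\<integral>y. indicator S y * (T * K (T * (y - z))) \<partial>lborel) \<le> C * envelope_mass / (1 + T * \<bar>x - z\<bar>) ^ M"
proof -
  have "(\<integral>y. indicator S y * (T * K (T * (y - z))) \<partial>lborel) \<le>
      (\<integral>y. C / (1 + T * \<bar>x - z\<bar>) ^ M * (T / (1 + \<bar>T * (y - z)\<bar>) ^ 2) \<partial>lborel)"
  proof (rule integral_mono)
    show "integrable lborel (\<lambda>y. indicator S y * (T * K (T * (y - z))))"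
      by (rule bounded_K_scaled) (use T in \<open>auto simp: indicator_def\<close>)
    show "integrable lborel (\<lambda>y. C / (1 + T * \<bar>x - z\<bar>) ^ M * (T / (1 + \<bar>T * (y - z)\<bar>) ^ 2))"
      by (intro integrable_mult_right envelope_scaled T)
    show "indicator S y * (T * K (T * (y - z))) \<le> C / (1 + T * \<bar>x - z\<bar>) ^ M * (T / (1 + \<bar>T * (y - z)\<bar>) ^ 2)" for y
    proof (cases "y \<in> S")
      case True
      let ?v = "T * (y - z)"
      have "T * \<bar>x - z\<bar> \<le> \<bar>?v\<bar>" using far[OF True] T by (simp add: abs_mult)
      then have "(1 + T * \<bar>x - z\<bar>) ^ M \<le> (1 + \<bar>?v\<bar>) ^ M" using T by (intro power_mono) auto
      then have "K ?v * (1 + T * \<bar>x - z\<bar>) ^ M \<le> K ?v * (1 + \<bar>?v\<bar>) ^ M"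
        by (intro mult_left_mono K_nonneg)
      also note K_le
      finally have "K ?v \<le> C / (1 + \<bar>?v\<bar>) ^ 2 / (1 + T * \<bar>x - z\<bar>) ^ M"
        using T by (subst pos_le_divide_eq) (auto intro!: zero_less_power add_pos_nonneg)
      then have "T * K ?v \<le> T * (C / (1 + \<bar>?v\<bar>) ^ 2 / (1 + T * \<bar>x - z\<bar>) ^ M)"
        using T by (intro mult_left_mono) auto
      then show ?thesis using True by (simp add: mult_ac)
    next
      case False
      then show ?thesis using T C_nonneg by auto
    qed
  qed
  also have "\<dots> = C / (1 + T * \<bar>x - z\<bar>) ^ M * envelope_mass"
    by (subst integral_mult_right_zero) (simp add: envelope_scaled[OF T])
  finally show ?thesis by (simp add: mult_ac)
qed

text \<open>Together with \<open>K_scaled_tail\<close>, this dominates the error of replacing an indicator by its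
  smoothed version by a convolution with \<open>K\<close>, whose integral against \<open>\<mu>\<close> involves only the
  smoothed density.\<close>

lemma K_scaled_lower:
  assumes T: "T > 0"
  shows "2 * c / 2 ^ M / (1 + T * \<bar>x - z\<bar>) ^ M \<le> (\<integral>y. 1 / (1 + T * \<bar>x - y\<bar>) ^ M * (T * K (T * (y - z))) \<partial>lborel)"
proof -
  \<comment> \<open>On this interval \<open>K\<close> is at least \<open>c\<close>, and the weight
    at \<open>y\<close> is at least \<open>1 / 2 ^ M\<close> times the weight at \<open>z\<close>.
    The length \<open>2 / T\<close> cancels the factor \<open>T\<close> and leaves the 2.\<close>
  let ?I = "{z - 1 / T..z + 1 / T}"
  have "(\<integral>y. (T * c / (2 * (1 + T * \<bar>x - z\<bar>)) ^ M) * indicator ?I y \<partial>lborel) \<le>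
      (\<integral>y. 1 / (1 + T * \<bar>x - y\<bar>) ^ M * (T * K (T * (y - z))) \<partial>lborel)"
  proof (rule integral_mono)
    show "integrable lborel (\<lambda>y. (T * c / (2 * (1 + T * \<bar>x - z\<bar>)) ^ M) * indicator ?I y)"
      by (intro integrable_mult_right) (use borel_integrable_atLeastAtMost'[of "z - 1 / T" "z + 1 / T" "\<lambda>_. 1::real"] in \<open>auto simp: set_integrable_def\<close>)
    show "integrable lborel (\<lambda>y. 1 / (1 + T * \<bar>x - y\<bar>) ^ M * (T * K (T * (y - z))))"
    proof (rule bounded_K_scaled)
      show "\<bar>1 / (1 + T * \<bar>x - y\<bar>) ^ M\<bar> \<le> 1" for y
        using inverse_one_plus_power_le_one[of "T * \<bar>x - y\<bar>" M] T by simp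
    qed (use T in auto)
    show "(T * c / (2 * (1 + T * \<bar>x - z\<bar>)) ^ M) * indicator ?I y \<le> 1 / (1 + T * \<bar>x - y\<bar>) ^ M * (T * K (T * (y - z)))" for y
    proof (cases "y \<in> ?I")
      case True
      then have "T * \<bar>y - z\<bar> \<le> T * (1 / T)" using T by (intro mult_left_mono) auto
      then have v: "T * \<bar>y - z\<bar> \<le> 1" using T by simp
      have "T * \<bar>x - y\<bar> \<le> T * (\<bar>x - z\<bar> + \<bar>y - z\<bar>)" using T by (intro mult_left_mono) auto
      then have "1 + T * \<bar>x - y\<bar> \<le> 2 * (1 + T * \<bar>x - z\<bar>)"
        using v T mult_nonneg_nonneg[of T "\<bar>x - z\<bar>"] unfolding distrib_left by linarith
      then have p: "(1 + T * \<bar>x - y\<bar>) ^ M \<le> (2 * (1 + T * \<bar>x - z\<bar>)) ^ M" "0 < (1 + T * \<bar>x - y\<bar>) ^ M"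
        using T by (auto intro!: power_mono zero_less_power add_pos_nonneg)
      have "T * c \<le> T * K (T * (y - z))"
        using T v by (intro mult_left_mono K_lower) (auto simp: abs_mult)
      then have "T * c / (2 * (1 + T * \<bar>x - z\<bar>)) ^ M \<le> T * K (T * (y - z)) / (1 + T * \<bar>x - y\<bar>) ^ M"
        using p T c_pos by (intro frac_le) auto
      then show ?thesis using True by simp
    next
      case False
      then show ?thesis using T K_nonneg by simp
    qed
  qed
  also have "(\<integral>y. (T * c / (2 * (1 + T * \<bar>x - z\<bar>)) ^ M) * indicator ?I y \<partial>lborel) = 2 * c / 2 ^ M / (1 + T * \<bar>x - z\<bar>) ^ M"
    using T by (subst integral_mult_right_zero, subst power_mult_distrib) simp
  finally show ?thesis .
qed

lemma \<kappa>_pos: "0 < \<kappa>"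
proof -
  \<comment> \<open>The lower bound at \<open>T = 1\<close> and \<open>x = z = 0\<close>, where the
    weight under the integral is at most 1.\<close>
  have "2 * c / 2 ^ M / (1 + 1 * \<bar>0 - 0\<bar>) ^ M \<le> (\<integral>y. 1 / (1 + 1 * \<bar>0 - y\<bar>) ^ M * (1 * K (1 * (y - 0))) \<partial>lborel)"
    by (rule K_scaled_lower) simp
  also have "\<dots> \<le> \<kappa>"
  proof (rule order_trans[OF abs_ge_self bounded_K_scaled(2)])
    show "\<bar>1 / (1 + 1 * \<bar>0 - y\<bar>) ^ M\<bar> \<le> 1" for y :: real
      using inverse_one_plus_power_le_one[of "\<bar>y\<bar>" M] by simp
  qed auto
  finally have "2 * c / 2 ^ M \<le> \<kappa>" by simp
  moreover have "0 < 2 * c / 2 ^ M" using c_pos by simp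
  ultimately show ?thesis by linarith
qed

lemma cdf_minus_smoothed:
  assumes \<mu>: "real_distribution \<mu>" and T: "T > 0"
  shows "\<bar>\<kappa> * cdf \<mu> x - (\<integral>y. indicator {..x} y * smoothed K T \<mu> y \<partial>lborel)\<bar>
    \<le> C * envelope_mass * 2 ^ M / (2 * c) * (\<integral>y. 1 / (1 + T * \<bar>x - y\<bar>) ^ M * smoothed K T \<mu> y \<partial>lborel)"
proof -
  interpret real_distribution \<mu> by fact
  define \<Theta> where "\<Theta> z = (\<integral>y. indicator {..x} y * (T * K (T * (y - z))) \<partial>lborel)" for z
  define \<Psi> where "\<Psi> z = (\<integral>y. 1 / (1 + T * \<bar>x - y\<bar>) ^ M * (T * K (T * (y - z))) \<partial>lborel)" for z
  \<comment> \<open>The constant of \<open>K_scaled_tail\<close> divided by that of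
    \<open>K_scaled_lower\<close>, so that the tail is at most \<open>A * \<Psi> z\<close>.\<close>
  define A where "A = C * envelope_mass * 2 ^ M / (2 * c)"
  note F1 = smoothed_Fubini[OF \<mu> T, of "indicator {..x}", folded \<Theta>_def]
  have g: "\<bar>1 / (1 + T * \<bar>x - y\<bar>) ^ M\<bar> \<le> 1" for y
    using inverse_one_plus_power_le_one[of "T * \<bar>x - y\<bar>" M] T by simp
  note F2 = smoothed_Fubini[OF \<mu> T, of "\<lambda>y. 1 / (1 + T * \<bar>x - y\<bar>) ^ M", OF _ g, folded \<Psi>_def]
  have A: "C * envelope_mass / (1 + T * \<bar>x - z\<bar>) ^ M \<le> A * \<Psi> z" for z
  proof -
    have "A * (2 * c / 2 ^ M / (1 + T * \<bar>x - z\<bar>) ^ M) \<le> A * \<Psi> z"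
      unfolding \<Psi>_def using c_pos C_nonneg envelope_mass_nonneg
      by (intro mult_left_mono K_scaled_lower T) (auto simp: A_def)
    moreover have "A * (2 * c / 2 ^ M / (1 + T * \<bar>x - z\<bar>) ^ M) = C * envelope_mass / (1 + T * \<bar>x - z\<bar>) ^ M"
      using c_pos by (simp add: A_def)
    ultimately show ?thesis by simp
  qed
  \<comment> \<open>For \<open>z \<le> x\<close> the error is the kernel mass to the right of
    \<open>x\<close>, otherwise the mass to the left of \<open>x\<close>; in both cases it sits at
    distance at least \<open>|x - z|\<close> from \<open>z\<close>.\<close>
  have pw: "\<bar>\<kappa> * indicator {..x} z - \<Theta> z\<bar> \<le> A * \<Psi> z" for z
  proof (cases "z \<le> x")
    case True
    have "\<kappa> - \<Theta> z = (\<integral>y. T * K (T * (y - z)) - indicator {..x} y * (T * K (T * (y - z))) \<partial>lborel)"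
      unfolding \<Theta>_def K_scaled(2)[OF T, of z, symmetric]
      by (rule Bochner_Integration.integral_diff[symmetric])
        (rule K_scaled(1)[OF T], rule bounded_K_scaled(1)[OF T], auto simp: indicator_def)
    also have "\<dots> = (\<integral>y. indicator {x<..} y * (T * K (T * (y - z))) \<partial>lborel)"
      by (rule Bochner_Integration.integral_cong) (auto simp: indicator_def)
    finally have e: "\<kappa> - \<Theta> z = (\<integral>y. indicator {x<..} y * (T * K (T * (y - z))) \<partial>lborel)" .
    moreover have "\<dots> \<le> C * envelope_mass / (1 + T * \<bar>x - z\<bar>) ^ M"
      by (rule K_scaled_tail) (use T True in auto)
    moreover have "0 \<le> (\<integral>y. indicator {x<..} y * (T * K (T * (y - z))) \<partial>lborel)"
      using T K_nonneg by (intro integral_nonneg_AE AE_I2) auto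
    ultimately show ?thesis using True A[of z] by simp
  next
    case False
    have "\<Theta> z \<le> C * envelope_mass / (1 + T * \<bar>x - z\<bar>) ^ M"
      unfolding \<Theta>_def by (rule K_scaled_tail) (use T False in auto)
    moreover have "0 \<le> \<Theta> z" unfolding \<Theta>_def
      using T K_nonneg by (intro integral_nonneg_AE AE_I2) auto
    ultimately show ?thesis using False A[of z] by simp
  qed
  have iI: "integrable \<mu> (\<lambda>z. \<kappa> * indicator {..x} z)"
    by (rule integrable_const_bound[of _ "\<bar>\<kappa>\<bar>"]) (auto simp: indicator_def)
  have i\<Theta>: "integrable \<mu> \<Theta>" and i\<Psi>: "integrable \<mu> \<Psi>"
    using F1(3) F2(3) by (auto simp: indicator_def)
  have "\<kappa> * cdf \<mu> x - (\<integral>z. \<Theta> z \<partial>\<mu>) = (\<integral>z. \<kappa> * indicator {..x} z - \<Theta> z \<partial>\<mu>)"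
    using iI i\<Theta> by (subst Bochner_Integration.integral_diff) (auto simp: cdf_def2)
  also have "\<bar>\<dots>\<bar> \<le> (\<integral>z. \<bar>\<kappa> * indicator {..x} z - \<Theta> z\<bar> \<partial>\<mu>)"
    by (rule integral_abs_bound)
  also have "\<dots> \<le> (\<integral>z. A * \<Psi> z \<partial>\<mu>)"
    by (rule integral_mono) (use iI i\<Theta> i\<Psi> pw in auto)
  also have "\<dots> = A * (\<integral>z. \<Psi> z \<partial>\<mu>)" by simp
  finally show ?thesis
    using F1(2) F2(2) by (simp add: A_def indicator_def)
qed

text \<open>The \<open>M\<close> powers are spent as follows: \<open>k\<close> of them move the
  weight from \<open>y\<close> to \<open>x\<close> by Peetre's inequality, and at least two remain
  to make the right-hand side integrable in \<open>y\<close>.\<close>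

lemma envelope_convolution:
  fixes x y T \<tau> :: real
  assumes T: "T > 0" "1 / T \<le> \<tau>" and k: "k + 2 \<le> M"
  shows "1 / (1 + T * \<bar>x - y\<bar>) ^ M * (1 / (1 + \<bar>y\<bar>) ^ k)
    \<le> (1 + \<tau>) ^ k / (1 + \<bar>x\<bar>) ^ k * (1 / (1 + \<bar>T * (y - x)\<bar>) ^ 2)"
proof -
  have \<tau>: "0 \<le> \<tau>" using T by (smt (verit) divide_pos_pos)
  define u where "u = T * \<bar>x - y\<bar>"
  have u: "0 \<le> u" using T by (simp add: u_def)
  have 2: "(1 + \<bar>x\<bar>) ^ k \<le> (1 + \<tau>) ^ k * (1 + u) ^ k * (1 + \<bar>y\<bar>) ^ k"
    unfolding u_def by (rule peetre_scaled[OF T])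
  have 3: "(1 + u) ^ k * (1 + u) ^ 2 \<le> (1 + u) ^ M"
    unfolding power_add[symmetric] using u k by (intro power_increasing) auto
  have "(1 + \<bar>x\<bar>) ^ k * (1 + u) ^ 2 \<le> (1 + \<tau>) ^ k * ((1 + u) ^ k * (1 + u) ^ 2) * (1 + \<bar>y\<bar>) ^ k"
    using mult_right_mono[OF 2, of "(1 + u)\<^sup>2"] by (simp add: mult_ac)
  also have "\<dots> \<le> (1 + \<tau>) ^ k * (1 + u) ^ M * (1 + \<bar>y\<bar>) ^ k"
    using 3 \<tau> by (intro mult_right_mono mult_left_mono) auto
  finally have "(1 + \<bar>x\<bar>) ^ k * (1 + u) ^ 2 \<le> (1 + \<tau>) ^ k * ((1 + u) ^ M * (1 + \<bar>y\<bar>) ^ k)" by (simp add: mult_ac)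
  moreover have "0 < (1 + \<bar>x\<bar>) ^ k * (1 + u) ^ 2" "0 < (1 + u) ^ M * (1 + \<bar>y\<bar>) ^ k"
    using u by (auto intro!: mult_pos_pos zero_less_power)
  ultimately have "1 / ((1 + u) ^ M * (1 + \<bar>y\<bar>) ^ k) \<le> (1 + \<tau>) ^ k / ((1 + \<bar>x\<bar>) ^ k * (1 + u) ^ 2)"
    by (simp add: divide_simps)
  moreover have "\<bar>T * (y - x)\<bar> = u" using T by (simp add: u_def abs_mult abs_minus_commute)
  ultimately show ?thesis by (simp add: u_def)
qed

text \<open>The gain \<open>1 / T\<close> is the integral of
  \<open>1 / (1 + |T (y - x)|) ^ 2\<close> over \<open>y\<close>, up to the factor
  \<open>envelope_mass\<close>.\<close>

lemma cdf_minus_smoothed_le: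
  assumes \<mu>: "real_distribution \<mu>" and T: "T > 0" "1 / T \<le> \<tau>" and k: "k + 2 \<le> M"
    and Q: "\<And>y. smoothed K T \<mu> y \<le> Q / (1 + \<bar>y\<bar>) ^ k"
  shows "\<bar>\<kappa> * cdf \<mu> x - (\<integral>y. indicator {..x} y * smoothed K T \<mu> y \<partial>lborel)\<bar>
    \<le> C * envelope_mass\<^sup>2 * 2 ^ M / (2 * c) * (1 + \<tau>) ^ k * Q / T / (1 + \<bar>x\<bar>) ^ k"
proof -
  interpret real_distribution \<mu> by fact
  have nn: "0 \<le> smoothed K T \<mu> y" for y
    unfolding smoothed_def using T K_nonneg by (intro integral_nonneg_AE AE_I2) auto
  have Q0: "0 \<le> Q" using nn[of 0] Q[of 0] by simp
  define B where "B = Q * ((1 + \<tau>) ^ k / (1 + \<bar>x\<bar>) ^ k) / T"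
  have "(\<integral>y. 1 / (1 + T * \<bar>x - y\<bar>) ^ M * smoothed K T \<mu> y \<partial>lborel)
      \<le> (\<integral>y. B * (T / (1 + \<bar>T * (y - x)\<bar>) ^ 2) \<partial>lborel)"
  proof (rule integral_mono)
    show "integrable lborel (\<lambda>y. 1 / (1 + T * \<bar>x - y\<bar>) ^ M * smoothed K T \<mu> y)"
    proof (rule smoothed_Fubini(1)[OF \<mu> T(1)])
      show "\<bar>1 / (1 + T * \<bar>x - y\<bar>) ^ M\<bar> \<le> 1" for y
        using inverse_one_plus_power_le_one[of "T * \<bar>x - y\<bar>" M] T by simp
    qed measurable
    show "integrable lborel (\<lambda>y. B * (T / (1 + \<bar>T * (y - x)\<bar>) ^ 2))"
      by (intro integrable_mult_right envelope_scaled T)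
    fix y
    have "1 / (1 + T * \<bar>x - y\<bar>) ^ M * smoothed K T \<mu> y \<le> 1 / (1 + T * \<bar>x - y\<bar>) ^ M * (Q / (1 + \<bar>y\<bar>) ^ k)"
      using T by (intro mult_left_mono Q) auto
    also have "\<dots> = Q * (1 / (1 + T * \<bar>x - y\<bar>) ^ M * (1 / (1 + \<bar>y\<bar>) ^ k))" by simp
    also have "\<dots> \<le> Q * ((1 + \<tau>) ^ k / (1 + \<bar>x\<bar>) ^ k * (1 / (1 + \<bar>T * (y - x)\<bar>) ^ 2))"
      by (intro mult_left_mono envelope_convolution T k Q0)
    also have "\<dots> = B * (T / (1 + \<bar>T * (y - x)\<bar>) ^ 2)" using T by (simp add: B_def)
    finally show "1 / (1 + T * \<bar>x - y\<bar>) ^ M * smoothed K T \<mu> y \<le> B * (T / (1 + \<bar>T * (y - x)\<bar>) ^ 2)" .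
  qed
  also have "\<dots> = B * envelope_mass"
    by (subst integral_mult_right_zero) (simp add: envelope_scaled[OF T(1)])
  finally have "C * envelope_mass * 2 ^ M / (2 * c) * (\<integral>y. 1 / (1 + T * \<bar>x - y\<bar>) ^ M * smoothed K T \<mu> y \<partial>lborel)
      \<le> C * envelope_mass * 2 ^ M / (2 * c) * (B * envelope_mass)"
    using c_pos C_nonneg envelope_mass_nonneg by (intro mult_left_mono) auto
  with cdf_minus_smoothed[OF \<mu> T(1), of x] show ?thesis
    by (simp add: B_def power2_eq_square mult_ac)
qed

text \<open>The normal density decays faster than any power; Peetre's inequality hands this decay to
  the convolution, with \<open>k\<close> powers of \<open>K\<close> paying for the shift.\<close>

lemma smoothed_normal_le:
  assumes T: "T > 0" "1 / T \<le> \<tau>" and k: "k \<le> M"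
  shows "smoothed K T std_normal_distribution y \<le> fact k * exp 2 * (1 + \<tau>) ^ k * C * envelope_mass / (1 + \<bar>y\<bar>) ^ k"
proof -
  have \<tau>: "0 \<le> \<tau>" using T by (smt (verit) divide_pos_pos)
  define B where "B = fact k * exp 2 * (1 + \<tau>) ^ k * C / (1 + \<bar>y\<bar>) ^ k"
  have b: "std_normal_density z * (T * K (T * (y - z))) \<le> B * (T / (1 + \<bar>T * (z - y)\<bar>) ^ 2)" for z
  proof -
    define u where "u = \<bar>T * (y - z)\<bar>"
    have u: "0 \<le> u" by (simp add: u_def)
    have "(1 + \<bar>y\<bar>) ^ k \<le> ((1 + \<tau>) ^ k * (1 + u) ^ k) * (1 + \<bar>z\<bar>) ^ k"
      using peetre_scaled[OF T, of y k z] T by (simp add: u_def abs_mult)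
    then have "fact k * exp 2 / (1 + \<bar>z\<bar>) ^ k \<le> fact k * exp 2 * (((1 + \<tau>) ^ k * (1 + u) ^ k) / (1 + \<bar>y\<bar>) ^ k)"
      by (simp add: divide_simps mult_ac)
    with std_normal_density_le[of z k]
    have 2: "std_normal_density z \<le> fact k * exp 2 * (1 + \<tau>) ^ k / (1 + \<bar>y\<bar>) ^ k * (1 + u) ^ k" by simp
    have "K (T * (y - z)) * (1 + u) ^ k \<le> K (T * (y - z)) * (1 + u) ^ M"
      using u k by (intro mult_left_mono power_increasing K_nonneg) auto
    also have "\<dots> \<le> C / (1 + u) ^ 2" unfolding u_def by (rule K_le)
    finally have 3: "T * (K (T * (y - z)) * (1 + u) ^ k) \<le> T * (C / (1 + u) ^ 2)"
      using T by (intro mult_left_mono) auto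
    have "std_normal_density z * (T * K (T * (y - z))) \<le>
        fact k * exp 2 * (1 + \<tau>) ^ k / (1 + \<bar>y\<bar>) ^ k * (1 + u) ^ k * (T * K (T * (y - z)))"
      using T K_nonneg by (intro mult_right_mono 2) auto
    also have "\<dots> = fact k * exp 2 * (1 + \<tau>) ^ k / (1 + \<bar>y\<bar>) ^ k * (T * (K (T * (y - z)) * (1 + u) ^ k))" by simp
    also have "\<dots> \<le> fact k * exp 2 * (1 + \<tau>) ^ k / (1 + \<bar>y\<bar>) ^ k * (T * (C / (1 + u) ^ 2))"
      using \<tau> by (intro mult_left_mono 3) auto
    also have "\<dots> = B * (T / (1 + u) ^ 2)" by (simp add: B_def)
    also have "u = \<bar>T * (z - y)\<bar>" by (simp add: u_def abs_mult abs_minus_commute)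
    finally show ?thesis .
  qed
  have "smoothed K T std_normal_distribution y = (\<integral>z. std_normal_density z * (T * K (T * (y - z))) \<partial>lborel)"
    unfolding smoothed_def by (subst integral_density) auto
  also have "\<dots> \<le> (\<integral>z. B * (T / (1 + \<bar>T * (z - y)\<bar>) ^ 2) \<partial>lborel)"
  proof (rule integral_mono)
    show "integrable lborel (\<lambda>z. B * (T / (1 + \<bar>T * (z - y)\<bar>) ^ 2))"
      by (intro integrable_mult_right envelope_scaled T)
    then show "integrable lborel (\<lambda>z. std_normal_density z * (T * K (T * (y - z))))"
    proof (rule Bochner_Integration.integrable_bound)
      show "AE z in lborel. norm (std_normal_density z * (T * K (T * (y - z)))) \<le> norm (B * (T / (1 + \<bar>T * (z - y)\<bar>) ^ 2))"
      proof (rule AE_I2)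
        fix z
        have "0 \<le> std_normal_density z * (T * K (T * (y - z)))" using T K_nonneg by simp
        with b[of z] show "norm (std_normal_density z * (T * K (T * (y - z)))) \<le> norm (B * (T / (1 + \<bar>T * (z - y)\<bar>) ^ 2))"
          unfolding real_norm_def by linarith
      qed
    qed measurable
  qed (rule b)
  also have "\<dots> = B * envelope_mass"
    by (subst integral_mult_right_zero) (simp add: envelope_scaled[OF T(1)])
  finally show ?thesis by (simp add: B_def)
qed

lemma smoothed_total:
  assumes "real_distribution \<mu>" "T > 0"
  shows "integrable lborel (smoothed K T \<mu>)" "(\<integral>y. smoothed K T \<mu> y \<partial>lborel) = \<kappa>"
proof -
  interpret real_distribution \<mu> by fact
  show "integrable lborel (smoothed K T \<mu>)"
    using smoothed_Fubini(1)[OF assms, of "\<lambda>_. 1"] by simp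
  have "(\<integral>y. smoothed K T \<mu> y \<partial>lborel) = (\<integral>z. (\<integral>y. T * K (T * (y - z)) \<partial>lborel) \<partial>\<mu>)"
    using smoothed_Fubini(2)[OF assms, of "\<lambda>_. 1"] by simp
  also have "\<dots> = \<kappa>"
    unfolding K_scaled(2)[OF assms(2)] using prob_space by simp
  finally show "(\<integral>y. smoothed K T \<mu> y \<partial>lborel) = \<kappa>" .
qed

text \<open>Both smoothed measures have mass \<open>\<kappa>\<close>, so the difference of the
  densities integrates to 0. For \<open>x > 0\<close> the integral over \<open>{..x}\<close> is thus
  minus the one over \<open>{x<..}\<close>, which sees only the far tail of the bound.\<close>

lemma smoothed_cdf_diff:
  assumes \<mu>: "real_distribution \<mu>" and \<gamma>: "real_distribution \<gamma>" and T: "T > 0" and m: "m \<ge> 1"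
    and p: "\<And>y. \<bar>smoothed K T \<mu> y - smoothed K T \<gamma> y\<bar> \<le> \<eta> / (1 + \<bar>y\<bar>) ^ (m + 1)"
  shows "\<bar>(\<integral>y. indicator {..x} y * smoothed K T \<mu> y \<partial>lborel) - (\<integral>y. indicator {..x} y * smoothed K T \<gamma> y \<partial>lborel)\<bar>
    \<le> \<eta> / (1 + \<bar>x\<bar>) ^ m"
proof -
  let ?p = "\<lambda>y. smoothed K T \<mu> y - smoothed K T \<gamma> y"
  have \<eta>: "0 \<le> \<eta>" using p[of 0] by simp
  have i: "integrable lborel ?p" using smoothed_total[OF \<mu> T] smoothed_total[OF \<gamma> T] by simp
  have i': "integrable lborel (\<lambda>y. indicator S y * ?p y)" if "S \<in> sets borel" for S
    using integrable_mult_indicator[OF _ i, of S] that by simp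
  have bound: "\<bar>\<integral>y. indicator S y * ?p y \<partial>lborel\<bar> \<le> \<eta> / (1 + \<bar>x\<bar>) ^ m"
    if S: "S \<in> sets borel" "S \<subseteq> S'" and e: "integrable lborel (\<lambda>y. indicator S' y / (1 + \<bar>y\<bar>) ^ (m + 1))"
      "(\<integral>y. indicator S' y / (1 + \<bar>y\<bar>) ^ (m + 1) \<partial>lborel) \<le> 1 / (1 + \<bar>x\<bar>) ^ m" for S S'
  proof -
    have "\<bar>\<integral>y. indicator S y * ?p y \<partial>lborel\<bar> \<le> (\<integral>y. \<bar>indicator S y * ?p y\<bar> \<partial>lborel)"
      by (rule integral_abs_bound)
    also have "\<dots> \<le> (\<integral>y. \<eta> * (indicator S' y / (1 + \<bar>y\<bar>) ^ (m + 1)) \<partial>lborel)"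
    proof (rule integral_mono)
      show "integrable lborel (\<lambda>y. \<eta> * (indicator S' y / (1 + \<bar>y\<bar>) ^ (m + 1)))"
        by (rule integrable_mult_right[OF e(1)])
      show "\<bar>indicator S y * ?p y\<bar> \<le> \<eta> * (indicator S' y / (1 + \<bar>y\<bar>) ^ (m + 1))" for y
        using p[of y] S(2) \<eta> by (auto simp: indicator_def)
    qed (use i'[OF S(1)] in auto)
    also have "\<dots> = \<eta> * (\<integral>y. indicator S' y / (1 + \<bar>y\<bar>) ^ (m + 1) \<partial>lborel)"
      by (rule integral_mult_right_zero)
    also have "\<dots> \<le> \<eta> * (1 / (1 + \<bar>x\<bar>) ^ m)" by (intro mult_left_mono e \<eta>)
    finally show ?thesis by simp
  qed
  have "(\<integral>y. indicator {..x} y * smoothed K T \<mu> y \<partial>lborel) - (\<integral>y. indicator {..x} y * smoothed K T \<gamma> y \<partial>lborel)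
      = (\<integral>y. indicator {..x} y * ?p y \<partial>lborel)" (is "?L = _")
    using integrable_mult_indicator[of "{..x}" lborel, OF _ smoothed_total(1)[OF \<mu> T]]
      integrable_mult_indicator[of "{..x}" lborel, OF _ smoothed_total(1)[OF \<gamma> T]]
    by (subst Bochner_Integration.integral_diff[symmetric]) (auto simp: right_diff_distrib)
  moreover have "\<bar>\<integral>y. indicator {..x} y * ?p y \<partial>lborel\<bar> \<le> \<eta> / (1 + \<bar>x\<bar>) ^ m"
  proof (cases "x \<le> 0")
    case True
    then show ?thesis using bound[OF _ _ envelope_integral_atMost[OF m True]] by simp
  next
    case False
    have "(\<integral>y. indicator {..x} y * ?p y \<partial>lborel) + (\<integral>y. indicator {x<..} y * ?p y \<partial>lborel) = (\<integral>y. ?p y \<partial>lborel)"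
    proof -
      have "(\<lambda>y. indicator {..x} y * ?p y + indicator {x<..} y * ?p y) = ?p"
        by (auto simp: indicator_def fun_eq_iff)
      with Bochner_Integration.integral_add[OF i'[of "{..x}"] i'[of "{x<..}"]] show ?thesis by simp
    qed
    also have "\<dots> = 0"
      using smoothed_total[OF \<mu> T] smoothed_total[OF \<gamma> T] by simp
    finally have "\<bar>\<integral>y. indicator {..x} y * ?p y \<partial>lborel\<bar> = \<bar>\<integral>y. indicator {x<..} y * ?p y \<partial>lborel\<bar>" by linarith
    also have "\<dots> \<le> \<eta> / (1 + \<bar>x\<bar>) ^ m"
    proof (rule bound)
      show "{x<..} \<subseteq> {x..}" by auto
    qed (use False envelope_integral_atLeast[OF m, of x] in auto)
    finally show ?thesis .
  qed
  ultimately show ?thesis by simp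
qed

text \<open>\<open>R\<close> is chosen before \<open>T\<close>, \<open>\<eta>\<close> and
  \<open>\<mu>\<close>. The term \<open>\<eta>\<close> is the distance of the smoothed distribution
  functions, and \<open>(1 + \<eta>) / T\<close> the cost of removing the smoothing from both. The
  removal works with the weight of exponent \<open>m + 1\<close> and needs two more powers, whence
  \<open>m + 3 \<le> M\<close>.\<close>

theorem nonuniform_smoothing:
  assumes m: "m \<ge> 1" "m + 3 \<le> M" and \<tau>: "\<tau> \<ge> 0"
  shows "\<exists>R\<ge>0. \<forall>T \<eta> \<mu>. T > 0 \<longrightarrow> 1 / T \<le> \<tau> \<longrightarrow> real_distribution \<mu> \<longrightarrow>
    (\<forall>y. \<bar>smoothed K T \<mu> y - smoothed K T std_normal_distribution y\<bar> \<le> \<eta> / (1 + \<bar>y\<bar>) ^ (m + 1)) \<longrightarrow>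
    (\<forall>x. \<bar>cdf \<mu> x - std_normal_cdf x\<bar> \<le> R * ((1 + \<eta>) / T + \<eta>) / (1 + \<bar>x\<bar>) ^ m)"
proof -
  define Q where "Q = fact (m + 1) * exp 2 * (1 + \<tau>) ^ (m + 1) * C * envelope_mass"
  define A where "A = C * envelope_mass\<^sup>2 * 2 ^ M / (2 * c) * (1 + \<tau>) ^ (m + 1)"
  have Q: "0 \<le> Q" and A: "0 \<le> A"
    using C_nonneg c_pos envelope_mass_nonneg \<tau> by (auto simp: Q_def A_def)
  define R where "R = (2 * A * (1 + Q) + 1) / \<kappa>"
  have R: "0 \<le> R" using A Q \<kappa>_pos by (simp add: R_def)
  show ?thesis
  proof (intro exI[of _ R] conjI allI impI R)
    fix T \<eta> :: real and \<mu> :: "real measure" and x :: real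
    assume T: "T > 0" "1 / T \<le> \<tau>" and \<mu>: "real_distribution \<mu>"
      and p: "\<forall>y. \<bar>smoothed K T \<mu> y - smoothed K T std_normal_distribution y\<bar> \<le> \<eta> / (1 + \<bar>y\<bar>) ^ (m + 1)"
    note \<gamma> = real_dist_normal_dist
    let ?I = "\<lambda>\<mu>. (\<integral>y. indicator {..x} y * smoothed K T \<mu> y \<partial>lborel)"
    let ?w = "(1 + \<bar>x\<bar>) ^ m"
    have \<eta>: "0 \<le> \<eta>" using p[rule_format, of 0] by simp
    have q\<gamma>: "smoothed K T std_normal_distribution y \<le> Q / (1 + \<bar>y\<bar>) ^ (m + 1)" for y
      unfolding Q_def by (rule smoothed_normal_le) (use T m in auto)
    \<comment> \<open>All that is known a priori about \<open>\<mu>\<close> at scale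
      \<open>1 / T\<close>: the bound for the normal law plus the assumed difference.\<close>
    have q\<mu>: "smoothed K T \<mu> y \<le> (Q + \<eta>) / (1 + \<bar>y\<bar>) ^ (m + 1)" for y
      using q\<gamma>[of y] p[rule_format, of y] unfolding add_divide_distrib by linarith
    have w: "a / (1 + \<bar>x\<bar>) ^ (m + 1) \<le> a / ?w" if "0 \<le> a" for a :: real
      using that by (intro divide_left_mono) (auto intro!: power_increasing)
    have 1: "\<bar>\<kappa> * std_normal_cdf x - ?I std_normal_distribution\<bar> \<le> A * Q / T / ?w"
    proof (rule order_trans)
      show "\<bar>\<kappa> * std_normal_cdf x - ?I std_normal_distribution\<bar> \<le> A * Q / T / (1 + \<bar>x\<bar>) ^ (m + 1)"
        unfolding A_def by (rule cdf_minus_smoothed_le[OF \<gamma> T _ q\<gamma>]) (use m in auto)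
    qed (rule w, use A Q T in auto)
    have 2: "\<bar>\<kappa> * cdf \<mu> x - ?I \<mu>\<bar> \<le> A * (Q + \<eta>) / T / ?w"
    proof (rule order_trans)
      show "\<bar>\<kappa> * cdf \<mu> x - ?I \<mu>\<bar> \<le> A * (Q + \<eta>) / T / (1 + \<bar>x\<bar>) ^ (m + 1)"
        unfolding A_def by (rule cdf_minus_smoothed_le[OF \<mu> T _ q\<mu>]) (use m in auto)
    qed (rule w, use A Q T \<eta> in auto)
    have 3: "\<bar>?I \<mu> - ?I std_normal_distribution\<bar> \<le> \<eta> / ?w"
      by (rule smoothed_cdf_diff) (use \<mu> \<gamma> T m p in auto)
    have "\<kappa> * \<bar>cdf \<mu> x - std_normal_cdf x\<bar> = \<bar>\<kappa> * cdf \<mu> x - \<kappa> * std_normal_cdf x\<bar>"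
      using \<kappa>_pos by (simp add: abs_mult right_diff_distrib[symmetric])
    also have "\<dots> \<le> A * (Q + \<eta>) / T / ?w + A * Q / T / ?w + \<eta> / ?w"
      using 1 2 3 by linarith
    also have "\<dots> = (A * (Q + \<eta>) / T + A * Q / T + \<eta>) / ?w" by (simp add: add_divide_distrib)
    also have "\<dots> \<le> (2 * A * (1 + Q) + 1) * ((1 + \<eta>) / T + \<eta>) / ?w"
    proof (rule divide_right_mono)
      have "A * (Q + \<eta>) + A * Q \<le> (2 * A * (1 + Q) + 1) * (1 + \<eta>)"
        using A Q \<eta> by (simp add: algebra_simps)
      then have "(A * (Q + \<eta>) + A * Q) / T \<le> (2 * A * (1 + Q) + 1) * (1 + \<eta>) / T"
        using T by (intro divide_right_mono) auto
      moreover have "1 * \<eta> \<le> (2 * A * (1 + Q) + 1) * \<eta>"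
        using A Q \<eta> by (intro mult_right_mono) auto
      ultimately show "A * (Q + \<eta>) / T + A * Q / T + \<eta> \<le> (2 * A * (1 + Q) + 1) * ((1 + \<eta>) / T + \<eta>)"
        by (simp add: add_divide_distrib distrib_left)
    qed auto
    finally have "\<bar>cdf \<mu> x - std_normal_cdf x\<bar> \<le> (2 * A * (1 + Q) + 1) * ((1 + \<eta>) / T + \<eta>) / ?w / \<kappa>"
      using \<kappa>_pos by (simp add: pos_le_divide_eq mult_ac)
    then show "\<bar>cdf \<mu> x - std_normal_cdf x\<bar> \<le> R * ((1 + \<eta>) / T + \<eta>) / ?w"
      by (simp add: R_def mult_ac)
  qed
qed

end

section \<open>A nonnegative kernel with compactly supported Fourier transform\<close>

text \<open>The squared modulus of the characteristic function of a Beta distribution on \<open>[0, 1]\<close> is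
  nonnegative and has its Fourier transform supported in \<open>[-1, 1]\<close>; it decays as fast as the
  order to which the density vanishes at the end points permits.\<close>

definition bump :: "nat \<Rightarrow> real \<Rightarrow> real" where
  "bump N s = s ^ N * (1 - s) ^ N"

definition bump_mass :: "nat \<Rightarrow> real" where
  "bump_mass N = (\<integral>s. indicator {0..1} s * bump N s \<partial>lborel)"

definition bump_measure :: "nat \<Rightarrow> real measure" where
  "bump_measure N = density lborel (\<lambda>s. ennreal (indicator {0..1} s * bump N s / bump_mass N))"

definition bump_kernel :: "nat \<Rightarrow> real \<Rightarrow> real" where
  "bump_kernel N v = (cmod (char (bump_measure N) v))\<^sup>2"

lemma bump_borel [measurable]: "bump N \<in> borel_measurable borel"
  unfolding bump_def by measurable

lemma bump_nonneg: "s \<in> {0..1} \<Longrightarrow> 0 \<le> bump N s"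
  by (simp add: bump_def)

lemma bump_integrable: "integrable lborel (\<lambda>s. indicator {0..1} s * bump N s)"
proof -
  have "continuous_on {0..1} (bump N)" unfolding bump_def by (intro continuous_intros)
  from borel_integrable_atLeastAtMost'[OF this] show ?thesis by (simp add: set_integrable_def)
qed

lemma bump_mass_pos: "bump_mass N > 0"
proof -
  have "(\<integral>s. indicator {1/4..3/4::real} s * (1/16) ^ N \<partial>lborel) \<le> bump_mass N"
    unfolding bump_mass_def
  proof (rule integral_mono)
    show "integrable lborel (\<lambda>s. indicator {1/4..3/4::real} s * (1/16) ^ N :: real)"
      using borel_integrable_atLeastAtMost'[of "1/4" "3/4" "\<lambda>_::real. (1/16::real) ^ N"]
      by (simp add: set_integrable_def continuous_on_const)
    show "indicator {1/4..3/4} s * (1/16) ^ N \<le> indicator {0..1} s * bump N s" for s :: real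
    proof (cases "s \<in> {1/4..3/4}")
      case True
      then have "(1/4) * (1/4) \<le> s * (1 - s)" by (intro mult_mono) auto
      then have "(1/16) ^ N \<le> (s * (1 - s)) ^ N" by (intro power_mono) auto
      then show ?thesis using True by (simp add: bump_def power_mult_distrib)
    next
      case False
      then show ?thesis using bump_nonneg[of s N] by (auto simp: indicator_def)
    qed
  qed (rule bump_integrable)
  moreover have "(\<integral>s. indicator {1/4..3/4::real} s * (1/16) ^ N \<partial>lborel) = (1/16) ^ N * (1/2::real)"
    by simp
  ultimately show ?thesis by (smt (verit) zero_less_power divide_pos_pos mult_pos_pos)
qed

lemma bump_density_nonneg: "0 \<le> indicator {0..1} s * bump N s / bump_mass N"
  using bump_nonneg[of s N] bump_mass_pos[of N] by (auto simp: indicator_def)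

lemma real_distribution_bump_measure: "real_distribution (bump_measure N)"
proof -
  have "(\<integral>\<^sup>+s. ennreal (indicator {0..1} s * bump N s / bump_mass N) \<partial>lborel) =
      ennreal (\<integral>s. indicator {0..1} s * bump N s / bump_mass N \<partial>lborel)"
    by (intro nn_integral_eq_integral integrable_divide bump_integrable AE_I2 bump_density_nonneg)
  also have "\<dots> = 1"
    using bump_mass_pos[of N] by (simp add: bump_mass_def)
  finally have "prob_space (bump_measure N)"
    by (intro prob_spaceI) (simp add: bump_measure_def emeasure_density)
  then show ?thesis
    by (simp add: real_distribution_def real_distribution_axioms_def bump_measure_def)
qed

lemma sets_bump_measure [simp, measurable_cong]: "sets (bump_measure N) = sets borel"
  by (simp add: bump_measure_def)

lemma AE_bump_measure: "AE s in bump_measure N. s \<in> {0..1}"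
  unfolding bump_measure_def by (subst AE_density) (auto simp: indicator_def)

text \<open>Stretches \<open>[0, 1]\<close> to \<open>[0, T]\<close> and passes to the gauge
  integral, where integration by parts takes place. \<open>T = 1\<close> serves the decay of the
  kernel, general \<open>T\<close> the smoothed densities.\<close>

lemma integral_bump_measure:
  fixes F :: "real \<Rightarrow> complex"
  assumes F: "continuous_on UNIV F" and T: "T > 0"
  shows "(\<integral>s. F (T * s) \<partial>bump_measure N) =
    integral {0..T} (\<lambda>t. complex_of_real (bump N (t / T)) * F t) / (bump_mass N * T)"
proof -
  have [measurable]: "F \<in> borel_measurable borel"
    using F by (rule borel_measurable_continuous_onI)
  have "(\<integral>s. F (T * s) \<partial>bump_measure N) =
      (\<integral>s. (indicator {0..1} s * bump N s / bump_mass N) *\<^sub>R F (T * s) \<partial>lborel)"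
    unfolding bump_measure_def
    by (rule integral_density) (auto simp: bump_density_nonneg)
  also have "\<dots> = \<bar>1 / T\<bar> *\<^sub>R (\<integral>t. (indicator {0..1} (0 + 1 / T * t) * bump N (0 + 1 / T * t) / bump_mass N) *\<^sub>R F (T * (0 + 1 / T * t)) \<partial>lborel)"
    by (rule lborel_integral_real_affine) (use T in auto)
  also have "(\<integral>t. (indicator {0..1} (0 + 1 / T * t) * bump N (0 + 1 / T * t) / bump_mass N) *\<^sub>R F (T * (0 + 1 / T * t)) \<partial>lborel)
      = (\<integral>t. (1 / complex_of_real (bump_mass N)) * (indicator {0..T} t *\<^sub>R (complex_of_real (bump N (t / T)) * F t)) \<partial>lborel)"
    by (rule Bochner_Integration.integral_cong) (use T in \<open>auto simp: indicator_def scaleR_conv_of_real zero_le_divide_iff\<close>)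
  also have "\<dots> = (1 / complex_of_real (bump_mass N)) * (LINT t:{0..T}|lborel. complex_of_real (bump N (t / T)) * F t)"
    unfolding set_lebesgue_integral_def by (rule integral_mult_right_zero)
  also have "(LINT t:{0..T}|lborel. complex_of_real (bump N (t / T)) * F t) =
      integral {0..T} (\<lambda>t. complex_of_real (bump N (t / T)) * F t)"
    by (rule set_borel_integral_eq_integral, rule borel_integrable_atLeastAtMost')
      (use T in \<open>auto simp: bump_def intro!: continuous_intros continuous_on_subset[OF F]\<close>)
  finally show ?thesis
    using T by (simp add: scaleR_conv_of_real field_simps)
qed

lemma smooth_bound_bump:
  assumes T: "T > 0" "1 / T \<le> \<tau>"
  shows "k \<le> N \<Longrightarrow> smooth_bound {0..T} {0, T} k (\<lambda>_. (2 * real N * \<tau> + 1) ^ k) (\<lambda>t. complex_of_real (bump N (t / T)))"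
proof -
  have \<tau>: "\<tau> \<ge> 0" using T by (smt (verit) divide_pos_pos)
  define G where "G = 2 * real N * \<tau> + 1"
  have G: "G \<ge> 1" using \<tau> by (simp add: G_def)
  \<comment> \<open>A derivative yields two terms of the same form, one exponent lowered by 1, with
    factors \<open>a / T\<close> and \<open>c / T\<close>, each at most \<open>N * \<tau>\<close>.
    Both exponents stay positive at orders below \<open>k\<close>, hence the vanishing at the end
    points. The summand 1 in \<open>G\<close> makes its powers increase, so that
    \<open>G ^ k\<close> also covers the lower orders.\<close>
  have *: "k \<le> a \<Longrightarrow> k \<le> c \<Longrightarrow> a \<le> N \<Longrightarrow> c \<le> N \<Longrightarrow>
      smooth_bound {0..T} {0, T} k (\<lambda>_. G ^ k) (\<lambda>t. complex_of_real ((t / T) ^ a * (1 - t / T) ^ c))" for a c k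
  proof (induction k arbitrary: a c)
    case 0
    show ?case using T
      unfolding smooth_bound.simps norm_of_real by (auto simp: abs_mult power_abs intro!: mult_le_one power_le_one)
  next
    case (Suc k)
    obtain a' c' where ac: "a = Suc a'" "c = Suc c'" using Suc.prems by (meson Suc_le_D)
    let ?u' = "\<lambda>t. (complex_of_real (real a / T)) * complex_of_real ((t / T) ^ a' * (1 - t / T) ^ c)
       + (complex_of_real (- real c / T)) * complex_of_real ((t / T) ^ a * (1 - t / T) ^ c')"
    have d: "((\<lambda>t. complex_of_real ((t / T) ^ a * (1 - t / T) ^ c)) has_vector_derivative ?u' t) (at t within S)" for t S
    proof -
      have "((\<lambda>t. (t / T) ^ a * (1 - t / T) ^ c) has_field_derivative
         (real a / T) * ((t / T) ^ a' * (1 - t / T) ^ c) + (- real c / T) * ((t / T) ^ a * (1 - t / T) ^ c')) (at t within S)"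
      proof -
        have 1: "((\<lambda>t. t / T) has_field_derivative 1 / T) (at t within S)"
          "((\<lambda>t. 1 - t / T) has_field_derivative - 1 / T) (at t within S)"
          using T by (auto intro!: derivative_eq_intros)
        show ?thesis unfolding ac
          by (rule DERIV_cong[OF DERIV_mult[OF DERIV_power_Suc[OF 1(1)] DERIV_power_Suc[OF 1(2)]]])
            (simp add: algebra_simps add_divide_distrib diff_divide_distrib)
      qed
      from has_vector_derivative_of_real[where 'a = complex, OF this] show ?thesis by simp
    qed
    have s: "smooth_bound {0..T} {0, T} k (\<lambda>t. cmod (complex_of_real (real a / T)) * G ^ k + cmod (complex_of_real (- real c / T)) * G ^ k) ?u'"
      using Suc.prems by (intro smooth_bound_add smooth_bound_scale Suc.IH) (auto simp: ac)
    have "real a / T + real c / T \<le> G"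
    proof -
      have "real a * (1 / T) \<le> real N * \<tau>" "real c * (1 / T) \<le> real N * \<tau>"
        by (rule mult_mono; use Suc.prems T \<tau> in simp)+
      then show ?thesis by (simp add: G_def)
    qed
    then have "(real a / T + real c / T) * G ^ k \<le> G * G ^ k"
      using G by (intro mult_right_mono) auto
    then have s': "smooth_bound {0..T} {0, T} k (\<lambda>t. G ^ Suc k) ?u'"
      using s T by (elim smooth_bound_mono) (simp add: distrib_right norm_divide)
    have b: "cmod (complex_of_real ((t / T) ^ a * (1 - t / T) ^ c)) \<le> G ^ Suc k" if "t \<in> {0..T}" for t
    proof -
      have "cmod (complex_of_real ((t / T) ^ a * (1 - t / T) ^ c)) \<le> 1"
        using T that unfolding norm_of_real by (auto simp: abs_mult power_abs intro!: mult_le_one power_le_one)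
      also have "1 \<le> G ^ Suc k" using G by (rule one_le_power)
      finally show ?thesis .
    qed
    show ?case
      unfolding smooth_bound.simps
      by (intro conjI exI[of _ ?u'] ballI d s' b) (use T in \<open>auto simp: ac\<close>)
  qed
  show "k \<le> N \<Longrightarrow> smooth_bound {0..T} {0, T} k (\<lambda>_. (2 * real N * \<tau> + 1) ^ k) (\<lambda>t. complex_of_real (bump N (t / T)))"
    using *[of k N N] by (simp add: G_def bump_def)
qed

lemma char_bump_measure_decay: "\<exists>C\<ge>0. \<forall>v. (1 + \<bar>v\<bar>) ^ N * cmod (char (bump_measure N) v) \<le> C"
proof -
  interpret real_distribution "bump_measure N" by (rule real_distribution_bump_measure)
  define G where "G = (2 * real N + 1) ^ N / bump_mass N"
  have "\<bar>v\<bar> ^ N * cmod (char (bump_measure N) v) \<le> G" for v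
  proof -
    let ?I = "integral {0..1} (\<lambda>t. complex_of_real (bump N (t / 1)) * iexp (- (- v * t)))"
    have "char (bump_measure N) v = (\<integral>s. iexp (v * (1 * s)) \<partial>bump_measure N)" by (simp add: char_def)
    also have "\<dots> = integral {0..1} (\<lambda>t. complex_of_real (bump N (t / 1)) * iexp (v * t)) / (bump_mass N * 1)"
      using integral_bump_measure[of "\<lambda>t. iexp (v * t)" 1 N] by (simp add: continuous_intros)
    finally have 1: "char (bump_measure N) v = ?I / bump_mass N" by simp
    have "\<bar>- v\<bar> ^ N * cmod ?I \<le> integral {0..1} (\<lambda>_::real. (2 * real N * 1 + 1) ^ N)"
      by (rule smooth_bound_fourier[OF smooth_bound_bump])
        (auto simp: bump_def intro!: integrable_continuous_interval continuous_intros)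
    then have "\<bar>v\<bar> ^ N * cmod ?I \<le> (2 * real N + 1) ^ N" by simp
    then show ?thesis unfolding 1 G_def
      using bump_mass_pos[of N] by (simp add: norm_divide divide_right_mono)
  qed
  then have b: "(1 + \<bar>v\<bar>) ^ N * cmod (char (bump_measure N) v) \<le> 2 ^ N * (1 + G)" for v
  proof -
    have "(1 + \<bar>v\<bar>) ^ N \<le> 2 ^ N * (1 + \<bar>v\<bar> ^ N)" by (rule one_plus_power_le) simp
    then have "(1 + \<bar>v\<bar>) ^ N * cmod (char (bump_measure N) v) \<le> 2 ^ N * (1 + \<bar>v\<bar> ^ N) * cmod (char (bump_measure N) v)"
      by (rule mult_right_mono) simp
    also have "\<dots> = 2 ^ N * (cmod (char (bump_measure N) v) + \<bar>v\<bar> ^ N * cmod (char (bump_measure N) v))"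
      by (simp add: algebra_simps)
    also have "\<dots> \<le> 2 ^ N * (1 + G)"
      using cmod_char_le_1[of v] \<open>\<bar>v\<bar> ^ N * cmod (char (bump_measure N) v) \<le> G\<close>
      by (intro mult_left_mono add_mono) auto
    finally show ?thesis .
  qed
  have "0 \<le> 2 ^ N * (1 + G)" using bump_mass_pos[of N] by (simp add: G_def)
  with b show ?thesis by blast
qed

lemma bump_kernel_nonneg: "0 \<le> bump_kernel N v"
  by (simp add: bump_kernel_def)

lemma bump_kernel_borel [measurable]: "bump_kernel N \<in> borel_measurable borel"
proof -
  interpret real_distribution "bump_measure N" by (rule real_distribution_bump_measure)
  show ?thesis unfolding bump_kernel_def by measurable
qed

lemma bump_kernel_decay: "\<exists>C\<ge>0. \<forall>v. bump_kernel N v \<le> C / (1 + \<bar>v\<bar>) ^ (2 * N)"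
proof -
  obtain C where C: "C \<ge> 0" "\<And>v. (1 + \<bar>v\<bar>) ^ N * cmod (char (bump_measure N) v) \<le> C"
    using char_bump_measure_decay[of N] by blast
  have "bump_kernel N v \<le> C\<^sup>2 / (1 + \<bar>v\<bar>) ^ (2 * N)" for v
  proof -
    have "((1 + \<bar>v\<bar>) ^ N * cmod (char (bump_measure N) v))\<^sup>2 \<le> C\<^sup>2"
      using C by (intro power_mono) auto
    then have "bump_kernel N v * (1 + \<bar>v\<bar>) ^ (2 * N) \<le> C\<^sup>2"
      by (simp add: bump_kernel_def power_mult_distrib power_mult[symmetric] mult.commute)
    then show ?thesis by (subst pos_le_divide_eq) auto
  qed
  then show ?thesis by (intro exI[of _ "C\<^sup>2"]) auto
qed

text \<open>The measure lives on \<open>[0, 1]\<close>, so for \<open>|v| \<le> 1\<close> the phase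
  \<open>v * s\<close> stays in \<open>[-1, 1]\<close> and the real part of the characteristic
  function is at least \<open>cos 1\<close>.\<close>

lemma bump_kernel_lower: "\<bar>v\<bar> \<le> 1 \<Longrightarrow> (cos 1)\<^sup>2 \<le> bump_kernel N v"
proof -
  assume v: "\<bar>v\<bar> \<le> 1"
  interpret real_distribution "bump_measure N" by (rule real_distribution_bump_measure)
  have "cos 1 = (\<integral>s. cos 1 \<partial>bump_measure N)" by (simp add: prob_space[unfolded space_eq_univ])
  also have "\<dots> \<le> (\<integral>s. cos (v * s) \<partial>bump_measure N)"
  proof (rule integral_mono_AE)
    show "integrable (bump_measure N) (\<lambda>s. cos (v * s))"
      by (rule integrable_const_bound[of _ 1]) auto
    show "AE s in bump_measure N. cos 1 \<le> cos (v * s)"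
      using AE_bump_measure
    proof eventually_elim
      case (elim s)
      have "\<bar>v * s\<bar> \<le> 1" using v elim by (auto simp: abs_mult intro: mult_le_one)
      then have "cos 1 \<le> cos \<bar>v * s\<bar>"
        by (intro cos_monotone_0_pi_le) (use pi_gt3 in auto)
      then show ?case by simp
    qed
  qed auto
  also have "\<dots> = Re (char (bump_measure N) v)"
    unfolding char_def by (subst integral_Re[symmetric]) (auto simp: integrable_iexp Re_exp)
  also have "\<dots> \<le> cmod (char (bump_measure N) v)" by (rule complex_Re_le_cmod)
  finally show ?thesis unfolding bump_kernel_def
    by (intro power_mono cos_ge_zero) (use pi_gt3 in auto)
qed

lemma cos_one_pos: "(0::real) < (cos 1)\<^sup>2"
  using cos_gt_zero[of 1] pi_gt3 by (simp add: field_simps)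

section \<open>Fourier representation of the smoothed density\<close>

lemma (in real_distribution) norm_integral_le:
  fixes f :: "real \<Rightarrow> complex"
  assumes "f \<in> borel_measurable borel" "AE s in M. cmod (f s) \<le> B"
  shows "cmod (\<integral>s. f s \<partial>M) \<le> B"
proof -
  have "integrable M f" by (rule integrable_const_bound[OF assms(2)]) (use assms in simp)
  have "cmod (\<integral>s. f s \<partial>M) \<le> (\<integral>s. cmod (f s) \<partial>M)" by (rule integral_norm_bound)
  also have "\<dots> \<le> (\<integral>s. B \<partial>M)"
    by (rule integral_mono_AE) (use \<open>integrable M f\<close> assms in auto)
  finally show ?thesis using prob_space by simp
qed

lemma Fubini_bounded:
  fixes F :: "real \<Rightarrow> real \<Rightarrow> complex"
  assumes "real_distribution A" "real_distribution B"
    and F: "case_prod F \<in> borel_measurable (borel \<Otimes>\<^sub>M borel)" and b: "\<And>x y. cmod (F x y) \<le> 1"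
  shows "(\<integral>x. (\<integral>y. F x y \<partial>B) \<partial>A) = (\<integral>y. (\<integral>x. F x y \<partial>A) \<partial>B)"
proof -
  interpret A: real_distribution A by fact
  interpret B: real_distribution B by fact
  interpret pair_prob_space A B ..
  have [measurable]: "case_prod F \<in> borel_measurable (A \<Otimes>\<^sub>M B)"
    using F by (simp cong: measurable_cong_sets)
  have "integrable (A \<Otimes>\<^sub>M B) (case_prod F)"
    by (rule P.integrable_const_bound[of _ 1]) (use b in auto)
  from Fubini_integral[OF this] show ?thesis by simp
qed

text \<open>A characteristic function times its conjugate is a double average of the characters
  \<open>exp (i v (s' - s))\<close>. Integration against \<open>\<mu>\<close> turns each of them
  into a value of \<open>char \<mu>\<close> at \<open>T (s - s')\<close>; since \<open>s\<close> and
  \<open>s'\<close> lie in \<open>[0, 1]\<close> almost surely, only frequencies in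
  \<open>[-T, T]\<close> enter.\<close>

lemma smoothed_bump_kernel:
  assumes \<mu>: "real_distribution \<mu>"
  shows "complex_of_real (smoothed (bump_kernel N) T \<mu> x) =
    T * (\<integral>s'. (\<integral>s. iexp (- (T * x * (s - s'))) * char \<mu> (T * (s - s')) \<partial>bump_measure N) \<partial>bump_measure N)"
proof -
  let ?\<rho> = "bump_measure N"
  note \<rho> = real_distribution_bump_measure[of N]
  interpret \<mu>: real_distribution \<mu> by fact
  interpret \<rho>: real_distribution ?\<rho> by fact
  define F where "F z s' s = iexp (- (T * x * (s - s'))) * iexp (T * (s - s') * z)" for z s' s :: real
  have nF: "cmod (F z s' s) = 1" for z s' s by (simp add: F_def norm_mult)
  have K: "complex_of_real (bump_kernel N (T * (x - z))) = (\<integral>s'. (\<integral>s. F z s' s \<partial>?\<rho>) \<partial>?\<rho>)" for z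
  proof -
    let ?v = "T * (x - z)"
    have cnj: "cnj (char ?\<rho> ?v) = (\<integral>s. iexp (- (?v * s)) \<partial>?\<rho>)"
      unfolding char_def by (subst Bochner_Integration.integral_cnj[symmetric]) (simp add: exp_cnj)
    have F': "F z s' s = iexp (?v * s') * iexp (- (?v * s))" for s' s
      unfolding F_def exp_add[symmetric] by (rule arg_cong[where f = exp]) (simp add: algebra_simps)
    have "complex_of_real (bump_kernel N ?v) = char ?\<rho> ?v * cnj (char ?\<rho> ?v)"
      unfolding bump_kernel_def by (rule complex_norm_square)
    also have "\<dots> = (\<integral>s'. iexp (?v * s') \<partial>?\<rho>) * (\<integral>s. iexp (- (?v * s)) \<partial>?\<rho>)"
      unfolding cnj by (simp add: char_def)
    also have "\<dots> = (\<integral>s'. iexp (?v * s') * (\<integral>s. iexp (- (?v * s)) \<partial>?\<rho>) \<partial>?\<rho>)"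
      by (rule integral_mult_left_zero[symmetric])
    also have "\<dots> = (\<integral>s'. (\<integral>s. F z s' s \<partial>?\<rho>) \<partial>?\<rho>)"
      unfolding F' by (subst integral_mult_right_zero) (rule refl)
    finally show ?thesis .
  qed
  have [measurable]: "(\<lambda>p. F (f p) (g p) (h p)) \<in> borel_measurable M"
    if [measurable]: "f \<in> borel_measurable M" "g \<in> borel_measurable M" "h \<in> borel_measurable M" for f g h and M :: "'b measure"
    unfolding F_def by measurable
  have "complex_of_real (smoothed (bump_kernel N) T \<mu> x) = (\<integral>z. T * complex_of_real (bump_kernel N (T * (x - z))) \<partial>\<mu>)"
    unfolding smoothed_def by (subst integral_complex_of_real[symmetric]) simp
  also have "\<dots> = T * (\<integral>z. (\<integral>s'. (\<integral>s. F z s' s \<partial>?\<rho>) \<partial>?\<rho>) \<partial>\<mu>)"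
    unfolding K by (rule integral_mult_right_zero)
  also have "(\<integral>z. (\<integral>s'. (\<integral>s. F z s' s \<partial>?\<rho>) \<partial>?\<rho>) \<partial>\<mu>) = (\<integral>s'. (\<integral>z. (\<integral>s. F z s' s \<partial>?\<rho>) \<partial>\<mu>) \<partial>?\<rho>)"
    by (rule Fubini_bounded[OF \<mu> \<rho>]) (auto intro!: \<rho>.norm_integral_le simp: nF)
  also have "\<dots> = (\<integral>s'. (\<integral>s. (\<integral>z. F z s' s \<partial>\<mu>) \<partial>?\<rho>) \<partial>?\<rho>)"
    by (intro Bochner_Integration.integral_cong refl Fubini_bounded[OF \<mu> \<rho>]) (auto simp: nF)
  also have "\<dots> = (\<integral>s'. (\<integral>s. iexp (- (T * x * (s - s'))) * char \<mu> (T * (s - s')) \<partial>?\<rho>) \<partial>?\<rho>)"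
    unfolding F_def char_def by (subst integral_mult_right_zero) (rule refl)
  finally show ?thesis .
qed

lemma integral_envelope_le:
  assumes "D \<ge> 0"
  shows "(\<lambda>t. D / (1 + \<bar>t - a\<bar>) ^ 2) integrable_on {0..T}"
    and "integral {0..T} (\<lambda>t. D / (1 + \<bar>t - a\<bar>) ^ 2) \<le> D * envelope_mass"
proof -
  have "integrable lborel (\<lambda>t. D * (1 / (1 + \<bar>1 * (t - a)\<bar>) ^ 2))"
    by (intro integrable_mult_right envelope_scaled) simp
  from has_integral_integral_lborel[OF this]
  have h: "((\<lambda>t. D / (1 + \<bar>t - a\<bar>) ^ 2) has_integral D * envelope_mass) UNIV"
    unfolding integral_mult_right_zero envelope_scaled(2)[of 1 a, OF zero_less_one] by simp
  show i: "(\<lambda>t. D / (1 + \<bar>t - a\<bar>) ^ 2) integrable_on {0..T}"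
    by (rule integrable_continuous_interval) (auto intro!: continuous_intros)
  show "integral {0..T} (\<lambda>t. D / (1 + \<bar>t - a\<bar>) ^ 2) \<le> D * envelope_mass"
    using integral_subset_le[of "{0..T}" UNIV "\<lambda>t. D / (1 + \<bar>t - a\<bar>) ^ 2"] i h assms
    by (auto simp: has_integral_iff)
qed

text \<open>For fixed \<open>s'\<close>, the substitution \<open>t = T s\<close> makes the inner
  average a Fourier integral over \<open>[0, T]\<close> of the bump times the difference of the
  characteristic functions shifted by \<open>a = T s'\<close>. The shifted argument stays in
  \<open>[-T, T]\<close>, the bump removes the boundary terms, and the normalisation
  \<open>1 / T\<close> cancels the prefactor. The bound is uniform in \<open>s'\<close> and survives
  the outer average. In the constant, \<open>2 ^ j\<close> is due to Leibniz and the other power to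
  the bump.\<close>

lemma smoothed_diff_moment:
  assumes T: "T > 0" "1 / T \<le> \<tau>" and \<mu>: "real_distribution \<mu>" and \<gamma>: "real_distribution \<gamma>"
    and D: "D \<ge> 0" and j: "j \<le> N"
    and d: "smooth_bound {-T..T} {} j (\<lambda>t. D / (1 + \<bar>t\<bar>) ^ 2) (\<lambda>t. char \<mu> t - char \<gamma> t)"
  shows "\<bar>x\<bar> ^ j * \<bar>smoothed (bump_kernel N) T \<mu> x - smoothed (bump_kernel N) T \<gamma> x\<bar>
    \<le> (2 * (2 * real N * \<tau> + 1)) ^ j * envelope_mass / bump_mass N * D"
proof -
  let ?\<rho> = "bump_measure N"
  interpret \<mu>: real_distribution \<mu> by fact
  interpret \<gamma>: real_distribution \<gamma> by fact
  interpret \<rho>: real_distribution ?\<rho> by (rule real_distribution_bump_measure)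
  define G where "G = (2 * (2 * real N * \<tau> + 1)) ^ j"
  have \<tau>: "0 \<le> \<tau>" using T by (smt (verit) divide_pos_pos)
  have G: "0 \<le> G" using \<tau> by (simp add: G_def)
  define \<delta> where "\<delta> t = char \<mu> t - char \<gamma> t" for t
  have \<delta>_cont: "continuous_on UNIV \<delta>"
    unfolding \<delta>_def by (intro continuous_on_diff) (auto simp: continuous_on_eq_continuous_at \<mu>.isCont_char \<gamma>.isCont_char)
  have \<delta>_meas [measurable]: "\<delta> \<in> borel_measurable borel"
    unfolding \<delta>_def by measurable
  define J where "J s' s = iexp (- (T * x * (s - s'))) * \<delta> (T * (s - s'))" for s' s
  have [measurable]: "(\<lambda>p. J (f p) (g p)) \<in> borel_measurable M"
    if [measurable]: "f \<in> borel_measurable M" "g \<in> borel_measurable M" for f g and M :: "'b measure"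
    unfolding J_def by measurable
  have eq: "complex_of_real (smoothed (bump_kernel N) T \<mu> x - smoothed (bump_kernel N) T \<gamma> x)
      = T * (\<integral>s'. (\<integral>s. J s' s \<partial>?\<rho>) \<partial>?\<rho>)"
  proof -
    have b: "cmod (iexp (- (T * x * (s - s'))) * char \<nu> (T * (s - s'))) \<le> 1" if "real_distribution \<nu>" for \<nu> s s'
      using real_distribution.cmod_char_le_1[OF that] by (simp add: norm_mult)
    have i: "integrable ?\<rho> (\<lambda>s. iexp (- (T * x * (s - s'))) * char \<nu> (T * (s - s')))"
      "integrable ?\<rho> (\<lambda>s'. \<integral>s. iexp (- (T * x * (s - s'))) * char \<nu> (T * (s - s')) \<partial>?\<rho>)" if \<nu>: "real_distribution \<nu>" for \<nu> s'
    proof -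
      interpret \<nu>: real_distribution \<nu> by fact
      have [measurable]: "(\<lambda>s. iexp (- (T * x * (s - s'))) * char \<nu> (T * (s - s'))) \<in> borel_measurable borel" for s'
        by measurable
      have "(\<lambda>s'. \<integral>s. iexp (- (T * x * (s - s'))) * char \<nu> (T * (s - s')) \<partial>?\<rho>) \<in> borel_measurable borel"
        by measurable
      then show "integrable ?\<rho> (\<lambda>s'. \<integral>s. iexp (- (T * x * (s - s'))) * char \<nu> (T * (s - s')) \<partial>?\<rho>)"
        by (intro \<rho>.integrable_const_bound[of _ 1] AE_I2 \<rho>.norm_integral_le b \<nu>) simp_all
      show "integrable ?\<rho> (\<lambda>s. iexp (- (T * x * (s - s'))) * char \<nu> (T * (s - s')))"
        by (intro \<rho>.integrable_const_bound[of _ 1] AE_I2 b \<nu>) measurable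
    qed
    show ?thesis
      unfolding of_real_diff smoothed_bump_kernel[OF \<mu>] smoothed_bump_kernel[OF \<gamma>] J_def \<delta>_def right_diff_distrib
      using i[OF \<mu>] i[OF \<gamma>] by (simp add: Bochner_Integration.integral_diff right_diff_distrib)
  qed
  have inner: "\<bar>x\<bar> ^ j * cmod (\<integral>s. J s' s \<partial>?\<rho>) \<le> G * envelope_mass / bump_mass N * D / T" if s': "s' \<in> {0..1}" for s'
  proof -
    define a where "a = T * s'"
    let ?u = "\<lambda>t. complex_of_real (bump N (t / T)) * \<delta> (t - a)"
    have a: "0 \<le> a" "a \<le> T" using s' T by (auto simp: a_def mult_left_le)
    have cont: "continuous_on S (\<lambda>t. \<delta> (t - a))" for S
      by (rule continuous_on_compose2[OF \<delta>_cont]) (auto intro!: continuous_intros)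
    have "smooth_bound {0..T} {0, T} j (\<lambda>t. 2 ^ j * ((2 * real N * \<tau> + 1) ^ j * (D / (1 + \<bar>t - a\<bar>) ^ 2))) ?u"
      using d by (intro smooth_bound_mult smooth_bound_bump T j smooth_bound_shift[where w = "\<lambda>t. D / (1 + \<bar>t\<bar>) ^ 2" and I = "{-T..T}"])
        (use a in \<open>auto simp: \<delta>_def[abs_def]\<close>)
    then have s: "smooth_bound {0..T} {0, T} j (\<lambda>t. G * D / (1 + \<bar>t - a\<bar>) ^ 2) ?u"
      by (rule smooth_bound_mono) (unfold G_def power_mult_distrib, simp)
    have "\<bar>x\<bar> ^ j * cmod (integral {0..T} (\<lambda>t. ?u t * iexp (- (x * t)))) \<le> integral {0..T} (\<lambda>t. G * D / (1 + \<bar>t - a\<bar>) ^ 2)"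
      by (rule smooth_bound_fourier[OF s])
        (use T D G in \<open>auto simp: bump_def intro!: integrable_continuous_interval integral_envelope_le continuous_intros cont\<close>)
    also have "\<dots> \<le> G * D * envelope_mass"
      by (rule integral_envelope_le) (use D G in auto)
    finally have I: "\<bar>x\<bar> ^ j * cmod (integral {0..T} (\<lambda>t. ?u t * iexp (- (x * t)))) \<le> G * D * envelope_mass" .
    have "(\<integral>s. J s' s \<partial>?\<rho>) = (\<integral>s. iexp (x * a) * (iexp (- (x * (T * s))) * \<delta> (T * s - a)) \<partial>?\<rho>)"
    proof (rule Bochner_Integration.integral_cong)
      fix s
      have "iexp (- (T * x * (s - s'))) = iexp (x * a) * iexp (- (x * (T * s)))"
        unfolding exp_add[symmetric] by (rule arg_cong[where f = exp]) (simp add: a_def algebra_simps)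
      then show "J s' s = iexp (x * a) * (iexp (- (x * (T * s))) * \<delta> (T * s - a))"
        by (simp add: J_def a_def right_diff_distrib)
    qed auto
    also have "\<dots> = iexp (x * a) * (\<integral>s. iexp (- (x * (T * s))) * \<delta> (T * s - a) \<partial>?\<rho>)"
      by (rule integral_mult_right_zero)
    also have "(\<integral>s. iexp (- (x * (T * s))) * \<delta> (T * s - a) \<partial>?\<rho>) =
        integral {0..T} (\<lambda>t. complex_of_real (bump N (t / T)) * (iexp (- (x * t)) * \<delta> (t - a))) / (bump_mass N * T)"
      by (rule integral_bump_measure[of "\<lambda>t. iexp (- (x * t)) * \<delta> (t - a)"])
        (auto intro!: continuous_intros cont T)
    also have "(\<lambda>t. complex_of_real (bump N (t / T)) * (iexp (- (x * t)) * \<delta> (t - a))) = (\<lambda>t. ?u t * iexp (- (x * t)))"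
      by (simp add: mult_ac)
    finally have "cmod (\<integral>s. J s' s \<partial>?\<rho>) = cmod (integral {0..T} (\<lambda>t. ?u t * iexp (- (x * t)))) / (bump_mass N * T)"
      using T bump_mass_pos[of N] by (simp add: norm_mult norm_divide)
    then have "\<bar>x\<bar> ^ j * cmod (\<integral>s. J s' s \<partial>?\<rho>) = (\<bar>x\<bar> ^ j * cmod (integral {0..T} (\<lambda>t. ?u t * iexp (- (x * t))))) / (bump_mass N * T)"
      by simp
    also have "\<dots> \<le> G * D * envelope_mass / (bump_mass N * T)"
      using I T bump_mass_pos[of N] by (intro divide_right_mono) auto
    finally show ?thesis by (simp add: mult_ac)
  qed
  have "cmod (\<integral>s'. (complex_of_real (\<bar>x\<bar> ^ j)) * (\<integral>s. J s' s \<partial>?\<rho>) \<partial>?\<rho>) \<le> G * envelope_mass / bump_mass N * D / T"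
  proof (rule \<rho>.norm_integral_le)
    show "AE s' in ?\<rho>. cmod ((complex_of_real (\<bar>x\<bar> ^ j)) * (\<integral>s. J s' s \<partial>?\<rho>)) \<le> G * envelope_mass / bump_mass N * D / T"
      using AE_bump_measure by eventually_elim (use inner in \<open>auto simp: norm_mult norm_power\<close>)
  qed measurable
  also have "(\<integral>s'. (complex_of_real (\<bar>x\<bar> ^ j)) * (\<integral>s. J s' s \<partial>?\<rho>) \<partial>?\<rho>) = complex_of_real (\<bar>x\<bar> ^ j) * (\<integral>s'. (\<integral>s. J s' s \<partial>?\<rho>) \<partial>?\<rho>)"
    by (rule integral_mult_right_zero)
  finally have "\<bar>x\<bar> ^ j * cmod (\<integral>s'. (\<integral>s. J s' s \<partial>?\<rho>) \<partial>?\<rho>) \<le> G * envelope_mass / bump_mass N * D / T"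
    by (simp add: norm_mult norm_power)
  then have "\<bar>x\<bar> ^ j * (T * cmod (\<integral>s'. (\<integral>s. J s' s \<partial>?\<rho>) \<partial>?\<rho>)) \<le> G * envelope_mass / bump_mass N * D"
    using mult_left_mono[of _ _ T] T by (fastforce simp: mult_ac)
  moreover have "\<bar>smoothed (bump_kernel N) T \<mu> x - smoothed (bump_kernel N) T \<gamma> x\<bar> = T * cmod (\<integral>s'. (\<integral>s. J s' s \<partial>?\<rho>) \<partial>?\<rho>)"
    using arg_cong[OF eq, of cmod] T unfolding norm_of_real by (simp add: norm_mult)
  ultimately show ?thesis by (simp add: G_def)
qed

text \<open>The moment bounds of orders 0 and \<open>k\<close> are merged by
  \<open>one_plus_power_le\<close>, the source of the factor \<open>2 ^ k\<close>.\<close>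

lemma smoothed_diff_le:
  assumes T: "T > 0" "1 / T \<le> \<tau>" and \<mu>: "real_distribution \<mu>" and \<gamma>: "real_distribution \<gamma>"
    and D: "D \<ge> 0" and k: "k \<le> N"
    and d: "smooth_bound {-T..T} {} k (\<lambda>t. D / (1 + \<bar>t\<bar>) ^ 2) (\<lambda>t. char \<mu> t - char \<gamma> t)"
  shows "\<bar>smoothed (bump_kernel N) T \<mu> x - smoothed (bump_kernel N) T \<gamma> x\<bar>
    \<le> 2 ^ k * (1 + (2 * (2 * real N * \<tau> + 1)) ^ k) * envelope_mass / bump_mass N * D / (1 + \<bar>x\<bar>) ^ k"
proof -
  let ?p = "\<bar>smoothed (bump_kernel N) T \<mu> x - smoothed (bump_kernel N) T \<gamma> x\<bar>"
  let ?B = "envelope_mass / bump_mass N * D" and ?G = "(2 * (2 * real N * \<tau> + 1)) ^ k"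
  have 0: "?p \<le> ?B"
    using smoothed_diff_moment[OF T \<mu> \<gamma> D, of 0 N x] d by (auto dest: smooth_bound_le)
  have 1: "\<bar>x\<bar> ^ k * ?p \<le> ?G * ?B"
    using smoothed_diff_moment[OF T \<mu> \<gamma> D k d, of x] by simp
  have "(1 + \<bar>x\<bar>) ^ k * ?p \<le> 2 ^ k * (1 + \<bar>x\<bar> ^ k) * ?p"
    by (intro mult_right_mono one_plus_power_le) auto
  also have "\<dots> = 2 ^ k * (?p + \<bar>x\<bar> ^ k * ?p)" by (simp add: algebra_simps)
  also have "\<dots> \<le> 2 ^ k * (?B + ?G * ?B)"
    using 0 1 by (intro mult_left_mono add_mono) auto
  also have "\<dots> = 2 ^ k * (1 + ?G) * envelope_mass / bump_mass N * D" by (simp add: algebra_simps add_divide_distrib)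
  finally show ?thesis by (subst pos_le_divide_eq) (auto simp: mult.commute)
qed

section \<open>Characteristic functions under the growth condition\<close>

lemma norm_exp_minus_one_le: "cmod (exp z - 1) \<le> cmod z * exp (cmod z)"
proof -
  have "cmod (exp z - exp 0) \<le> exp (cmod z) * cmod (z - 0)"
  proof (rule field_differentiable_bound[of "cball 0 (cmod z)" exp exp])
    show "cmod (exp w) \<le> exp (cmod z)" if "w \<in> cball 0 (cmod z)" for w
    proof -
      have "cmod (exp w) \<le> exp (cmod w)" by (rule norm_exp)
      also have "\<dots> \<le> exp (cmod z)" using that by simp
      finally show ?thesis .
    qed
  qed (auto intro!: derivative_eq_intros)
  then show ?thesis by (simp add: mult.commute)
qed

text \<open>Recovers the size of a small \<open>z\<close> from \<open>exp z\<close>. The function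
  \<open>exp w - w\<close> has derivative at most \<open>3 |w|\<close> on the unit disc, and three
  times \<open>1 / 6\<close> is \<open>1 / 2\<close>, which leaves half of
  \<open>|z|\<close>.\<close>

lemma norm_exp_minus_one_ge:
  assumes "cmod z \<le> 1 / 6"
  shows "cmod z \<le> 2 * cmod (exp z - 1)"
proof -
  let ?r = "cmod z"
  have e: "exp ?r \<le> 3"
  proof -
    have "exp ?r \<le> exp 1" using assms by simp
    also have "\<dots> \<le> 3" by (rule exp_le)
    finally show ?thesis .
  qed
  have "cmod ((exp z - z) - (exp 0 - 0)) \<le> (?r * 3) * cmod (z - 0)"
  proof (rule field_differentiable_bound[of "cball 0 ?r" "\<lambda>w. exp w - w" "\<lambda>w. exp w - 1"])
    show "cmod (exp w - 1) \<le> ?r * 3" if "w \<in> cball 0 ?r" for w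
    proof -
      have "cmod (exp w - 1) \<le> cmod w * exp (cmod w)" by (rule norm_exp_minus_one_le)
      also have "\<dots> \<le> ?r * exp ?r" using that by (intro mult_mono) auto
      also have "\<dots> \<le> ?r * 3" using e by (intro mult_left_mono) auto
      finally show ?thesis .
    qed
  qed (auto intro!: derivative_eq_intros)
  also have "\<dots> = (3 * ?r) * ?r" by simp
  also have "\<dots> \<le> (1 / 2) * ?r" using assms by (intro mult_right_mono) auto
  finally have "cmod (exp z - 1 - z) \<le> ?r / 2" by (simp add: algebra_simps)
  moreover have "?r \<le> cmod (exp z - 1) + cmod (exp z - 1 - z)"
    using norm_triangle_ineq4[of "exp z - 1" "exp z - 1 - z"] by simp
  ultimately show ?thesis by linarith
qed

text \<open>With two moments the error is \<open>o(t^2)\<close> rather than \<open>O(|t|^3)\<close>: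
  the minimum of \<open>6 x^2\<close> and \<open>|t| |x|^3\<close> is dominated by the former and
  tends to 0 through the latter. Dominated convergence works along sequences, which explains the
  form of the statement.\<close>

lemma (in real_distribution) char_expansion_error:
  assumes "integrable M (\<lambda>x. x)" "expectation (\<lambda>x. x) = 0" "integrable M (\<lambda>x. x\<^sup>2)" "expectation (\<lambda>x. x\<^sup>2) = 1"
    and t: "t \<longlonglongrightarrow> 0"
  shows "\<exists>e. e \<longlonglongrightarrow> 0 \<and> (\<forall>n. cmod (char M (t n) - (1 - (t n)\<^sup>2 / 2)) \<le> (t n)\<^sup>2 * e n)"
proof (intro exI conjI allI)
  let ?e = "\<lambda>n. expectation (\<lambda>x. min (6 * x\<^sup>2) (\<bar>t n\<bar> * \<bar>x\<bar> ^ 3)) / 6"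
  have "(\<lambda>n. expectation (\<lambda>x. min (6 * x\<^sup>2) (\<bar>t n\<bar> * \<bar>x\<bar> ^ 3))) \<longlonglongrightarrow> expectation (\<lambda>x. 0)"
  proof (rule integral_dominated_convergence[where w = "\<lambda>x. 6 * x\<^sup>2"])
    show "AE x in M. (\<lambda>n. min (6 * x\<^sup>2) (\<bar>t n\<bar> * \<bar>x\<bar> ^ 3)) \<longlonglongrightarrow> 0"
    proof (rule AE_I2)
      fix x
      have "(\<lambda>n. min (6 * x\<^sup>2) (\<bar>t n\<bar> * \<bar>x\<bar> ^ 3)) \<longlonglongrightarrow> min (6 * x\<^sup>2) (\<bar>0\<bar> * \<bar>x\<bar> ^ 3)"
        by (intro tendsto_intros t)
      then show "(\<lambda>n. min (6 * x\<^sup>2) (\<bar>t n\<bar> * \<bar>x\<bar> ^ 3)) \<longlonglongrightarrow> 0" by simp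
    qed
    show "integrable M (\<lambda>x. 6 * x\<^sup>2)" using assms by auto
  qed auto
  from tendsto_divide[OF this tendsto_const[of 6]] show "?e \<longlonglongrightarrow> 0" by simp
  fix n
  have v: "variance (\<lambda>x. x) = 1" using assms by simp
  show "cmod (char M (t n) - (1 - (t n)\<^sup>2 / 2)) \<le> (t n)\<^sup>2 * ?e n"
    using char_approx3[OF assms(1-3) v, of "t n"] by simp
qed

text \<open>Mean value inequality on \<open>[-|t|, |t|]\<close>. The factor
  \<open>1 / (k + 1)\<close> of a true integration is given away, so that the same \<open>c\<close>
  persists under iteration.\<close>

lemma power_bound_from_derivative:
  fixes u u' :: "real \<Rightarrow> complex"
  assumes "0 \<le> a" "u 0 = 0" "0 \<le> c"
    and "\<And>t. t \<in> {-a..a} \<Longrightarrow> (u has_vector_derivative u' t) (at t within {-a..a})"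
    and "\<And>t. t \<in> {-a..a} \<Longrightarrow> cmod (u' t) \<le> c * \<bar>t\<bar> ^ k"
    and t: "t \<in> {-a..a}"
  shows "cmod (u t) \<le> c * \<bar>t\<bar> ^ Suc k"
proof -
  let ?S = "{- \<bar>t\<bar>..\<bar>t\<bar>}"
  have S: "?S \<subseteq> {-a..a}" using t by auto
  have "cmod (u t - u 0) \<le> (c * \<bar>t\<bar> ^ k) * norm (t - 0)"
  proof (rule differentiable_bound[of ?S])
    show "(u has_derivative (\<lambda>h. h *\<^sub>R u' x)) (at x within ?S)" if "x \<in> ?S" for x
      using assms(4)[of x] S that unfolding has_vector_derivative_def by (meson has_derivative_subset subsetD)
    show "onorm (\<lambda>h. h *\<^sub>R u' x) \<le> c * \<bar>t\<bar> ^ k" if x: "x \<in> ?S" for x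
    proof -
      have "onorm (\<lambda>h. h *\<^sub>R u' x) \<le> norm (u' x)"
        by (rule onorm_le) (simp add: mult.commute)
      also have "\<dots> \<le> c * \<bar>x\<bar> ^ k" using assms(5) S x by blast
      also have "\<dots> \<le> c * \<bar>t\<bar> ^ k" using x assms by (intro mult_left_mono power_mono) auto
      finally show ?thesis .
    qed
  qed auto
  then show ?thesis using assms by (simp add: mult_ac)
qed

text \<open>Two expansions at 0 are compared. The bounded third derivative gives
  \<open>D0 t = t D1(0) + (t^2/2) D2(0) + O(t^3)\<close>. Mean 0 and variance 1 give
  \<open>exp (D0 t) = (1 - t^2/2 + o(t^2)) exp (t^2/2) = 1 + o(t^2)\<close>, hence
  \<open>D0 t = o(t^2)\<close>. So both coefficients vanish.\<close>

lemma log_char_derivatives_zero: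
  assumes rd: "real_distribution \<mu>"
    and mom: "integrable \<mu> (\<lambda>x. x)" "(\<integral>x. x \<partial>\<mu>) = 0" "integrable \<mu> (\<lambda>x. x\<^sup>2)" "(\<integral>x. x\<^sup>2 \<partial>\<mu>) = 1"
    and a: "0 < a" and c: "0 \<le> c"
    and D0: "D0 0 = 0" "\<And>t. t \<in> {-a..a} \<Longrightarrow> exp (D0 t) = char \<mu> t * exp (t\<^sup>2 / 2)"
    and D: "\<And>t. t \<in> {-a..a} \<Longrightarrow> (D0 has_vector_derivative D1 t) (at t within {-a..a})"
      "\<And>t. t \<in> {-a..a} \<Longrightarrow> (D1 has_vector_derivative D2 t) (at t within {-a..a})"
      "\<And>t. t \<in> {-a..a} \<Longrightarrow> (D2 has_vector_derivative D3 t) (at t within {-a..a})"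
    and D3: "\<And>t. t \<in> {-a..a} \<Longrightarrow> cmod (D3 t) \<le> c"
  shows "D1 0 = 0" "D2 0 = 0"
proof -
  interpret real_distribution \<mu> by fact
  have r2: "cmod (D2 t - D2 0) \<le> c * \<bar>t\<bar> ^ Suc 0" if "t \<in> {-a..a}" for t
    by (rule power_bound_from_derivative[where a = a and u' = "D3"])
      (use that a c D3 in \<open>auto intro!: derivative_eq_intros D\<close>)
  have r1: "cmod (D1 t - D1 0 - t *\<^sub>R D2 0) \<le> c * \<bar>t\<bar> ^ Suc (Suc 0)" if "t \<in> {-a..a}" for t
  proof (rule power_bound_from_derivative[where a = a and u' = "\<lambda>t. D2 t - D2 0"])
    show "((\<lambda>t. D1 t - D1 0 - t *\<^sub>R D2 0) has_vector_derivative D2 t - D2 0) (at t within {-a..a})"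
      if "t \<in> {-a..a}" for t
      using that by (auto intro!: derivative_eq_intros D)
  qed (use that a c r2 in auto)
  have r0: "cmod (D0 t - t *\<^sub>R D1 0 - (t\<^sup>2 / 2) *\<^sub>R D2 0) \<le> c * \<bar>t\<bar> ^ Suc (Suc (Suc 0))" if "t \<in> {-a..a}" for t
  proof (rule power_bound_from_derivative[where a = a and u' = "\<lambda>t. D1 t - D1 0 - t *\<^sub>R D2 0"])
    show "((\<lambda>t. D0 t - t *\<^sub>R D1 0 - (t\<^sup>2 / 2) *\<^sub>R D2 0) has_vector_derivative D1 t - D1 0 - t *\<^sub>R D2 0) (at t within {-a..a})"
      if "t \<in> {-a..a}" for t
      using that by (auto intro!: derivative_eq_intros D)
  qed (use that a c r1 D0 in auto)
  define t where "t n = a / real (Suc n)" for n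
  have t: "t n \<in> {-a..a}" "0 < t n" for n
  proof -
    show "0 < t n" using a by (simp add: t_def)
    moreover have "t n \<le> a / 1" unfolding t_def using a by (intro divide_left_mono) auto
    ultimately show "t n \<in> {-a..a}" using a by simp
  qed
  have t0: "t \<longlonglongrightarrow> 0"
    unfolding t_def using LIMSEQ_Suc[OF lim_const_over_n[of a]] by simp
  obtain e where e: "e \<longlonglongrightarrow> 0" "\<And>n. cmod (char \<mu> (t n) - (1 - (t n)\<^sup>2 / 2)) \<le> (t n)\<^sup>2 * e n"
    using char_expansion_error[OF mom t0] by blast
  define z where "z n = D0 (t n)" for n
  have r: "cmod (z n - t n *\<^sub>R D1 0 - ((t n)\<^sup>2 / 2) *\<^sub>R D2 0) \<le> c * t n ^ 3" for n
    using r0[OF t(1)[of n]] t(2)[of n] by (simp add: z_def numeral_3_eq_3)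
  have "z \<longlonglongrightarrow> D0 0"
    unfolding z_def
    by (rule continuous_within_tendsto_compose'[OF has_vector_derivative_continuous[OF D(1)] _ t0]) (use t a in auto)
  then have z0: "z \<longlonglongrightarrow> 0" by (simp add: D0)
  define E where "E n = exp ((t n)\<^sup>2 / 2)" for n
  \<comment> \<open>The two sources of the \<open>o(t^2)\<close> error: the expansion of the
    characteristic function and that of the Gaussian factor. The 2 comes from
    \<open>norm_exp_minus_one_ge\<close>, which also forces \<open>zq\<close> to hold only
    eventually.\<close>
  define q where "q n = 2 * (e n * E n + \<bar>((1 - (t n)\<^sup>2 / 2) * E n - 1) / (t n)\<^sup>2\<bar>)" for n
  have "((\<lambda>s::real. ((1 - s\<^sup>2 / 2) * exp (s\<^sup>2 / 2) - 1) / s\<^sup>2) \<longlongrightarrow> 0) (at_right 0)"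
    by real_asymp
  moreover have "filterlim t (at_right 0) sequentially"
    using t0 t(2) by (intro tendsto_imp_filterlim_at_right) auto
  ultimately have "(\<lambda>n. ((1 - (t n)\<^sup>2 / 2) * E n - 1) / (t n)\<^sup>2) \<longlonglongrightarrow> 0"
    unfolding E_def by (rule filterlim_compose)
  moreover have "E \<longlonglongrightarrow> exp (0\<^sup>2 / 2)" unfolding E_def by (intro tendsto_intros t0) simp
  ultimately have "q \<longlonglongrightarrow> 2 * (0 * exp (0\<^sup>2 / 2) + \<bar>0\<bar>)"
    unfolding q_def by (intro tendsto_intros e)
  then have q0: "q \<longlonglongrightarrow> 0" by simp
  have zq: "eventually (\<lambda>n. cmod (z n) \<le> (t n)\<^sup>2 * q n) sequentially"
  proof -
    have "eventually (\<lambda>n. cmod (z n) < 1 / 6) sequentially"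
      using tendsto_norm[OF z0] by (rule order_tendstoD) simp
    then show ?thesis
    proof eventually_elim
      case (elim n)
      have "exp (z n) - 1 = (char \<mu> (t n) - (1 - (t n)\<^sup>2 / 2)) * E n + complex_of_real ((1 - (t n)\<^sup>2 / 2) * E n - 1)"
        using D0(2)[OF t(1)[of n]] by (simp add: z_def E_def algebra_simps exp_of_real[symmetric])
      then have "cmod (exp (z n) - 1) = cmod ((char \<mu> (t n) - (1 - (t n)\<^sup>2 / 2)) * E n + complex_of_real ((1 - (t n)\<^sup>2 / 2) * E n - 1))"
        by (rule arg_cong)
      also have "\<dots> \<le> cmod ((char \<mu> (t n) - (1 - (t n)\<^sup>2 / 2)) * E n) + cmod (complex_of_real ((1 - (t n)\<^sup>2 / 2) * E n - 1))"
        by (rule norm_triangle_ineq)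
      also have "\<dots> = cmod (char \<mu> (t n) - (1 - (t n)\<^sup>2 / 2)) * E n + \<bar>(1 - (t n)\<^sup>2 / 2) * E n - 1\<bar>"
        unfolding norm_mult norm_of_real by (simp add: E_def)
      also have "\<dots> \<le> (t n)\<^sup>2 * e n * E n + \<bar>(1 - (t n)\<^sup>2 / 2) * E n - 1\<bar>"
        by (intro add_mono mult_right_mono e) (auto simp: E_def)
      also have "\<dots> = (t n)\<^sup>2 * q n / 2"
        using t(2)[of n] by (simp add: q_def abs_divide distrib_left)
      finally show ?case using norm_exp_minus_one_ge[of "z n"] elim by simp
    qed
  qed
  \<comment> \<open>Division by \<open>t n\<close> leaves only terms tending to 0. Once
    \<open>D1 0\<close> has vanished, the same is done with \<open>(t n)^2 / 2\<close> for
    \<open>D2 0\<close>.\<close>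
  have "cmod (D1 0) \<le> 0"
  proof (rule tendsto_lowerbound)
    show "(\<lambda>n. t n * q n + t n / 2 * cmod (D2 0) + c * (t n)\<^sup>2) \<longlonglongrightarrow> 0"
      using tendsto_add[OF tendsto_add[OF tendsto_mult[OF t0 q0] tendsto_mult[OF tendsto_divide[OF t0 tendsto_const[of 2]] tendsto_const[of "cmod (D2 0)"]]]
        tendsto_mult[OF tendsto_const[of c] tendsto_power[OF t0, of 2]]] by simp
    show "eventually (\<lambda>n. cmod (D1 0) \<le> t n * q n + t n / 2 * cmod (D2 0) + c * (t n)\<^sup>2) sequentially"
      using zq
    proof eventually_elim
      case (elim n)
      let ?v = "z n - t n *\<^sub>R D1 0 - ((t n)\<^sup>2 / 2) *\<^sub>R D2 0"
      have "t n * cmod (D1 0) = cmod (z n - ((t n)\<^sup>2 / 2) *\<^sub>R D2 0 - ?v)" using t(2)[of n] by simp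
      also have "\<dots> \<le> cmod (z n) + cmod (((t n)\<^sup>2 / 2) *\<^sub>R D2 0) + cmod ?v"
        using norm_triangle_ineq4[of "z n - ((t n)\<^sup>2 / 2) *\<^sub>R D2 0" ?v] norm_triangle_ineq4[of "z n" "((t n)\<^sup>2 / 2) *\<^sub>R D2 0"]
        by linarith
      also have "\<dots> \<le> (t n)\<^sup>2 * q n + (t n)\<^sup>2 / 2 * cmod (D2 0) + c * t n ^ 3"
        using elim r[of n] by simp
      also have "\<dots> = t n * (t n * q n + t n / 2 * cmod (D2 0) + c * (t n)\<^sup>2)"
        by (simp add: power2_eq_square power3_eq_cube algebra_simps)
      finally show ?case using t(2)[of n] by simp
    qed
  qed auto
  then show D1: "D1 0 = 0" by simp
  have "cmod (D2 0) \<le> 0"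
  proof (rule tendsto_lowerbound)
    show "(\<lambda>n. 2 * q n + 2 * c * t n) \<longlonglongrightarrow> 0"
      using tendsto_add[OF tendsto_mult[OF tendsto_const[of 2] q0] tendsto_mult[OF tendsto_const[of "2 * c"] t0]] by simp
    show "eventually (\<lambda>n. cmod (D2 0) \<le> 2 * q n + 2 * c * t n) sequentially"
      using zq
    proof eventually_elim
      case (elim n)
      let ?v = "z n - ((t n)\<^sup>2 / 2) *\<^sub>R D2 0"
      have "(t n)\<^sup>2 / 2 * cmod (D2 0) = cmod (z n - ?v)" by simp
      also have "\<dots> \<le> cmod (z n) + cmod ?v" by (rule norm_triangle_ineq4)
      also have "\<dots> \<le> (t n)\<^sup>2 * q n + c * t n ^ 3"
        using elim r[of n] D1 by simp
      also have "\<dots> = (t n)\<^sup>2 / 2 * (2 * q n + 2 * c * t n)"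
        by (simp add: power2_eq_square power3_eq_cube algebra_simps)
      finally show ?case using t(2)[of n] by simp
    qed
  qed auto
  then show "D2 0 = 0" by simp
qed

text \<open>Two branches differ by a continuous function with values in the discrete set of
  multiples of \<open>2 pi i\<close>. On an interval it is constant, and at 0 it vanishes.\<close>

lemma log_char_on_unique:
  assumes L: "log_char_on M X I L" "log_char_on M X I' L'" and J: "{-a..a} \<subseteq> I" "{-a..a} \<subseteq> I'" "0 \<le> a" and t: "t \<in> {-a..a}"
  shows "L t = L' t"
proof -
  let ?J = "{-a..a}"
  have "(\<lambda>t. L t - L' t) constant_on ?J"
  proof (rule continuous_discrete_range_constant)
    show "continuous_on ?J (\<lambda>t. L t - L' t)"
      using L J unfolding log_char_on_def by (intro continuous_on_diff) (blast intro: continuous_on_subset)+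
    have ex: "\<exists>k::int. L t - L' t = of_int (2 * k) * pi * \<i>" if "t \<in> ?J" for t
    proof -
      have "exp (L t) = exp (L' t)" using that L J unfolding log_char_on_def by (metis subsetD)
      then show ?thesis unfolding exp_eq by auto
    qed
    fix x assume x: "x \<in> ?J"
    show "\<exists>e>0. \<forall>y. y \<in> ?J \<and> L y - L' y \<noteq> L x - L' x \<longrightarrow> e \<le> norm (L y - L' y - (L x - L' x))"
    proof (intro exI[of _ "2 * pi"] conjI allI impI)
      fix y assume y: "y \<in> ?J \<and> L y - L' y \<noteq> L x - L' x"
      obtain k l where kl: "L x - L' x = of_int (2 * k) * pi * \<i>" "L y - L' y = of_int (2 * l) * pi * \<i>"
        using ex x y by meson
      then have "k \<noteq> l" using y by auto
      then have "(1::real) \<le> \<bar>of_int (l - k)\<bar>" by linarith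
      then have "2 * pi * 1 \<le> 2 * pi * \<bar>of_int (l - k)\<bar>" by (intro mult_left_mono) auto
      moreover have "L y - L' y - (L x - L' x) = complex_of_real (2 * pi * of_int (l - k)) * \<i>"
        unfolding kl by (simp add: algebra_simps)
      ultimately show "2 * pi \<le> norm (L y - L' y - (L x - L' x))"
        by (simp only: norm_mult norm_of_real) (simp add: abs_mult)
    qed simp
  qed simp
  moreover have "L 0 - L' 0 = 0" using L unfolding log_char_on_def by simp
  ultimately have "L t - L' t = 0" using t J(3) unfolding constant_on_def
    by (metis atLeastAtMost_iff neg_le_0_iff_le)
  then show ?thesis by simp
qed

lemma derivatives_on_unique:
  assumes D: "derivatives_on k f I D" "derivatives_on k' f' I' D'"
    and J: "{-a..a} \<subseteq> I" "{-a..a} \<subseteq> I'" "0 < a" and f: "\<And>t. t \<in> {-a..a} \<Longrightarrow> f t = f' t"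
    and i: "i \<le> k" "i \<le> k'" and t: "t \<in> {-a..a}"
  shows "D i t = D' i t"
  using i t
proof (induction i arbitrary: t)
  case 0
  then show ?case using D J f unfolding derivatives_on_def by (metis subsetD)
next
  case (Suc i)
  have "(D i has_vector_derivative D (Suc i) t) (at t within {-a..a})"
    using D(1) J Suc.prems unfolding derivatives_on_def
    by (meson Suc_le_lessD has_vector_derivative_within_subset subsetD)
  moreover have "(D' i has_vector_derivative D' (Suc i) t) (at t within {-a..a})"
    using D(2) J Suc.prems unfolding derivatives_on_def
    by (meson Suc_le_lessD has_vector_derivative_within_subset subsetD)
  then have "(D i has_vector_derivative D' (Suc i) t) (at t within {-a..a})"
    by (rule has_vector_derivative_transform[rotated 2]) (use Suc in auto)
  ultimately show ?case
    using vector_derivative_unique_within_closed_interval[of "-a" a t "D i"] J(3) Suc.prems by auto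
qed

text \<open>The growth condition provides a separate logarithm and a separate neighbourhood of the
  origin for each order; uniqueness merges them.\<close>

lemma growth_condition_merge:
  assumes g: "growth_condition M S \<sigma> m" and m: "m \<ge> 2"
  shows "\<exists>C>0. \<exists>\<epsilon>>0. \<forall>n. \<sigma> n > 0 \<longrightarrow> (\<exists>L D.
    log_char_on M (\<lambda>\<omega>. S n \<omega> / \<sigma> n) {- (\<epsilon> * \<sigma> n)..\<epsilon> * \<sigma> n} L \<and>
    derivatives_on (m + 1) (\<lambda>t. L t + complex_of_real (t\<^sup>2 / 2)) {- (\<epsilon> * \<sigma> n)..\<epsilon> * \<sigma> n} D \<and>
    (\<forall>j t. 3 \<le> j \<longrightarrow> j \<le> m + 1 \<longrightarrow> t \<in> {- (\<epsilon> * \<sigma> n)..\<epsilon> * \<sigma> n} \<longrightarrow> cmod (D j t) \<le> C / \<sigma> n ^ (j - 2)))"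
proof -
  let ?I = "\<lambda>\<epsilon> n. {- (\<epsilon> * \<sigma> n)..\<epsilon> * \<sigma> n}"
  define Q where "Q j C \<epsilon> \<longleftrightarrow> (\<forall>n. \<sigma> n > 0 \<longrightarrow> (\<exists>L D.
      log_char_on M (\<lambda>\<omega>. S n \<omega> / \<sigma> n) (?I \<epsilon> n) L \<and>
      derivatives_on j (\<lambda>t. L t + complex_of_real (t\<^sup>2 / 2)) (?I \<epsilon> n) D \<and>
      (\<forall>t\<in>?I \<epsilon> n. cmod (D j t) \<le> C / \<sigma> n ^ (j - 2))))" for j C \<epsilon>
  have "\<forall>j. 3 \<le> j \<and> j \<le> m + 1 \<longrightarrow> (\<exists>C>0. \<exists>\<epsilon>>0. Q j C \<epsilon>)"
    using g unfolding growth_condition_def Let_def Q_def .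
  then obtain C e where *: "\<And>j. 3 \<le> j \<Longrightarrow> j \<le> m + 1 \<Longrightarrow> C j > (0::real) \<and> e j > (0::real) \<and> Q j (C j) (e j)"
    by metis
  \<comment> \<open>The smallest radius and, next, the largest constant over the finitely many
    orders; the range is nonempty because \<open>m \<ge> 2\<close>.\<close>
  define \<epsilon> where "\<epsilon> = Min (e ` {3..m+1})"
  define K where "K = Max (C ` {3..m+1})"
  have \<epsilon>_le: "\<epsilon> \<le> e j" and K_ge: "C j \<le> K" if "3 \<le> j" "j \<le> m + 1" for j
    using that by (auto simp: \<epsilon>_def K_def)
  have "\<epsilon> \<in> e ` {3..m+1}" unfolding \<epsilon>_def using m by (intro Min_in) auto
  then have \<epsilon>: "\<epsilon> > 0" using * by auto
  have K: "K > 0" using K_ge[of 3] *[of 3] m by simp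
  show ?thesis
  proof (rule exI[of _ K], rule conjI[OF K], rule exI[of _ \<epsilon>], rule conjI[OF \<epsilon>], intro allI impI)
    fix n assume \<sigma>: "\<sigma> n > 0"
    have sub: "?I \<epsilon> n \<subseteq> ?I (e j) n" if "3 \<le> j" "j \<le> m + 1" for j
      using mult_right_mono[OF \<epsilon>_le[OF that], of "\<sigma> n"] \<sigma> by auto
    \<comment> \<open>The logarithm and the derivatives belonging to the top order
      \<open>m + 1\<close> are kept; the bound for a lower order \<open>j\<close>, given for another
      logarithm, is transported to them.\<close>
    obtain L D where L: "log_char_on M (\<lambda>\<omega>. S n \<omega> / \<sigma> n) (?I (e (m + 1)) n) L"
      and D: "derivatives_on (m + 1) (\<lambda>t. L t + complex_of_real (t\<^sup>2 / 2)) (?I (e (m + 1)) n) D"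
      using *[of "m + 1"] m \<sigma> unfolding Q_def by auto
    show "\<exists>L D. log_char_on M (\<lambda>\<omega>. S n \<omega> / \<sigma> n) (?I \<epsilon> n) L \<and>
      derivatives_on (m + 1) (\<lambda>t. L t + complex_of_real (t\<^sup>2 / 2)) (?I \<epsilon> n) D \<and>
      (\<forall>j t. 3 \<le> j \<longrightarrow> j \<le> m + 1 \<longrightarrow> t \<in> ?I \<epsilon> n \<longrightarrow> cmod (D j t) \<le> K / \<sigma> n ^ (j - 2))"
    proof (intro exI[of _ L] exI[of _ D] conjI allI impI)
      have s: "?I \<epsilon> n \<subseteq> ?I (e (m + 1)) n" using sub[of "m + 1"] m by simp
      show "log_char_on M (\<lambda>\<omega>. S n \<omega> / \<sigma> n) (?I \<epsilon> n) L"
        using L s unfolding log_char_on_def by (meson continuous_on_subset subsetD)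
      show "derivatives_on (m + 1) (\<lambda>t. L t + complex_of_real (t\<^sup>2 / 2)) (?I \<epsilon> n) D"
        using D s unfolding derivatives_on_def by (meson has_vector_derivative_within_subset subsetD)
      fix j t assume j: "3 \<le> j" "j \<le> m + 1" and t: "t \<in> ?I \<epsilon> n"
      obtain L' D' where L': "log_char_on M (\<lambda>\<omega>. S n \<omega> / \<sigma> n) (?I (e j) n) L'"
        and D': "derivatives_on j (\<lambda>t. L' t + complex_of_real (t\<^sup>2 / 2)) (?I (e j) n) D'"
        and b: "\<forall>t\<in>?I (e j) n. cmod (D' j t) \<le> C j / \<sigma> n ^ (j - 2)"
        using *[OF j] \<sigma> unfolding Q_def by auto
      have LL: "L t = L' t" if "t \<in> ?I \<epsilon> n" for t
        by (rule log_char_on_unique[OF L L' s sub[OF j] _ that]) (use \<epsilon> \<sigma> in simp)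
      have "D j t = D' j t"
        by (rule derivatives_on_unique[OF D D' s sub[OF j] _ _ _ _ t]) (use \<epsilon> \<sigma> LL j in auto)
      then have "cmod (D j t) \<le> C j / \<sigma> n ^ (j - 2)" using b t sub[OF j] by auto
      also have "\<dots> \<le> K / \<sigma> n ^ (j - 2)" using K_ge[OF j] \<sigma> by (intro divide_right_mono) auto
      finally show "cmod (D j t) \<le> K / \<sigma> n ^ (j - 2)" .
    qed
  qed
qed

text \<open>\<open>D\<close> is meant to be the family of derivatives of \<open>\<Lambda>\<close>,
  and \<open>\<eta>\<close> a multiple of \<open>1 / \<sigma>\<close>.
  \<open>linear_ode_bound\<close> is used twice: for \<open>f\<close>, with coefficient
  \<open>D 1 - t\<close>, inhomogeneity 0 and size 1; then for \<open>f - g\<close>, with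
  coefficient \<open>- t\<close> and inhomogeneity \<open>D 1 * f\<close>, which has size
  \<open>\<eta>\<close> because \<open>D 1\<close> has.\<close>

lemma char_diff_smooth_bound:
  fixes C :: real and m :: nat
  assumes C: "C \<ge> 0"
  shows "\<exists>B\<ge>0. \<forall>\<mu> \<eta> T D. real_distribution \<mu> \<longrightarrow> 0 \<le> \<eta> \<longrightarrow> \<eta> \<le> C \<longrightarrow>
    derivatives_on (m + 1) (D 0) {-T..T} D \<longrightarrow>
    (\<forall>t\<in>{-T..T}. char \<mu> t = exp (D 0 t - complex_of_real (t\<^sup>2 / 2)) \<and> cmod (D 0 t) \<le> t\<^sup>2 / 4 \<and>
      (\<forall>j\<le>m + 1. cmod (D j t) \<le> \<eta> * (1 + \<bar>t\<bar>) ^ 3)) \<longrightarrow>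
    smooth_bound {-T..T} {} (m + 1) (\<lambda>t. B * \<eta> / (1 + \<bar>t\<bar>) ^ 2) (\<lambda>t. char \<mu> t - char std_normal_distribution t)"
proof -
  define c where "c = C + 1"
  have c: "c \<ge> 0" "c \<ge> 1" "c \<ge> C" using C by (auto simp: c_def)
  \<comment> \<open>The modulus of \<open>f\<close> is at most
    \<open>exp (- t^2/2 + |D 0 t|)\<close>, and the hypothesis on \<open>D 0\<close> gives away half
    of the exponent.\<close>
  define E where "E t = exp (- (t\<^sup>2 / 4))" for t :: real
  have E: "0 \<le> E t" for t by (simp add: E_def)
  obtain C1 N1 where C1: "C1 \<ge> 0" and ode1: "linear_ode_bound m c 3 C1 N1"
    using linear_ode_bound_exists[OF c(1)] by blast
  \<comment> \<open>\<open>2 ^ m * C1\<close> is the Leibniz constant of \<open>D 1 * f\<close>,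
    with exponent \<open>3 + N1\<close>; the summand \<open>c\<close> makes the pair also dominate
    the coefficient \<open>- t\<close> and the difference \<open>f - g\<close> itself.\<close>
  define c' where "c' = c + 2 ^ m * C1"
  define a' where "a' = 3 + N1"
  have c': "c' \<ge> 0" "c' \<ge> c" "c' \<ge> 2 ^ m * C1" using c C1 by (auto simp: c'_def)
  obtain C2 N2 where C2: "C2 \<ge> 0" and ode2: "linear_ode_bound m c' a' C2 N2"
    using linear_ode_bound_exists[OF c'(1)] by blast
  \<comment> \<open>With exponent \<open>N2 + 2\<close> in \<open>power_mult_exp_le\<close>, the
    Gaussian factor absorbs the growth of degree \<open>N2\<close> and still leaves the integrable
    weight \<open>1 / (1 + |t|)^2\<close>.\<close>
  define B where "B = C2 * (fact (N2 + 2) * exp 2)"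
  have B: "B \<ge> 0" using C2 by (simp add: B_def)
  have pow: "(1 + \<bar>t\<bar>) ^ 3 \<le> (1 + \<bar>t\<bar>) ^ a'" "1 + \<bar>t\<bar> \<le> (1 + \<bar>t\<bar>) ^ 3" "1 + \<bar>t\<bar> \<le> (1 + \<bar>t\<bar>) ^ a'" for t :: real
  proof -
    show 1: "(1 + \<bar>t\<bar>) ^ 3 \<le> (1 + \<bar>t\<bar>) ^ a'" by (intro power_increasing) (auto simp: a'_def)
    show 2: "1 + \<bar>t\<bar> \<le> (1 + \<bar>t\<bar>) ^ 3" using power_increasing[of 1 3 "1 + \<bar>t\<bar>"] by simp
    show "1 + \<bar>t\<bar> \<le> (1 + \<bar>t\<bar>) ^ a'" using 1 2 by linarith
  qed
  show ?thesis
  proof (rule exI[of _ B], rule conjI[OF B], intro allI impI)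
    fix \<mu> :: "real measure" and \<eta> T :: real and D :: "nat \<Rightarrow> real \<Rightarrow> complex"
    let ?I = "{-T..T}"
    let ?f = "char \<mu>" and ?g = "char std_normal_distribution"
    assume rd: "real_distribution \<mu>" and \<eta>: "0 \<le> \<eta>" "\<eta> \<le> C"
      and D: "derivatives_on (m + 1) (D 0) ?I D"
      and h: "\<forall>t\<in>?I. char \<mu> t = exp (D 0 t - complex_of_real (t\<^sup>2 / 2)) \<and> cmod (D 0 t) \<le> t\<^sup>2 / 4 \<and>
        (\<forall>j\<le>m + 1. cmod (D j t) \<le> \<eta> * (1 + \<bar>t\<bar>) ^ 3)"
    have dD: "(D j has_vector_derivative D (Suc j) t) (at t within ?I)" if "j < m + 1" "t \<in> ?I" for j t
      using D that unfolding derivatives_on_def by blast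
    have f: "?f t = exp (D 0 t - complex_of_real (t\<^sup>2 / 2))" if "t \<in> ?I" for t using h that by blast
    have bD: "cmod (D j t) \<le> \<eta> * (1 + \<bar>t\<bar>) ^ 3" if "j \<le> m + 1" "t \<in> ?I" for j t using h that by blast
    have b0: "cmod (D 0 t) \<le> t\<^sup>2 / 4" if "t \<in> ?I" for t using h that by blast
    have g: "?g t = exp (- complex_of_real (t\<^sup>2 / 2))" for t
      by (simp add: char_std_normal_distribution flip: exp_of_real)
    have dsq: "((\<lambda>t. complex_of_real (t\<^sup>2 / 2)) has_vector_derivative complex_of_real t) (at t within ?I)" for t
      by (rule has_vector_derivative_of_real) (auto intro!: derivative_eq_intros)
    have df: "(?f has_vector_derivative (D 1 t - complex_of_real t) * ?f t) (at t within ?I)" if t: "t \<in> ?I" for t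
    proof -
      have "((\<lambda>t. D 0 t - complex_of_real (t\<^sup>2 / 2)) has_vector_derivative D 1 t - complex_of_real t) (at t within ?I)"
        using has_vector_derivative_diff[OF dD[of 0 t] dsq] t by simp
      from field_vector_diff_chain_within[OF this, of exp "exp (D 0 t - complex_of_real (t\<^sup>2 / 2))"]
      have "((\<lambda>t. exp (D 0 t - complex_of_real (t\<^sup>2 / 2))) has_vector_derivative (D 1 t - complex_of_real t) * ?f t) (at t within ?I)"
        using f[OF t] by (simp add: o_def DERIV_exp has_field_derivative_at_within)
      then show ?thesis
        by (rule has_vector_derivative_transform[rotated 2]) (use f t in auto)
    qed
    have dg: "(?g has_vector_derivative - complex_of_real t * ?g t) (at t within ?I)" for t
    proof -
      have "((\<lambda>t. - complex_of_real (t\<^sup>2 / 2)) has_vector_derivative - complex_of_real t) (at t within ?I)"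
        by (rule has_vector_derivative_minus[OF dsq])
      from field_vector_diff_chain_within[OF this, of exp "exp (- complex_of_real (t\<^sup>2 / 2))"]
      show ?thesis unfolding g by (simp add: o_def DERIV_exp has_field_derivative_at_within)
    qed
    have sD: "smooth_bound ?I {} m (\<lambda>t. \<eta> * (1 + \<bar>t\<bar>) ^ 3) (D 1)"
      by (rule smooth_bound_derivatives) (use dD bD in auto)
    have st: "smooth_bound ?I {} m (\<lambda>t. (1 + \<bar>t\<bar>) ^ 3) (\<lambda>t. - complex_of_real t)"
      using smooth_bound_scale[OF smooth_bound_of_real[of ?I "\<lambda>t. (1 + \<bar>t\<bar>) ^ 3" m], of "-1"] pow(2) by simp
    have sv: "smooth_bound ?I {} m (\<lambda>t. c * (1 + \<bar>t\<bar>) ^ 3) (\<lambda>t. D 1 t - complex_of_real t)"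
      using smooth_bound_mono[OF smooth_bound_add[OF sD st], of "\<lambda>t. c * (1 + \<bar>t\<bar>) ^ 3"] \<eta>
      by (simp add: c_def distrib_right mult_right_mono)
    have bf: "cmod (?f t) \<le> E t" if t: "t \<in> ?I" for t
    proof -
      have "Re (D 0 t) \<le> t\<^sup>2 / 4" using b0[OF t] complex_Re_le_cmod[of "D 0 t"] by linarith
      then show ?thesis unfolding f[OF t] norm_exp_eq_Re E_def by simp
    qed
    have sf: "smooth_bound ?I {} (Suc m) (\<lambda>t. 1 * (C1 * (1 + \<bar>t\<bar>) ^ N1 * E t)) ?f"
    proof (rule linear_ode_boundD[OF ode1])
      show "\<forall>t\<in>?I. cmod (?f t) \<le> 1 * (c * (1 + \<bar>t\<bar>) ^ 3 * E t)"
      proof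
        fix t assume "t \<in> ?I"
        have "1 * 1 \<le> c * (1 + \<bar>t\<bar>) ^ 3" using c by (intro mult_mono one_le_power) auto
        then have "1 * E t \<le> c * (1 + \<bar>t\<bar>) ^ 3 * E t" using E by (intro mult_right_mono) auto
        with bf[OF \<open>t \<in> ?I\<close>] show "cmod (?f t) \<le> 1 * (c * (1 + \<bar>t\<bar>) ^ 3 * E t)" by simp
      qed
      show "\<forall>t\<in>?I. (?f has_vector_derivative (D 1 t - complex_of_real t) * ?f t + 0) (at t within ?I)"
        using df by simp
      show "smooth_bound ?I {} m (\<lambda>t. 1 * (c * (1 + \<bar>t\<bar>) ^ 3 * E t)) (\<lambda>t. 0)"
        by (rule smooth_bound_const) (use c E in auto)
    qed (use sv E in auto)
    have "smooth_bound ?I {} (Suc m) (\<lambda>t. \<eta> * (C2 * (1 + \<bar>t\<bar>) ^ N2 * E t)) (\<lambda>t. ?f t - ?g t)"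
    proof (rule linear_ode_boundD[OF ode2])
      show "\<forall>t\<in>?I. cmod (?f t - ?g t) \<le> \<eta> * (c' * (1 + \<bar>t\<bar>) ^ a' * E t)"
      proof
        fix t assume t: "t \<in> ?I"
        \<comment> \<open>Factoring out \<open>g\<close> exposes the small factor of size
          \<open>\<eta>\<close>; the growth \<open>exp (t^2/4)\<close> in its bound turns
          \<open>exp (- t^2/2)\<close> into \<open>E t\<close>.\<close>
        have "?f t - ?g t = ?g t * (exp (D 0 t) - 1)"
        proof -
          have "exp (z - q) - exp (- q) = exp (- q) * (exp z - 1)" for z q :: complex
            unfolding right_diff_distrib exp_add[symmetric] by simp
          then show ?thesis unfolding f[OF t] g .
        qed
        then have "cmod (?f t - ?g t) = exp (- (t\<^sup>2 / 2)) * cmod (exp (D 0 t) - 1)"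
          by (simp add: norm_mult g)
        also have "\<dots> \<le> exp (- (t\<^sup>2 / 2)) * (\<eta> * (1 + \<bar>t\<bar>) ^ 3 * exp (t\<^sup>2 / 4))"
        proof (intro mult_left_mono order_trans[OF norm_exp_minus_one_le] mult_mono)
          show "cmod (D 0 t) \<le> \<eta> * (1 + \<bar>t\<bar>) ^ 3" using bD[of 0 t] t by simp
        qed (use b0[OF t] \<eta> in auto)
        also have "\<dots> = \<eta> * ((1 + \<bar>t\<bar>) ^ 3 * E t)"
        proof -
          have "exp (- (t\<^sup>2 / 2)) * exp (t\<^sup>2 / 4) = E t" unfolding E_def mult_exp_exp by simp
          then show ?thesis by (metis mult.assoc mult.commute)
        qed
        also have "\<dots> \<le> \<eta> * (c' * (1 + \<bar>t\<bar>) ^ a' * E t)"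
        proof (intro mult_left_mono mult_right_mono E \<eta>)
          have "1 * (1 + \<bar>t\<bar>) ^ 3 \<le> c' * (1 + \<bar>t\<bar>) ^ a'"
            using c c' pow(1) by (intro mult_mono) auto
          then show "(1 + \<bar>t\<bar>) ^ 3 \<le> c' * (1 + \<bar>t\<bar>) ^ a'" by simp
        qed
        finally show "cmod (?f t - ?g t) \<le> \<eta> * (c' * (1 + \<bar>t\<bar>) ^ a' * E t)" .
      qed
      show "\<forall>t\<in>?I. ((\<lambda>t. ?f t - ?g t) has_vector_derivative - complex_of_real t * (?f t - ?g t) + D 1 t * ?f t) (at t within ?I)"
      proof
        fix t assume t: "t \<in> ?I"
        from has_vector_derivative_diff[OF df[OF t] dg]
        show "((\<lambda>t. ?f t - ?g t) has_vector_derivative - complex_of_real t * (?f t - ?g t) + D 1 t * ?f t) (at t within ?I)"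
          by (simp add: algebra_simps)
      qed
      show "smooth_bound ?I {} m (\<lambda>t. c' * (1 + \<bar>t\<bar>) ^ a') (\<lambda>t. - complex_of_real t)"
      proof (rule smooth_bound_mono[OF st])
        show "(1 + \<bar>t\<bar>) ^ 3 \<le> c' * (1 + \<bar>t\<bar>) ^ a'" for t
          using mult_mono[of 1 c' "(1 + \<bar>t\<bar>) ^ 3" "(1 + \<bar>t\<bar>) ^ a'"] pow(1)[of t] c c' by simp
      qed
      show "smooth_bound ?I {} m (\<lambda>t. \<eta> * (c' * (1 + \<bar>t\<bar>) ^ a' * E t)) (\<lambda>t. D 1 t * ?f t)"
      proof (rule smooth_bound_mono[OF smooth_bound_mult[OF sD smooth_bound_SucD[OF sf]]])
        fix t :: real
        have "2 ^ m * C1 * (\<eta> * (1 + \<bar>t\<bar>) ^ a' * E t) \<le> c' * (\<eta> * (1 + \<bar>t\<bar>) ^ a' * E t)"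
          using c' \<eta> E by (intro mult_right_mono) auto
        then show "2 ^ m * (\<eta> * (1 + \<bar>t\<bar>) ^ 3 * (1 * (C1 * (1 + \<bar>t\<bar>) ^ N1 * E t))) \<le> \<eta> * (c' * (1 + \<bar>t\<bar>) ^ a' * E t)"
          by (simp add: a'_def power_add mult_ac)
      qed
    qed (use \<eta> E in auto)
    then have "smooth_bound ?I {} (Suc m) (\<lambda>t. B * \<eta> / (1 + \<bar>t\<bar>) ^ 2) (\<lambda>t. ?f t - ?g t)"
    proof (rule smooth_bound_mono)
      fix t :: real
      have "\<eta> * C2 * ((1 + \<bar>t\<bar>) ^ (N2 + 2) * E t) \<le> \<eta> * C2 * (fact (N2 + 2) * exp 2)"
        unfolding E_def using \<eta> C2 by (intro mult_left_mono power_mult_exp_le) auto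
      then have "\<eta> * (C2 * (1 + \<bar>t\<bar>) ^ N2 * E t) * (1 + \<bar>t\<bar>) ^ 2 \<le> B * \<eta>"
        by (simp only: B_def power_add mult_ac)
      then show "\<eta> * (C2 * (1 + \<bar>t\<bar>) ^ N2 * E t) \<le> B * \<eta> / (1 + \<bar>t\<bar>) ^ 2"
        by (subst pos_le_divide_eq) auto
    qed
    then show "smooth_bound ?I {} (m + 1) (\<lambda>t. B * \<eta> / (1 + \<bar>t\<bar>) ^ 2) (\<lambda>t. ?f t - ?g t)" by simp
  qed
qed

lemma growth_condition_char_smooth:
  fixes M :: "'a measure" and S :: "nat \<Rightarrow> 'a \<Rightarrow> real"
  assumes M: "prob_space M"
    and S: "\<And>n. S n \<in> borel_measurable M" "\<And>n. integrable M (\<lambda>\<omega>. (S n \<omega>)\<^sup>2)" "\<And>n. (\<integral>\<omega>. S n \<omega> \<partial>M) = 0"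
    and \<sigma>: "\<And>n. \<sigma> n = sqrt (\<integral>\<omega>. (S n \<omega>)\<^sup>2 \<partial>M)"
    and m: "m \<ge> 2" and g: "growth_condition M S \<sigma> m"
    and s0: "s0 > 0" "\<And>n. \<sigma> n > 0 \<Longrightarrow> s0 \<le> \<sigma> n"
  shows "\<exists>\<epsilon>>0. \<exists>B\<ge>0. \<forall>n. \<sigma> n > 0 \<longrightarrow> smooth_bound {- (\<epsilon> * \<sigma> n)..\<epsilon> * \<sigma> n} {} (m + 1)
    (\<lambda>t. B / \<sigma> n / (1 + \<bar>t\<bar>) ^ 2)
    (\<lambda>t. char (distr M borel (\<lambda>\<omega>. S n \<omega> / \<sigma> n)) t - char std_normal_distribution t)"
proof -
  interpret prob_space M by fact
  obtain C \<epsilon>0 where C: "C > 0" and \<epsilon>0: "\<epsilon>0 > 0" and merge: "\<And>n. \<sigma> n > 0 \<Longrightarrow> (\<exists>L D.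
    log_char_on M (\<lambda>\<omega>. S n \<omega> / \<sigma> n) {- (\<epsilon>0 * \<sigma> n)..\<epsilon>0 * \<sigma> n} L \<and>
    derivatives_on (m + 1) (\<lambda>t. L t + complex_of_real (t\<^sup>2 / 2)) {- (\<epsilon>0 * \<sigma> n)..\<epsilon>0 * \<sigma> n} D \<and>
    (\<forall>j t. 3 \<le> j \<longrightarrow> j \<le> m + 1 \<longrightarrow> t \<in> {- (\<epsilon>0 * \<sigma> n)..\<epsilon>0 * \<sigma> n} \<longrightarrow> cmod (D j t) \<le> C / \<sigma> n ^ (j - 2)))"
    using growth_condition_merge[OF g m] by blast
  define \<tau> where "\<tau> = 1 / s0"
  have \<tau>: "\<tau> > 0" using s0 by (simp add: \<tau>_def)
  \<comment> \<open>An order \<open>j \<ge> 3\<close> carries \<open>j - 3\<close> factors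
    \<open>1 / \<sigma>\<close> beyond the first, together at most \<open>(1 + \<tau>) ^ m\<close>.
    With \<open>C'\<close> every bound becomes a multiple of \<open>1 / \<sigma>\<close>
    alone.\<close>
  define C' where "C' = C * (1 + \<tau>) ^ m"
  have C': "C \<le> C'" "C' > 0"
    using C \<tau> mult_left_mono[of 1 "(1 + \<tau>) ^ m" C] by (auto simp: C'_def one_le_power)
  \<comment> \<open>The second entry ensures \<open>C |t|^3 / \<sigma> \<le> t^2 / 4\<close> for
    \<open>|t| \<le> \<epsilon> \<sigma>\<close>, the bound on \<open>D 0\<close> that
    \<open>char_diff_smooth_bound\<close> asks for.\<close>
  define \<epsilon> where "\<epsilon> = min \<epsilon>0 (1 / (4 * C))"
  have \<epsilon>: "\<epsilon> > 0" "\<epsilon> \<le> \<epsilon>0" "C * \<epsilon> \<le> 1 / 4"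
  proof -
    show "\<epsilon> > 0" "\<epsilon> \<le> \<epsilon>0" using \<epsilon>0 C by (auto simp: \<epsilon>_def)
    have "C * \<epsilon> \<le> C * (1 / (4 * C))" using C by (intro mult_left_mono) (auto simp: \<epsilon>_def)
    then show "C * \<epsilon> \<le> 1 / 4" using C by simp
  qed
  have "0 \<le> C' * \<tau>" using C' \<tau> by simp
  from char_diff_smooth_bound[OF this, of m]
  obtain B where B: "B \<ge> 0" and smooth: "\<And>\<mu> \<eta> T D. real_distribution \<mu> \<Longrightarrow> 0 \<le> \<eta> \<Longrightarrow> \<eta> \<le> C' * \<tau> \<Longrightarrow>
    derivatives_on (m + 1) (D 0) {-T..T} D \<Longrightarrow>
    (\<forall>t\<in>{-T..T}. char \<mu> t = exp (D 0 t - complex_of_real (t\<^sup>2 / 2)) \<and> cmod (D 0 t) \<le> t\<^sup>2 / 4 \<and>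
      (\<forall>j\<le>m + 1. cmod (D j t) \<le> \<eta> * (1 + \<bar>t\<bar>) ^ 3)) \<Longrightarrow>
    smooth_bound {-T..T} {} (m + 1) (\<lambda>t. B * \<eta> / (1 + \<bar>t\<bar>) ^ 2) (\<lambda>t. char \<mu> t - char std_normal_distribution t)"
    by blast
  show ?thesis
  proof (rule exI[of _ \<epsilon>], rule conjI[OF \<epsilon>(1)], rule exI[of _ "B * C'"], rule conjI, use B C' in simp, intro allI impI)
    fix n assume pos: "\<sigma> n > 0"
    let ?X = "\<lambda>\<omega>. S n \<omega> / \<sigma> n"
    define \<mu> where "\<mu> = distr M borel ?X"
    have [measurable]: "S n \<in> borel_measurable M" by (rule S)
    have rd: "real_distribution \<mu>" unfolding \<mu>_def by (rule real_distribution_distr) measurable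
    have Si: "integrable M (S n)" using square_integrable_imp_integrable[OF S(1,2)] .
    have "(\<sigma> n)\<^sup>2 = (\<integral>\<omega>. (S n \<omega>)\<^sup>2 \<partial>M)" unfolding \<sigma> by simp
    then have mom: "integrable \<mu> (\<lambda>x. x)" "(\<integral>x. x \<partial>\<mu>) = 0" "integrable \<mu> (\<lambda>x. x\<^sup>2)" "(\<integral>x. x\<^sup>2 \<partial>\<mu>) = 1"
      unfolding \<mu>_def using Si S(2,3) pos
      by (auto simp: integrable_distr_eq integral_distr power_divide)
    define T where "T = \<epsilon> * \<sigma> n"
    have T: "0 < T" "T \<le> \<epsilon>0 * \<sigma> n" using \<epsilon> pos by (auto simp: T_def)
    define c where "c = C / \<sigma> n"
    have c: "0 \<le> c" "c \<le> C' / \<sigma> n" using C C' pos by (auto simp: c_def divide_right_mono)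
    let ?I = "{-T..T}"
    obtain L D where L: "log_char_on M ?X {- (\<epsilon>0 * \<sigma> n)..\<epsilon>0 * \<sigma> n} L"
      and D: "derivatives_on (m + 1) (\<lambda>t. L t + complex_of_real (t\<^sup>2 / 2)) {- (\<epsilon>0 * \<sigma> n)..\<epsilon>0 * \<sigma> n} D"
      and Db: "\<And>j t. 3 \<le> j \<Longrightarrow> j \<le> m + 1 \<Longrightarrow> t \<in> {- (\<epsilon>0 * \<sigma> n)..\<epsilon>0 * \<sigma> n} \<Longrightarrow> cmod (D j t) \<le> C / \<sigma> n ^ (j - 2)"
      using merge[OF pos] by blast
    have sub: "?I \<subseteq> {- (\<epsilon>0 * \<sigma> n)..\<epsilon>0 * \<sigma> n}" using T by auto
    have D0: "D 0 t = L t + complex_of_real (t\<^sup>2 / 2)" if "t \<in> ?I" for t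
      using D sub that unfolding derivatives_on_def by blast
    have Lc: "exp (L t) = char \<mu> t" if "t \<in> ?I" for t
      using L sub that unfolding log_char_on_def \<mu>_def by blast
    have dD: "(D j has_vector_derivative D (Suc j) t) (at t within ?I)" if "j < m + 1" "t \<in> ?I" for j t
      using D sub that unfolding derivatives_on_def by (meson has_vector_derivative_within_subset subsetD)
    have d3: "(D 0 has_vector_derivative D 1 t) (at t within ?I)" "(D 1 has_vector_derivative D 2 t) (at t within ?I)"
      "(D 2 has_vector_derivative D 3 t) (at t within ?I)" if "t \<in> ?I" for t
      using dD[of 0 t] dD[of 1 t] dD[of 2 t] that m by (simp_all add: numeral_2_eq_2 numeral_3_eq_3)
    have D00: "D 0 0 = 0" using D0[of 0] T L unfolding log_char_on_def by simp
    have D3: "cmod (D 3 t) \<le> c" if "t \<in> ?I" for t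
      using Db[of 3 t] sub that m by (auto simp: c_def)
    have eD0: "exp (D 0 t) = char \<mu> t * exp (t\<^sup>2 / 2)" if "t \<in> ?I" for t
      using D0[OF that] Lc[OF that] by (simp add: exp_add flip: exp_of_real)
    have z: "D 1 0 = 0" "D 2 0 = 0"
      using log_char_derivatives_zero[where ?D0.0 = "D 0" and ?D1.0 = "D 1" and ?D2.0 = "D 2" and ?D3.0 = "D 3", OF rd mom T(1) c(1) D00 eD0 d3 D3] by auto
    \<comment> \<open>Three integrations from 0, where \<open>D 2\<close>, \<open>D 1\<close> and
      \<open>D 0\<close> vanish, starting from the bound on \<open>D 3\<close>.\<close>
    have b2: "cmod (D 2 t) \<le> c * \<bar>t\<bar> ^ Suc 0" if "t \<in> ?I" for t
      by (rule power_bound_from_derivative[where a = T and u' = "D 3"]) (use that T c d3 D3 z in auto)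
    have b1: "cmod (D 1 t) \<le> c * \<bar>t\<bar> ^ Suc (Suc 0)" if "t \<in> ?I" for t
      by (rule power_bound_from_derivative[where a = T and u' = "D 2"]) (use that T c d3(2) b2 z in \<open>simp_all del: One_nat_def\<close>)
    have b0: "cmod (D 0 t) \<le> c * \<bar>t\<bar> ^ Suc (Suc (Suc 0))" if "t \<in> ?I" for t
      by (rule power_bound_from_derivative[where a = T and u' = "D 1"]) (use that T c d3(1) b1 D00 in \<open>simp_all del: One_nat_def\<close>)
    have "smooth_bound ?I {} (m + 1) (\<lambda>t. B * (C' / \<sigma> n) / (1 + \<bar>t\<bar>) ^ 2) (\<lambda>t. char \<mu> t - char std_normal_distribution t)"
    proof (rule smooth[OF rd])
      show "0 \<le> C' / \<sigma> n" using C' pos by simp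
      have "1 / \<sigma> n \<le> \<tau>" unfolding \<tau>_def using s0 pos by (intro divide_left_mono) auto
      then show "C' / \<sigma> n \<le> C' * \<tau>" using C' mult_left_mono[of "1 / \<sigma> n" \<tau> C'] by simp
      show "derivatives_on (m + 1) (D 0) ?I D" unfolding derivatives_on_def using dD by blast
      show "\<forall>t\<in>?I. char \<mu> t = exp (D 0 t - complex_of_real (t\<^sup>2 / 2)) \<and> cmod (D 0 t) \<le> t\<^sup>2 / 4 \<and>
        (\<forall>j\<le>m + 1. cmod (D j t) \<le> C' / \<sigma> n * (1 + \<bar>t\<bar>) ^ 3)"
      proof (intro ballI conjI allI impI)
        fix t assume t: "t \<in> ?I"
        show "char \<mu> t = exp (D 0 t - complex_of_real (t\<^sup>2 / 2))"
          using D0[OF t] Lc[OF t] by simp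
        have "cmod (D 0 t) \<le> (c * \<bar>t\<bar>) * t\<^sup>2"
          using b0[OF t] by (simp add: power2_eq_square mult.assoc abs_mult_self_eq)
        also have "\<dots> \<le> (1 / 4) * t\<^sup>2"
        proof (rule mult_right_mono)
          have "c * \<bar>t\<bar> \<le> c * T" using t c by (intro mult_left_mono) auto
          also have "\<dots> = C * \<epsilon>" using pos by (simp add: c_def T_def)
          finally show "c * \<bar>t\<bar> \<le> 1 / 4" using \<epsilon> by linarith
        qed simp
        finally show "cmod (D 0 t) \<le> t\<^sup>2 / 4" by simp
        fix j assume j: "j \<le> m + 1"
        have low: "c * \<bar>t\<bar> ^ k \<le> C' / \<sigma> n * (1 + \<bar>t\<bar>) ^ 3" if "k \<le> 3" for k
        proof (rule mult_mono[OF c(2)])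
          have "\<bar>t\<bar> ^ k \<le> (1 + \<bar>t\<bar>) ^ k" by (intro power_mono) auto
          also have "\<dots> \<le> (1 + \<bar>t\<bar>) ^ 3" using that by (intro power_increasing) auto
          finally show "\<bar>t\<bar> ^ k \<le> (1 + \<bar>t\<bar>) ^ 3" .
        qed (use c C' pos in auto)
        consider "j = 0" | "j = 1" | "j = 2" | "3 \<le> j" by linarith
        then show "cmod (D j t) \<le> C' / \<sigma> n * (1 + \<bar>t\<bar>) ^ 3"
        proof cases
          case 1 show ?thesis unfolding 1 by (rule order_trans[OF b0[OF t] low]) simp
        next
          case 2 show ?thesis unfolding 2 by (rule order_trans[OF b1[OF t] low]) simp
        next
          case 3 show ?thesis unfolding 3 by (rule order_trans[OF b2[OF t] low]) simp
        next
          case 4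
          have "1 / \<sigma> n \<le> 1 + \<tau>" using \<open>1 / \<sigma> n \<le> \<tau>\<close> by simp
          then have "(1 / \<sigma> n) ^ (j - 3) \<le> (1 + \<tau>) ^ (j - 3)" using pos by (intro power_mono) auto
          also have "\<dots> \<le> (1 + \<tau>) ^ m" using \<tau> j by (intro power_increasing) auto
          finally have p: "(1 / \<sigma> n) ^ (j - 3) \<le> (1 + \<tau>) ^ m" .
          have "j - 2 = Suc (j - 3)" using 4 by simp
          then have "C / \<sigma> n ^ (j - 2) = C / \<sigma> n * (1 / \<sigma> n) ^ (j - 3)"
            by (simp add: power_one_over)
          also have "\<dots> \<le> C / \<sigma> n * (1 + \<tau>) ^ m" using p C pos by (intro mult_left_mono) auto
          also have "\<dots> = C' / \<sigma> n * 1" by (simp add: C'_def)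
          also have "\<dots> \<le> C' / \<sigma> n * (1 + \<bar>t\<bar>) ^ 3" using C' pos by (intro mult_left_mono one_le_power) auto
          finally show ?thesis using Db[OF 4 j, of t] t sub by fastforce
        qed
      qed
    qed
    then show "smooth_bound {- (\<epsilon> * \<sigma> n)..\<epsilon> * \<sigma> n} {} (m + 1) (\<lambda>t. B * C' / \<sigma> n / (1 + \<bar>t\<bar>) ^ 2)
      (\<lambda>t. char (distr M borel ?X) t - char std_normal_distribution t)"
      by (simp add: T_def \<mu>_def)
  qed
qed

section \<open>Absolutely continuous functions\<close>

text \<open>Replaces the length condition in absolute continuity by containment in an open set,
  which a gauge can enforce. \<open>U\<close> is an open superset of \<open>N\<close> with measure
  below the \<open>d\<close> belonging to \<open>e\<close>; disjoint intervals inside it have total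
  length at most that measure.\<close>

lemma locally_abs_continuous_cover:
  assumes ac: "locally_abs_continuous h" and N: "N \<in> null_sets lebesgue" and e: "e > 0"
  shows "\<exists>U. open U \<and> N \<subseteq> U \<and> (\<forall>P. finite P \<longrightarrow> (\<forall>(u, v)\<in>P. a \<le> u \<and> u \<le> v \<and> v \<le> b \<and> {u..v} \<subseteq> U) \<longrightarrow>
    disjoint_family_on (\<lambda>(u, v). {u<..<v}) P \<longrightarrow> (\<Sum>(u, v)\<in>P. \<bar>h v - h u\<bar>) < e)"
proof -
  from ac e obtain d where d: "d > 0" "\<And>P. finite P \<Longrightarrow> (\<forall>(u, v)\<in>P. a \<le> u \<and> u \<le> v \<and> v \<le> b) \<Longrightarrow>
        disjoint_family_on (\<lambda>(u, v). {u<..<v}) P \<Longrightarrow> (\<Sum>(u, v)\<in>P. v - u) < d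
        \<Longrightarrow> (\<Sum>(u, v)\<in>P. \<bar>h v - h u\<bar>) < e"
    unfolding locally_abs_continuous_def by meson
  obtain U where U: "open U" "N \<subseteq> U" "emeasure lebesgue (U - N) < ennreal d"
    using sets_lebesgue_outer_open[OF null_setsD2[OF N] d(1)] by blast
  have "emeasure lebesgue U = emeasure lebesgue (U - N)"
    using N U(1) by (intro emeasure_Diff_null_set[symmetric]) (auto intro: lborelD_Collect)
  then have em: "emeasure lebesgue U < ennreal d" using U by simp
  have "(\<Sum>(u, v)\<in>P. \<bar>h v - h u\<bar>) < e"
    if P: "finite P" "\<forall>(u, v)\<in>P. a \<le> u \<and> u \<le> v \<and> v \<le> b \<and> {u..v} \<subseteq> U"
      "disjoint_family_on (\<lambda>(u, v). {u<..<v}) P" for P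
  proof (rule d(2)[OF P(1) _ P(3)])
    show "\<forall>(u, v)\<in>P. a \<le> u \<and> u \<le> v \<and> v \<le> b" using P(2) by auto
    have "(\<Sum>(u, v)\<in>P. v - u) = (\<Sum>p\<in>P. measure lebesgue (case p of (u, v) \<Rightarrow> {u<..<v}))"
      using P(2) by (intro sum.cong) auto
    also have "\<dots> = measure lebesgue (\<Union>p\<in>P. case p of (u, v) \<Rightarrow> {u<..<v})"
      by (rule measure_finite_Union[symmetric]) (use P in auto)
    finally have eq: "(\<Sum>(u, v)\<in>P. v - u) = measure lebesgue (\<Union>p\<in>P. case p of (u, v) \<Rightarrow> {u<..<v})" .
    have sub: "(\<Union>p\<in>P. case p of (u, v) \<Rightarrow> {u<..<v}) \<subseteq> U" using P(2) by fastforce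
    have "emeasure lebesgue (\<Union>p\<in>P. case p of (u, v) \<Rightarrow> {u<..<v}) \<le> emeasure lebesgue U"
      by (rule emeasure_mono[OF sub]) (use U(1) in simp)
    with em have "emeasure lebesgue (\<Union>p\<in>P. case p of (u, v) \<Rightarrow> {u<..<v}) < ennreal d" by simp
    moreover from this have "emeasure lebesgue (\<Union>p\<in>P. case p of (u, v) \<Rightarrow> {u<..<v}) \<noteq> \<top>" by auto
    ultimately show "(\<Sum>(u, v)\<in>P. v - u) < d"
      unfolding eq using emeasure_eq_ennreal_measure[of lebesgue "\<Union>p\<in>P. case p of (u, v) \<Rightarrow> {u<..<v}"]
      by (simp add: ennreal_less_iff)
  qed
  then show ?thesis using U by blast
qed

text \<open>The gauge straddles the points of differentiability, and confines the intervals tagged by the exceptional null set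
  to an open set of small measure, where absolute continuity applies.\<close>

lemma locally_abs_continuous_FTC:
  assumes diff: "AE x in lebesgue. h differentiable (at x)" and ac: "locally_abs_continuous h" and ab: "a \<le> b"
  shows "(deriv h has_integral (h b - h a)) {a..b}"
proof -
  obtain N where N: "N \<in> null_sets lebesgue" "\<And>x. x \<notin> N \<Longrightarrow> h differentiable (at x)"
    using diff unfolding eventually_ae_filter by auto
  \<comment> \<open>With the value 0 on \<open>N\<close>, intervals tagged there contribute only
    increments of \<open>h\<close> to the error. The change on a null set is reverted at the
    end.\<close>
  define f where "f x = (if x \<in> N then 0 else deriv h x)" for x
  have "(f has_integral (h b - h a)) {a..b}"
    unfolding has_integral_real
  proof (intro allI impI)
    fix e :: real assume e: "e > 0"
    \<comment> \<open>The added 1 keeps \<open>w\<close> positive when \<open>a = b\<close>.\<close>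
    define w where "w = b - a + 1"
    have w: "w > 0" using ab by (simp add: w_def)
    define e1 where "e1 = e / (2 * w)"
    have e1: "e1 > 0" using e w by (simp add: e1_def)
    have "e1 * (b - a) < e1 * w" using e1 by (simp add: w_def)
    also have "\<dots> = e / 2" using w by (simp add: e1_def)
    finally have e1b: "e1 * (b - a) < e / 2" .
    obtain U where U: "open U" "N \<subseteq> U" and ac': "\<And>P. finite P \<Longrightarrow>
      (\<forall>(u, v)\<in>P. a \<le> u \<and> u \<le> v \<and> v \<le> b \<and> {u..v} \<subseteq> U) \<Longrightarrow>
      disjoint_family_on (\<lambda>(u, v). {u<..<v}) P \<Longrightarrow> (\<Sum>(u, v)\<in>P. \<bar>h v - h u\<bar>) < e / 2"
      using locally_abs_continuous_cover[OF ac N(1), of "e / 2" a b] e by auto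
    have "\<exists>r>0. \<forall>y. \<bar>y - x\<bar> < r \<longrightarrow> \<bar>h y - h x - deriv h x * (y - x)\<bar> \<le> e1 * \<bar>y - x\<bar>" if "x \<notin> N" for x
    proof -
      have "(h has_derivative (\<lambda>y. deriv h x * y)) (at x)"
        using N(2)[OF that] by (metis DERIV_deriv_iff_real_differentiable has_field_derivative_def)
      then show ?thesis
        unfolding has_derivative_at_alt using e1 by (simp add: real_norm_def)
    qed
    then obtain r where r: "\<And>x. x \<notin> N \<Longrightarrow> r x > 0"
      "\<And>x y. x \<notin> N \<Longrightarrow> \<bar>y - x\<bar> < r x \<Longrightarrow> \<bar>h y - h x - deriv h x * (y - x)\<bar> \<le> e1 * \<bar>y - x\<bar>"
      by metis
    define \<gamma> where "\<gamma> x = (if x \<in> N then U else ball x (r x))" for x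
    show "\<exists>\<gamma>. gauge \<gamma> \<and> (\<forall>\<D>. \<D> tagged_division_of {a..b} \<and> \<gamma> fine \<D> \<longrightarrow>
        norm ((\<Sum>(x, k)\<in>\<D>. measure lborel k *\<^sub>R f x) - (h b - h a)) < e)"
    proof (intro exI[of _ \<gamma>] conjI allI impI)
      show "gauge \<gamma>" unfolding gauge_def \<gamma>_def using U r(1) by auto
      fix p assume "p tagged_division_of {a..b} \<and> \<gamma> fine p"
      then have p: "p tagged_division_of {a..b}" and fine: "\<gamma> fine p" by auto
      note pD = tagged_division_ofD[OF p]
      have K: "\<exists>u v. k = {u..v} \<and> u \<le> x \<and> x \<le> v \<and> a \<le> u \<and> v \<le> b \<and> Inf k = u \<and> Sup k = v \<and> measure lborel k = v - u"
        if xk: "(x, k) \<in> p" for x k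
      proof -
        obtain u v where k: "k = {u..v}" using pD(4)[OF xk] by auto
        moreover have "u \<le> x" "x \<le> v" using pD(2)[OF xk] k by auto
        moreover have "a \<le> u" "v \<le> b" using pD(3)[OF xk] k calculation by auto
        ultimately show ?thesis by auto
      qed
      let ?E = "\<lambda>(x, k). measure lborel k *\<^sub>R f x - (h (Sup k) - h (Inf k))"
      have "(\<Sum>(x, k)\<in>p. measure lborel k *\<^sub>R f x) - (h b - h a) = (\<Sum>xk\<in>p. ?E xk)"
        unfolding additive_tagged_division_1[OF ab p, of h, symmetric] sum_subtractf[symmetric]
        by (intro sum.cong) auto
      also have "\<bar>\<dots>\<bar> \<le> (\<Sum>xk\<in>p. \<bar>?E xk\<bar>)" by (rule sum_abs)
      also have "\<dots> = (\<Sum>xk\<in>{xk\<in>p. fst xk \<notin> N}. \<bar>?E xk\<bar>) + (\<Sum>xk\<in>{xk\<in>p. fst xk \<in> N}. \<bar>?E xk\<bar>)"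
        using pD(1) by (subst sum.union_disjoint[symmetric]) (auto intro!: sum.cong)
      also have "\<dots> < e / 2 + e / 2"
      proof (rule add_less_le_mono)
        have "(\<Sum>xk\<in>{xk\<in>p. fst xk \<notin> N}. \<bar>?E xk\<bar>) \<le> (\<Sum>xk\<in>{xk\<in>p. fst xk \<notin> N}. e1 * measure lborel (snd xk))"
        proof (rule sum_mono)
          fix xk assume "xk \<in> {xk\<in>p. fst xk \<notin> N}"
          then obtain x k where xk: "xk = (x, k)" "(x, k) \<in> p" "x \<notin> N" by (cases xk) auto
          obtain u v where k: "k = {u..v}" "u \<le> x" "x \<le> v" "Inf k = u" "Sup k = v" "measure lborel k = v - u"
            using K[OF xk(2)] by blast
          have "k \<subseteq> ball x (r x)" using fine xk unfolding fine_def \<gamma>_def by fastforce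
          then have "u \<in> ball x (r x)" "v \<in> ball x (r x)" using k by (auto simp del: mem_ball)
          then have uv: "\<bar>u - x\<bar> < r x" "\<bar>v - x\<bar> < r x" by (auto simp: dist_real_def)
          have "\<bar>h u - h x - deriv h x * (u - x)\<bar> \<le> e1 * (x - u)" "\<bar>h v - h x - deriv h x * (v - x)\<bar> \<le> e1 * (v - x)"
            using r(2)[OF xk(3) uv(1)] r(2)[OF xk(3) uv(2)] k by auto
          moreover have "(v - u) * deriv h x - (h v - h u) =
             (h u - h x - deriv h x * (u - x)) - (h v - h x - deriv h x * (v - x))" by (simp add: algebra_simps)
          moreover have "e1 * (x - u) + e1 * (v - x) = e1 * (v - u)" by (simp add: algebra_simps)
          ultimately have "\<bar>(v - u) * deriv h x - (h v - h u)\<bar> \<le> e1 * (v - u)" by linarith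
          then show "\<bar>?E xk\<bar> \<le> e1 * measure lborel (snd xk)" using xk k by (simp add: f_def)
        qed
        also have "\<dots> \<le> (\<Sum>xk\<in>p. e1 * measure lborel (snd xk))"
          using pD(1) e1 by (intro sum_mono2) auto
        also have "\<dots> = e1 * (b - a)"
          using additive_content_tagged_division[of p a b] p ab by (simp add: sum_distrib_left[symmetric] case_prod_beta)
        also have "\<dots> < e / 2" by (rule e1b)
        finally show "(\<Sum>xk\<in>{xk\<in>p. fst xk \<notin> N}. \<bar>?E xk\<bar>) < e / 2" .
      next
        \<comment> \<open>Degenerate intervals contribute nothing and are dropped, because
          injectivity of \<open>\<phi>\<close> is derived from the disjointness of nonempty
          interiors.\<close>
        define q where "q = {xk\<in>p. fst xk \<in> N \<and> Inf (snd xk) < Sup (snd xk)}"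
        define \<phi> :: "real \<times> real set \<Rightarrow> real \<times> real" where "\<phi> xk = (Inf (snd xk), Sup (snd xk))" for xk
        have q: "finite q" "q \<subseteq> p" using pD(1) by (auto simp: q_def)
        have intk: "interior k = {Inf k<..<Sup k}" if "(x, k) \<in> p" for x k
          using K[OF that] by (metis interior_atLeastAtMost_real)
        have disj: "{Inf k<..<Sup k} \<inter> {Inf k'<..<Sup k'} = {}" if "(x, k) \<in> p" "(x', k') \<in> p" "(x, k) \<noteq> (x', k')" for x k x' k'
          using pD(5)[OF that] intk[OF that(1)] intk[OF that(2)] by simp
        have inj: "inj_on \<phi> q"
        proof (rule inj_onI)
          fix xk xk' assume A: "xk \<in> q" "xk' \<in> q" "\<phi> xk = \<phi> xk'"
          show "xk = xk'"
          proof (rule ccontr)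
            assume "xk \<noteq> xk'"
            with A q(2) disj[of "fst xk" "snd xk" "fst xk'" "snd xk'"]
            have "{Inf (snd xk)<..<Sup (snd xk)} = {}" by (auto simp: \<phi>_def)
            then show False using A(1) by (auto simp: q_def)
          qed
        qed
        have "(\<Sum>xk\<in>{xk\<in>p. fst xk \<in> N}. \<bar>?E xk\<bar>) = (\<Sum>xk\<in>q. \<bar>?E xk\<bar>)"
        proof (rule sum.mono_neutral_right)
          show "\<forall>xk\<in>{xk\<in>p. fst xk \<in> N} - q. \<bar>?E xk\<bar> = 0"
          proof
            fix xk assume "xk \<in> {xk\<in>p. fst xk \<in> N} - q"
            then obtain x k where xk: "xk = (x, k)" "(x, k) \<in> p" "x \<in> N" "\<not> Inf k < Sup k"
              by (cases xk) (auto simp: q_def)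
            with K[OF xk(2)] have "Inf k = Sup k" by auto
            then show "\<bar>?E xk\<bar> = 0" using xk by (simp add: f_def)
          qed
        qed (use pD(1) in \<open>auto simp: q_def\<close>)
        also have "\<dots> = (\<Sum>xk\<in>q. case \<phi> xk of (u, v) \<Rightarrow> \<bar>h v - h u\<bar>)"
          by (rule sum.cong) (auto simp: q_def \<phi>_def f_def abs_minus_commute)
        also have "\<dots> = (\<Sum>(u, v)\<in>\<phi> ` q. \<bar>h v - h u\<bar>)"
          using inj by (simp add: sum.reindex)
        also have "\<dots> < e / 2"
        proof (rule ac')
          show "finite (\<phi> ` q)" using q by simp
          show "\<forall>(u, v)\<in>\<phi> ` q. a \<le> u \<and> u \<le> v \<and> v \<le> b \<and> {u..v} \<subseteq> U"
          proof
            fix uv assume "uv \<in> \<phi> ` q"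
            then obtain x k where xk: "uv = \<phi> (x, k)" "(x, k) \<in> p" "x \<in> N" by (auto simp: q_def)
            obtain u v where k: "k = {u..v}" "u \<le> x" "x \<le> v" "a \<le> u" "v \<le> b" "Inf k = u" "Sup k = v"
              using K[OF xk(2)] by blast
            have "k \<subseteq> U" using fine xk unfolding fine_def \<gamma>_def by fastforce
            then show "case uv of (u, v) \<Rightarrow> a \<le> u \<and> u \<le> v \<and> v \<le> b \<and> {u..v} \<subseteq> U"
              using k xk(1) by (simp add: \<phi>_def)
          qed
          show "disjoint_family_on (\<lambda>(u, v). {u<..<v}) (\<phi> ` q)"
            unfolding disjoint_family_on_def
          proof (intro ballI impI)
            fix s t assume "s \<in> \<phi> ` q" "t \<in> \<phi> ` q" "s \<noteq> t"
            then obtain xk xk' where "xk \<in> q" "xk' \<in> q" "s = \<phi> xk" "t = \<phi> xk'" "xk \<noteq> xk'" by auto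
            then show "(case s of (u, v) \<Rightarrow> {u<..<v}) \<inter> (case t of (u, v) \<Rightarrow> {u<..<v}) = {}"
              using disj[of "fst xk" "snd xk" "fst xk'" "snd xk'"] q(2) by (auto simp: \<phi>_def)
          qed
        qed
        finally show "(\<Sum>xk\<in>{xk\<in>p. fst xk \<in> N}. \<bar>?E xk\<bar>) \<le> e / 2" by simp
      qed
      finally show "norm ((\<Sum>(x, k)\<in>p. measure lborel k *\<^sub>R f x) - (h b - h a)) < e" by simp
    qed
  qed
  then show ?thesis
    by (rule has_integral_spike[rotated 2, where S = N]) (use N in \<open>auto simp: negligible_iff_null_sets f_def\<close>)
qed

section \<open>From distribution functions to expectations\<close>

text \<open>The case distinction selects the tail beyond \<open>x\<close> as seen from the origin,
  which is the expectation of the absolute value of \<open>tail_kernel x\<close>.\<close>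

lemma cdf_std_normal_tail:
  assumes m: "m \<ge> 1"
  shows "\<exists>A\<ge>0. \<forall>x. (if 0 < x then 1 - std_normal_cdf x else std_normal_cdf x) \<le> A / (1 + \<bar>x\<bar>) ^ m"
proof -
  interpret real_distribution std_normal_distribution by (rule real_dist_normal_dist)
  define A where "A = (fact (m + 1) * exp 2 :: real)"
  have A: "0 \<le> A" by (simp add: A_def)
  have meas: "measure std_normal_distribution S \<le> A / (1 + \<bar>x\<bar>) ^ m"
    if S: "S \<in> sets borel" "S \<subseteq> S'" and e: "integrable lborel (\<lambda>y. indicator S' y / (1 + \<bar>y\<bar>) ^ (m + 1))"
      "(\<integral>y. indicator S' y / (1 + \<bar>y\<bar>) ^ (m + 1) \<partial>lborel) \<le> 1 / (1 + \<bar>x\<bar>) ^ m" for S S' :: "real set" and x :: real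
  proof -
    have i: "integrable lborel (\<lambda>y. indicator S y * std_normal_density y)"
      using integrable_mult_indicator[of S lborel std_normal_density] S(1) integrable_normal_density[of 1 0] by simp
    have "measure std_normal_distribution S = (\<integral>y. indicator S y \<partial>std_normal_distribution)"
      using S(1) by simp
    also have "\<dots> = (\<integral>y. indicator S y * std_normal_density y \<partial>lborel)"
      using S(1) by (subst integral_density) (auto simp: mult.commute)
    also have "\<dots> \<le> (\<integral>y. A * (indicator S' y / (1 + \<bar>y\<bar>) ^ (m + 1)) \<partial>lborel)"
    proof (rule integral_mono[OF i integrable_mult_right[OF e(1)]])
      fix y show "indicator S y * std_normal_density y \<le> A * (indicator S' y / (1 + \<bar>y\<bar>) ^ (m + 1))"
        using std_normal_density_le[of y "m + 1"] S(2) A by (auto simp: indicator_def A_def)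
    qed
    also have "\<dots> = A * (\<integral>y. indicator S' y / (1 + \<bar>y\<bar>) ^ (m + 1) \<partial>lborel)"
      by (rule integral_mult_right_zero)
    also have "\<dots> \<le> A * (1 / (1 + \<bar>x\<bar>) ^ m)" by (intro mult_left_mono e A)
    finally show ?thesis by simp
  qed
  have "(if 0 < x then 1 - std_normal_cdf x else std_normal_cdf x) \<le> A / (1 + \<bar>x\<bar>) ^ m" for x
  proof (cases "0 < x")
    case True
    have "1 - std_normal_cdf x = measure std_normal_distribution {x<..}"
      using prob_compl[of "{..x}"] by (simp add: cdf_def2 Compl_eq_Diff_UNIV[symmetric])
    also have "\<dots> \<le> A / (1 + \<bar>x\<bar>) ^ m"
      by (rule meas[OF _ _ envelope_integral_atLeast[OF m]]) (use True in auto)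
    finally show ?thesis using True by simp
  next
    case False
    then show ?thesis
      using meas[OF _ _ envelope_integral_atMost[OF m, of x]] by (simp add: cdf_def2)
  qed
  with A show ?thesis by blast
qed

text \<open>The signed indicator of the points between 0 and \<open>w\<close>: integrating it over
  \<open>x\<close> against \<open>h'\<close> gives \<open>h w - h 0\<close>. The strict and weak
  inequalities are placed so that, for given \<open>x\<close>, it is the indicator of
  \<open>{x<..}\<close> or minus that of \<open>{..x}\<close>, whose measures are expressed by the
  distribution function at \<open>x\<close> itself.\<close>

definition tail_kernel :: "real \<Rightarrow> real \<Rightarrow> real" where
  "tail_kernel x w = (if 0 < x \<and> x < w then 1 else if w \<le> x \<and> x \<le> 0 then - 1 else 0)"

lemma tail_kernel_measurable [measurable]:
  assumes [measurable]: "f \<in> borel_measurable M" "g \<in> borel_measurable M"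
  shows "(\<lambda>p. tail_kernel (f p) (g p)) \<in> borel_measurable M"
  unfolding tail_kernel_def by measurable

lemma (in real_distribution) integral_tail_kernel:
  "(\<integral>w. tail_kernel x w \<partial>M) = (if 0 < x then 1 - cdf M x else - cdf M x)"
  "(\<integral>w. \<bar>tail_kernel x w\<bar> \<partial>M) = (if 0 < x then 1 - cdf M x else cdf M x)"
proof -
  have 1: "1 - cdf M x = measure M {x<..}"
    using prob_compl[of "{..x}"] by (simp add: cdf_def2 Compl_eq_Diff_UNIV[symmetric])
  have 2: "tail_kernel x = (if 0 < x then indicator {x<..} else (\<lambda>w. - indicator {..x} w))"
    by (auto simp: tail_kernel_def fun_eq_iff)
  show "(\<integral>w. tail_kernel x w \<partial>M) = (if 0 < x then 1 - cdf M x else - cdf M x)"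
    unfolding 1 2 by (auto simp: cdf_def2)
  have 3: "(\<lambda>w. \<bar>tail_kernel x w\<bar>) = (if 0 < x then indicator {x<..} else indicator {..x})"
    by (auto simp: tail_kernel_def fun_eq_iff)
  show "(\<integral>w. \<bar>tail_kernel x w\<bar> \<partial>M) = (if 0 < x then 1 - cdf M x else cdf M x)"
    unfolding 1 3 by (auto simp: cdf_def2)
qed

text \<open>Fubini for \<open>tail_kernel x w * g x\<close>. Splitting at the origin makes it
  converge: on each half-line \<open>g\<close> meets only the decaying tail of \<open>\<nu>\<close>,
  whose bound matches the weight in \<open>gi\<close>. Integrability of \<open>h\<close> is obtained
  on the way.\<close>

lemma integral_tail_representation:
  assumes \<nu>: "real_distribution \<nu>" and [measurable]: "g \<in> borel_measurable borel"
    and gi: "integrable lborel (\<lambda>x. \<bar>g x\<bar> / (1 + \<bar>x\<bar>) ^ m)"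
    and h: "\<And>w. h w = h 0 + (\<integral>x. tail_kernel x w * g x \<partial>lborel)"
    and A: "\<And>x. (if 0 < x then 1 - cdf \<nu> x else cdf \<nu> x) \<le> A / (1 + \<bar>x\<bar>) ^ m"
  shows "integrable \<nu> h" "(\<integral>w. h w \<partial>\<nu>) = h 0 + (\<integral>x. (if 0 < x then 1 - cdf \<nu> x else - cdf \<nu> x) * g x \<partial>lborel)"
    "integrable lborel (\<lambda>x. (if 0 < x then 1 - cdf \<nu> x else - cdf \<nu> x) * g x)"
proof -
  interpret real_distribution \<nu> by fact
  interpret P: pair_sigma_finite lborel \<nu> ..
  have tk: "integrable \<nu> (\<lambda>w. tail_kernel x w * g x)" for x
    by (rule integrable_const_bound[of _ "\<bar>g x\<bar>"]) (auto simp: tail_kernel_def)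
  have i: "integrable (lborel \<Otimes>\<^sub>M \<nu>) (\<lambda>(x, w). tail_kernel x w * g x)"
  proof (rule P.Fubini_integrable)
    have eq: "(\<integral>w. norm (case (x, w) of (x, w) \<Rightarrow> tail_kernel x w * g x) \<partial>\<nu>) = (if 0 < x then 1 - cdf \<nu> x else cdf \<nu> x) * \<bar>g x\<bar>" for x
      unfolding integral_tail_kernel(2)[symmetric] by (simp add: abs_mult)
    have m1: "(\<lambda>x. \<integral>w. norm (case (x, w) of (x, w) \<Rightarrow> tail_kernel x w * g x) \<partial>\<nu>) \<in> borel_measurable lborel"
      by measurable
    show "integrable lborel (\<lambda>x. \<integral>w. norm (case (x, w) of (x, w) \<Rightarrow> tail_kernel x w * g x) \<partial>\<nu>)"
    proof (rule Bochner_Integration.integrable_bound[OF integrable_mult_right[OF gi, of A] m1], rule AE_I2)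
      fix x
      define t where "t = (if 0 < x then 1 - cdf \<nu> x else cdf \<nu> x)"
      have "0 \<le> t" using cdf_bounded_prob[of x] cdf_nonneg[of x] by (simp add: t_def)
      then have "0 \<le> t * \<bar>g x\<bar>" by simp
      moreover have "t * \<bar>g x\<bar> \<le> A / (1 + \<bar>x\<bar>) ^ m * \<bar>g x\<bar>"
        unfolding t_def by (intro mult_right_mono A) auto
      then have "t * \<bar>g x\<bar> \<le> A * (\<bar>g x\<bar> / (1 + \<bar>x\<bar>) ^ m)" by simp
      ultimately show "norm (\<integral>w. norm (case (x, w) of (x, w) \<Rightarrow> tail_kernel x w * g x) \<partial>\<nu>) \<le> norm (A * (\<bar>g x\<bar> / (1 + \<bar>x\<bar>) ^ m))"
        unfolding eq unfolding t_def[symmetric] real_norm_def by linarith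
    qed
  qed (use tk in auto)
  have inner: "(\<integral>w. tail_kernel x w * g x \<partial>\<nu>) = (if 0 < x then 1 - cdf \<nu> x else - cdf \<nu> x) * g x" for x
    unfolding integral_tail_kernel(1)[symmetric] by simp
  have heq: "h = (\<lambda>w. h 0 + (\<integral>x. tail_kernel x w * g x \<partial>lborel))" using h by blast
  have i2: "integrable \<nu> (\<lambda>w. \<integral>x. tail_kernel x w * g x \<partial>lborel)" by (rule P.integrable_snd[OF i])
  show "integrable \<nu> h" by (subst heq) (use i2 in simp)
  have "(\<integral>w. h w \<partial>\<nu>) = (\<integral>w. h 0 + (\<integral>x. tail_kernel x w * g x \<partial>lborel) \<partial>\<nu>)"
    by (subst heq) (rule refl)
  also have "\<dots> = h 0 + (\<integral>w. (\<integral>x. tail_kernel x w * g x \<partial>lborel) \<partial>\<nu>)"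
    using i2 prob_space by simp
  also have "(\<integral>w. (\<integral>x. tail_kernel x w * g x \<partial>lborel) \<partial>\<nu>) = (\<integral>x. (if 0 < x then 1 - cdf \<nu> x else - cdf \<nu> x) * g x \<partial>lborel)"
    using P.Fubini_integral[OF i] unfolding inner .
  finally show "(\<integral>w. h w \<partial>\<nu>) = h 0 + (\<integral>x. (if 0 < x then 1 - cdf \<nu> x else - cdf \<nu> x) * g x \<partial>lborel)" .
  show "integrable lborel (\<lambda>x. (if 0 < x then 1 - cdf \<nu> x else - cdf \<nu> x) * g x)"
    using P.integrable_fst[OF i] unfolding inner .
qed

text \<open>Fubini is applied to a product with \<open>lborel\<close>, while \<open>deriv h\<close>
  is given only through its gauge integrals. These make it Lebesgue measurable on each
  \<open>[-n, n]\<close>, hence everywhere, and such a function agrees almost everywhere with a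
  Borel one.\<close>

lemma borel_version_of_deriv:
  fixes h :: "real \<Rightarrow> real"
  assumes h: "\<And>a b. a \<le> b \<Longrightarrow> (deriv h has_integral (h b - h a)) {a..b}"
  obtains g where "g \<in> borel_measurable borel" "AE x in lebesgue. deriv h x = g x"
proof -
  have "(\<lambda>x. deriv h x * indicator {- real n..real n} x) \<in> borel_measurable lebesgue" for n
    by (rule has_integral_implies_lebesgue_measurable_real[OF h]) simp
  then have "deriv h \<in> borel_measurable lebesgue"
  proof (rule borel_measurable_LIMSEQ_real[rotated])
    fix x :: real
    obtain n0 where n0: "\<bar>x\<bar> \<le> real n0" using real_arch_simple by blast
    have "eventually (\<lambda>n. deriv h x * indicator {- real n..real n} x = deriv h x) sequentially"
      using eventually_ge_at_top[of n0]
    proof eventually_elim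
      case (elim n)
      then have "x \<in> {- real n..real n}" using n0 by auto
      then show ?case by simp
    qed
    then show "(\<lambda>n. deriv h x * indicator {- real n..real n} x) \<longlonglongrightarrow> deriv h x"
      by (rule tendsto_eventually)
  qed
  from completion_ex_borel_measurable_real[OF this] obtain g
    where "g \<in> borel_measurable lborel" "AE x in lborel. deriv h x = g x" by blast
  then show ?thesis using that[of g] by (simp add: AE_completion)
qed

theorem normal_approx_of_cdf_bound:
  fixes h :: "real \<Rightarrow> real"
  assumes M: "prob_space M" and [measurable]: "W \<in> borel_measurable M" and m: "m \<ge> 1"
    and K: "\<And>x. \<bar>cdf (distr M borel W) x - std_normal_cdf x\<bar> \<le> K / (1 + \<bar>x\<bar>) ^ m"
    and h: "\<And>a b. a \<le> b \<Longrightarrow> (deriv h has_integral (h b - h a)) {a..b}"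
    and H: "H m h < \<infinity>"
  shows "normal_approx M W h (K * enn2real (H m h))"
proof -
  interpret M: prob_space M by fact
  let ?\<gamma> = std_normal_distribution
  define \<mu> where "\<mu> = distr M borel W"
  have \<mu>: "real_distribution \<mu>" unfolding \<mu>_def by (rule M.real_distribution_distr) measurable
  note \<gamma> = real_dist_normal_dist
  have K0: "0 \<le> K" using K[of 0] by simp
  obtain g where g [measurable]: "g \<in> borel_measurable borel" and ae: "AE x in lebesgue. deriv h x = g x"
    using borel_version_of_deriv[OF h] by blast
  let ?w = "\<lambda>x. \<bar>g x\<bar> / (1 + \<bar>x\<bar>) ^ m"
  have "H m h = (\<integral>\<^sup>+ x. ennreal (?w x) \<partial>lebesgue)"
    unfolding H_def by (rule nn_integral_cong_AE) (use ae in auto)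
  then have Hw: "H m h = (\<integral>\<^sup>+ x. ennreal (?w x) \<partial>lborel)" by (simp add: nn_integral_completion)
  have wi: "integrable lborel ?w"
    by (rule integrableI_nonneg) (use H Hw in auto)
  have wH: "(\<integral>x. ?w x \<partial>lborel) = enn2real (H m h)"
    unfolding Hw by (rule integral_eq_nn_integral) auto
  \<comment> \<open>On a bounded interval the weight \<open>1 / (1 + |x|) ^ m\<close> is bounded
    away from 0, so finiteness of \<open>H\<close> yields local integrability.\<close>
  have gsi: "set_integrable lborel {a..b} g" for a b
  proof -
    let ?R = "(1 + max \<bar>a\<bar> \<bar>b\<bar>) ^ m"
    have "integrable lborel (\<lambda>x. indicator {a..b} x *\<^sub>R g x)"
    proof (rule Bochner_Integration.integrable_bound[OF integrable_mult_right[OF wi, of ?R]], measurable, rule AE_I2)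
      fix x
      show "norm (indicator {a..b} x *\<^sub>R g x) \<le> norm (?R * ?w x)"
      proof (cases "x \<in> {a..b}")
        case True
        then have "\<bar>x\<bar> \<le> max \<bar>a\<bar> \<bar>b\<bar>" by auto
        then have "(1 + \<bar>x\<bar>) ^ m \<le> ?R" by (intro power_mono) auto
        then have "\<bar>g x\<bar> * (1 + \<bar>x\<bar>) ^ m \<le> \<bar>g x\<bar> * ?R" by (intro mult_left_mono) auto
        then have "\<bar>g x\<bar> \<le> ?R * ?w x" by (simp add: pos_le_divide_eq mult.commute)
        then show ?thesis using True by (simp add: abs_mult)
      qed simp
    qed
    then show ?thesis unfolding set_integrable_def .
  qed
  have gint: "(\<integral>x. indicator {a..b} x * g x \<partial>lborel) = h b - h a" if "a \<le> b" for a b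
  proof -
    obtain N where N: "N \<in> null_sets lebesgue" "\<And>x. x \<notin> N \<Longrightarrow> deriv h x = g x"
      using ae unfolding eventually_ae_filter by auto
    have "(g has_integral (h b - h a)) {a..b}"
      by (rule has_integral_spike[where S = N, OF _ _ h[OF that]]) (use N in \<open>auto simp: negligible_iff_null_sets\<close>)
    then have "integral {a..b} g = h b - h a" by (rule integral_unique)
    then show ?thesis
      using set_borel_integral_eq_integral(2)[OF gsi[of a b]] by (simp add: set_lebesgue_integral_def)
  qed
  have rep: "h w = h 0 + (\<integral>x. tail_kernel x w * g x \<partial>lborel)" for w
  proof (cases "0 < w")
    case True
    have "AE x in lborel. tail_kernel x w * g x = indicator {0..w} x * g x"
      using AE_lborel_singleton[of 0] AE_lborel_singleton[of w]
      by eventually_elim (use True in \<open>auto simp: tail_kernel_def indicator_def\<close>)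
    then have "(\<integral>x. tail_kernel x w * g x \<partial>lborel) = (\<integral>x. indicator {0..w} x * g x \<partial>lborel)"
      by (intro integral_cong_AE) auto
    then show ?thesis using gint[of 0 w] True by simp
  next
    case False
    have "(\<integral>x. tail_kernel x w * g x \<partial>lborel) = (\<integral>x. - (indicator {w..0} x * g x) \<partial>lborel)"
      by (rule Bochner_Integration.integral_cong) (use False in \<open>auto simp: tail_kernel_def indicator_def\<close>)
    then show ?thesis using gint[of w 0] False by simp
  qed
  have hm: "h \<in> borel_measurable borel"
  proof -
    have "(\<lambda>w. h 0 + (\<integral>x. tail_kernel x w * g x \<partial>lborel)) \<in> borel_measurable borel"
      by measurable
    moreover have "h = (\<lambda>w. h 0 + (\<integral>x. tail_kernel x w * g x \<partial>lborel))" by (rule ext) (rule rep)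
    ultimately show ?thesis by (rule back_subst[where P = "\<lambda>h. h \<in> borel_measurable borel", OF _ sym])
  qed
  obtain A where A: "0 \<le> A" "\<And>x. (if 0 < x then 1 - cdf ?\<gamma> x else cdf ?\<gamma> x) \<le> A / (1 + \<bar>x\<bar>) ^ m"
    using cdf_std_normal_tail[OF m] by blast
  \<comment> \<open>The tails of \<open>\<mu>\<close> inherit polynomial decay from the normal law
    through \<open>K\<close>; this takes the place of moment bounds for \<open>W\<close>.\<close>
  have A\<mu>: "(if 0 < x then 1 - cdf \<mu> x else cdf \<mu> x) \<le> (A + K) / (1 + \<bar>x\<bar>) ^ m" for x
    using A(2)[of x] K[of x] unfolding \<mu>_def[symmetric] add_divide_distrib by (auto split: if_splits)
  note R\<gamma> = integral_tail_representation[OF \<gamma> g wi rep A(2)]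
  note R\<mu> = integral_tail_representation[OF \<mu> g wi rep A\<mu>]
  \<comment> \<open>\<open>h 0\<close> and the constants 1 cancel, and the same difference of
    distribution functions remains on both half-lines.\<close>
  have "(\<integral>w. h w \<partial>\<mu>) - (\<integral>w. h w \<partial>?\<gamma>) = (\<integral>x. (cdf ?\<gamma> x - cdf \<mu> x) * g x \<partial>lborel)"
    unfolding R\<mu>(2) R\<gamma>(2) add_diff_cancel_left
    by (subst Bochner_Integration.integral_diff[OF R\<mu>(3) R\<gamma>(3), symmetric])
      (auto intro!: Bochner_Integration.integral_cong simp: algebra_simps)
  also have "\<bar>\<dots>\<bar> \<le> (\<integral>x. \<bar>(cdf ?\<gamma> x - cdf \<mu> x) * g x\<bar> \<partial>lborel)"
    by (rule integral_abs_bound)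
  also have "\<dots> \<le> (\<integral>x. K * ?w x \<partial>lborel)"
  proof (rule integral_mono)
    have "integrable lborel (\<lambda>x. (if 0 < x then 1 - cdf \<mu> x else - cdf \<mu> x) * g x - (if 0 < x then 1 - cdf ?\<gamma> x else - cdf ?\<gamma> x) * g x)"
      by (rule Bochner_Integration.integrable_diff[OF R\<mu>(3) R\<gamma>(3)])
    also have "(\<lambda>x. (if 0 < x then 1 - cdf \<mu> x else - cdf \<mu> x) * g x - (if 0 < x then 1 - cdf ?\<gamma> x else - cdf ?\<gamma> x) * g x)
        = (\<lambda>x. (cdf ?\<gamma> x - cdf \<mu> x) * g x)"
      by (auto simp: fun_eq_iff algebra_simps)
    finally show "integrable lborel (\<lambda>x. \<bar>(cdf ?\<gamma> x - cdf \<mu> x) * g x\<bar>)" by simp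
    show "integrable lborel (\<lambda>x. K * ?w x)" by (rule integrable_mult_right[OF wi])
    show "\<bar>(cdf ?\<gamma> x - cdf \<mu> x) * g x\<bar> \<le> K * ?w x" for x
      using mult_right_mono[OF K[of x], of "\<bar>g x\<bar>"] by (simp add: \<mu>_def abs_mult abs_minus_commute)
  qed
  also have "\<dots> = K * enn2real (H m h)" unfolding wH[symmetric] by (rule integral_mult_right_zero)
  finally have bound: "\<bar>(\<integral>w. h w \<partial>\<mu>) - (\<integral>w. h w \<partial>?\<gamma>)\<bar> \<le> K * enn2real (H m h)" .
  have hM: "integrable M (\<lambda>\<omega>. h (W \<omega>))"
    using R\<mu>(1) hm unfolding \<mu>_def by (subst (asm) integrable_distr_eq) auto
  have eM: "(\<integral>w. h w \<partial>\<mu>) = (\<integral>\<omega>. h (W \<omega>) \<partial>M)"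
    unfolding \<mu>_def using hm by (subst integral_distr) auto
  have h\<gamma>: "integrable lborel (\<lambda>x. h x * std_normal_density x)"
    using R\<gamma>(1) hm by (subst (asm) integrable_density) (auto simp: mult.commute)
  have e\<gamma>: "(\<integral>w. h w \<partial>?\<gamma>) = (\<integral>x. h x * std_normal_density x \<partial>lborel)"
    using hm by (subst integral_density) (auto simp: mult.commute)
  show ?thesis
    unfolding normal_approx_def using hM h\<gamma> bound unfolding eM e\<gamma> by blast
qed

section \<open>Powers\<close>

text \<open>For \<open>p > 0\<close> the second function is a continuous antiderivative of
  \<open>p |x|^(p - 1)\<close> across the origin, which settles the integrability of that
  singularity when \<open>p < 1\<close>.\<close>

lemma DERIV_abs_powr:
  assumes "x \<noteq> (0::real)"
  shows "((\<lambda>x. \<bar>x\<bar> powr p) has_real_derivative sgn x * (p * \<bar>x\<bar> powr (p - 1))) (at x)"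
    and "((\<lambda>x. sgn x * \<bar>x\<bar> powr p) has_real_derivative p * \<bar>x\<bar> powr (p - 1)) (at x)"
proof -
  have pos: "((\<lambda>x. \<bar>x\<bar> powr p) has_real_derivative p * \<bar>x\<bar> powr (p - 1)) (at x)
    \<and> ((\<lambda>x. sgn x * \<bar>x\<bar> powr p) has_real_derivative p * \<bar>x\<bar> powr (p - 1)) (at x)" if x: "x > 0" for x :: real
  proof -
    have d: "((\<lambda>x. x powr p) has_real_derivative p * \<bar>x\<bar> powr (p - 1)) (at x)"
      using has_real_derivative_powr[OF x, of p] x by simp
    show ?thesis
      by (intro conjI; rule has_field_derivative_transform_within_open[OF d, of "{0<..}"]) (use x in auto)
  qed
  have neg: "((\<lambda>x. \<bar>x\<bar> powr p) has_real_derivative - (p * \<bar>x\<bar> powr (p - 1))) (at x)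
    \<and> ((\<lambda>x. sgn x * \<bar>x\<bar> powr p) has_real_derivative p * \<bar>x\<bar> powr (p - 1)) (at x)" if x: "x < 0" for x :: real
  proof -
    have "((\<lambda>x. (- x) powr p) has_real_derivative p * (- x) powr (p - 1) * (- 1)) (at x)"
      by (rule DERIV_chain2[where g = uminus, OF has_real_derivative_powr]) (use x in \<open>auto intro!: derivative_eq_intros\<close>)
    then have d: "((\<lambda>x. (- x) powr p) has_real_derivative - (p * \<bar>x\<bar> powr (p - 1))) (at x)"
      using x by simp
    from DERIV_minus[OF this]
    have d': "((\<lambda>x. - ((- x) powr p)) has_real_derivative p * \<bar>x\<bar> powr (p - 1)) (at x)" by simp
    show ?thesis
      by (intro conjI has_field_derivative_transform_within_open[OF d, of "{..<0}"]
          has_field_derivative_transform_within_open[OF d', of "{..<0}"]) (use x in auto)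
  qed
  show "((\<lambda>x. \<bar>x\<bar> powr p) has_real_derivative sgn x * (p * \<bar>x\<bar> powr (p - 1))) (at x)"
    "((\<lambda>x. sgn x * \<bar>x\<bar> powr p) has_real_derivative p * \<bar>x\<bar> powr (p - 1)) (at x)"
    using pos[of x] neg[of x] assms by (cases "x > 0"; simp)+
qed

lemma continuous_on_abs_powr:
  assumes "p > 0"
  shows "continuous_on S (\<lambda>x::real. \<bar>x\<bar> powr p)" "continuous_on S (\<lambda>x::real. sgn x * \<bar>x\<bar> powr p)"
proof -
  show c: "continuous_on S (\<lambda>x::real. \<bar>x\<bar> powr p)" for S
    using assms by (intro continuous_on_powr') (auto intro!: continuous_intros)
  have "continuous_on UNIV (\<lambda>x::real. if x \<le> 0 then - (\<bar>x\<bar> powr p) else \<bar>x\<bar> powr p)"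
    by (rule continuous_on_cases_le) (auto intro!: continuous_intros c)
  also have "(\<lambda>x::real. if x \<le> 0 then - (\<bar>x\<bar> powr p) else \<bar>x\<bar> powr p) = (\<lambda>x. sgn x * \<bar>x\<bar> powr p)"
    by (auto simp: fun_eq_iff sgn_if)
  finally show "continuous_on S (\<lambda>x::real. sgn x * \<bar>x\<bar> powr p)"
    by (rule continuous_on_subset) simp
qed

text \<open>For exponents below 1 the derivative is unbounded near 0, but continuity of
  \<open>h\<close> makes a single exceptional point harmless. Powers enter the argument by this
  formula instead of passing through \<open>locally_abs_continuous\<close>.\<close>

lemma FTC_deriv_off_origin:
  fixes h :: "real \<Rightarrow> real"
  assumes "\<And>x. x \<noteq> 0 \<Longrightarrow> h differentiable (at x)" "continuous_on UNIV h" "a \<le> b"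
  shows "(deriv h has_integral (h b - h a)) {a..b}"
proof (rule fundamental_theorem_of_calculus_strong[of "{0}"])
  show "(h has_vector_derivative deriv h x) (at x)" if "x \<in> {a..b} - {0}" for x
    using assms(1)[of x] that
    by (metis DERIV_deriv_iff_real_differentiable DiffE has_real_derivative_iff_has_vector_derivative singletonI)
qed (use assms in \<open>auto intro: continuous_on_subset\<close>)

text \<open>\<open>p > 0\<close> gives convergence at the origin, \<open>p < m\<close> at
  infinity.\<close>

lemma nn_integral_abs_powr_finite:
  assumes p: "0 < p" "p < real m"
  shows "(\<integral>\<^sup>+x. ennreal (p * \<bar>x\<bar> powr (p - 1) / (1 + \<bar>x\<bar>) ^ m) \<partial>lborel) < \<infinity>"
proof -
  let ?f = "\<lambda>x::real. ennreal (p * \<bar>x\<bar> powr (p - 1) / (1 + \<bar>x\<bar>) ^ m)"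
  let ?g = "\<lambda>x::real. ennreal (p * x powr (p - 1 - m))"
  have 1: "(\<integral>\<^sup>+x. ennreal (p * \<bar>x\<bar> powr (p - 1)) * indicator {-1..1} x \<partial>lborel) < \<infinity>"
  proof -
    have "((\<lambda>x. p * \<bar>x\<bar> powr (p - 1)) has_integral (sgn 1 * \<bar>1\<bar> powr p - sgn (-1) * \<bar>-1\<bar> powr p)) {-1..1::real}"
    proof (rule fundamental_theorem_of_calculus_strong[of "{0}"])
      show "((\<lambda>x. sgn x * \<bar>x\<bar> powr p) has_vector_derivative p * \<bar>x\<bar> powr (p - 1)) (at x)" if "x \<in> {-1..1} - {0}" for x
        using DERIV_abs_powr(2)[of x p] that by (simp add: has_real_derivative_iff_has_vector_derivative)
    qed (use p continuous_on_abs_powr in auto)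
    from nn_integral_has_integral_lebesgue'[OF _ this] p show ?thesis by simp
  qed
  have 2: "(\<integral>\<^sup>+x. ?g x * indicator {1..} x \<partial>lborel) < \<infinity>"
  proof -
    have "(\<integral>\<^sup>+x. ?g x * indicator {1..} x \<partial>lborel) = ennreal (0 - p / (p - m) * 1 powr (p - m))"
    proof (rule nn_integral_FTC_atLeast)
      fix x :: real assume x: "1 \<le> x"
      then have "((\<lambda>x. p / (p - m) * x powr (p - m)) has_real_derivative p / (p - m) * ((p - m) * x powr (p - m - 1))) (at x)"
        by (intro DERIV_cmult has_real_derivative_powr) auto
      moreover have "p - m - 1 = p - 1 - m" by simp
      ultimately show "((\<lambda>x. p / (p - m) * x powr (p - m)) has_real_derivative p * x powr (p - 1 - m)) (at x)"
        using p by simp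
    next
      have "((\<lambda>x::real. x powr (p - m)) \<longlongrightarrow> 0) at_top"
        using p by (intro tendsto_neg_powr) (auto simp: filterlim_ident)
      from tendsto_mult[OF tendsto_const[of "p / (p - m)"] this]
      show "((\<lambda>x. p / (p - m) * x powr (p - m)) \<longlongrightarrow> 0) at_top" by simp
    qed (use p in auto)
    then show ?thesis by simp
  qed
  have 3: "(\<integral>\<^sup>+x. ?g (- x) * indicator {..-1} x \<partial>lborel) < \<infinity>"
  proof -
    have "(\<integral>\<^sup>+x. ?g x * indicator {1..} x \<partial>lborel) = ennreal \<bar>-1\<bar> * (\<integral>\<^sup>+x. ?g (0 + (-1) * x) * indicator {1..} (0 + (-1) * x) \<partial>lborel)"
      by (rule nn_integral_real_affine) auto
    also have "\<dots> = (\<integral>\<^sup>+x. ?g (- x) * indicator {..-1} x \<partial>lborel)"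
      by (auto intro!: nn_integral_cong simp: indicator_def)
    finally show ?thesis using 2 by simp
  qed
  have big: "p * \<bar>x\<bar> powr (p - 1) / (1 + \<bar>x\<bar>) ^ m \<le> p * \<bar>x\<bar> powr (p - 1 - m)" if "1 \<le> \<bar>x\<bar>" for x :: real
  proof -
    have "p * \<bar>x\<bar> powr (p - 1) / (1 + \<bar>x\<bar>) ^ m \<le> p * \<bar>x\<bar> powr (p - 1) / \<bar>x\<bar> ^ m"
      using p that by (intro divide_left_mono power_mono) auto
    also have "\<dots> = p * \<bar>x\<bar> powr (p - 1 - m)"
      using that by (simp add: powr_diff powr_realpow)
    finally show ?thesis .
  qed
  have small: "p * \<bar>x\<bar> powr (p - 1) / (1 + \<bar>x\<bar>) ^ m \<le> p * \<bar>x\<bar> powr (p - 1)" for x :: real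
  proof -
    have "p * \<bar>x\<bar> powr (p - 1) / (1 + \<bar>x\<bar>) ^ m \<le> p * \<bar>x\<bar> powr (p - 1) / 1"
      using p by (intro divide_left_mono) (auto intro!: one_le_power)
    then show ?thesis by simp
  qed
  have "(\<integral>\<^sup>+x. ?f x \<partial>lborel) \<le> (\<integral>\<^sup>+x. (ennreal (p * \<bar>x\<bar> powr (p - 1)) * indicator {-1..1} x + ?g x * indicator {1..} x) + ?g (- x) * indicator {..-1} x \<partial>lborel)"
  proof (rule nn_integral_mono)
    fix x :: real
    consider "\<bar>x\<bar> \<le> 1" | "x > 1" | "x < -1" by linarith
    then show "?f x \<le> (ennreal (p * \<bar>x\<bar> powr (p - 1)) * indicator {-1..1} x + ?g x * indicator {1..} x) + ?g (- x) * indicator {..-1} x"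
    proof cases
      case 1
      then have "x \<in> {-1..1}" by auto
      then have "?f x \<le> ennreal (p * \<bar>x\<bar> powr (p - 1)) * indicator {-1..1} x"
        using small[of x] by (simp add: ennreal_leI)
      also have "\<dots> \<le> \<dots> + (?g x * indicator {1..} x + ?g (- x) * indicator {..-1} x)"
        by (rule add_increasing2) auto
      finally show ?thesis by (simp add: add.assoc)
    next
      case 2
      then show ?thesis using big[of x] by (simp add: ennreal_leI)
    next
      case 3
      then show ?thesis using big[of x] by (simp add: ennreal_leI)
    qed
  qed
  also have "\<dots> = ((\<integral>\<^sup>+x. ennreal (p * \<bar>x\<bar> powr (p - 1)) * indicator {-1..1} x \<partial>lborel) + (\<integral>\<^sup>+x. ?g x * indicator {1..} x \<partial>lborel))
      + (\<integral>\<^sup>+x. ?g (- x) * indicator {..-1} x \<partial>lborel)"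
    by (subst nn_integral_add; (subst nn_integral_add)?; simp)
  also have "\<dots> < \<infinity>" using 1 2 3 by simp
  finally show ?thesis .
qed

lemma H_finite_powr:
  assumes p: "0 < p" "p < real m"
    and d: "\<And>x. x \<noteq> 0 \<Longrightarrow> \<bar>deriv h x\<bar> = p * \<bar>x\<bar> powr (p - 1)"
  shows "H m h < \<infinity>"
proof -
  have "AE x in lebesgue. x \<noteq> (0::real)"
    by (rule AE_completion[OF AE_lborel_singleton])
  then have "H m h = (\<integral>\<^sup>+x. ennreal (p * \<bar>x\<bar> powr (p - 1) / (1 + \<bar>x\<bar>) ^ m) \<partial>lebesgue)"
    unfolding H_def by (intro nn_integral_cong_AE) (use d in \<open>auto elim!: eventually_mono\<close>)
  then show ?thesis using nn_integral_abs_powr_finite[OF p] by (simp add: nn_integral_completion)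
qed

lemma abs_powr_admissible:
  assumes p: "0 < p" "p < real m"
  shows "H m (\<lambda>x. \<bar>x\<bar> powr p) < \<infinity>"
    and "a \<le> b \<Longrightarrow> (deriv (\<lambda>x::real. \<bar>x\<bar> powr p) has_integral (\<bar>b\<bar> powr p - \<bar>a\<bar> powr p)) {a..b}"
proof -
  show "H m (\<lambda>x. \<bar>x\<bar> powr p) < \<infinity>"
    by (rule H_finite_powr[OF p]) (use p in \<open>auto simp: DERIV_imp_deriv[OF DERIV_abs_powr(1)] abs_mult\<close>)
  show "a \<le> b \<Longrightarrow> (deriv (\<lambda>x::real. \<bar>x\<bar> powr p) has_integral (\<bar>b\<bar> powr p - \<bar>a\<bar> powr p)) {a..b}"
    by (rule FTC_deriv_off_origin)
      (use p DERIV_abs_powr(1) continuous_on_abs_powr in \<open>auto simp: real_differentiable_def\<close>)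
qed

lemma power_admissible:
  assumes q: "q < m"
  shows "H m (\<lambda>x. x ^ q) < \<infinity>"
    and "a \<le> b \<Longrightarrow> (deriv (\<lambda>x::real. x ^ q) has_integral (b ^ q - a ^ q)) {a..b}"
proof -
  have d: "((\<lambda>x::real. x ^ q) has_real_derivative real q * x ^ (q - 1)) (at x)" for x
    by (auto intro!: derivative_eq_intros)
  show "H m (\<lambda>x. x ^ q) < \<infinity>"
  proof (cases "q = 0")
    case True
    then show ?thesis by (simp add: H_def)
  next
    case False
    show ?thesis
    proof (rule H_finite_powr)
      show "0 < real q" "real q < real m" using False q by auto
      fix x :: real assume "x \<noteq> 0"
      then have "\<bar>x\<bar> powr (real q - 1) = \<bar>x\<bar> ^ (q - 1)"
        using False powr_realpow[of "\<bar>x\<bar>" "q - 1"] by (simp add: of_nat_diff)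
      then show "\<bar>deriv (\<lambda>x. x ^ q) x\<bar> = real q * \<bar>x\<bar> powr (real q - 1)"
        by (simp add: DERIV_imp_deriv[OF d] abs_mult power_abs)
    qed
  qed
  show "a \<le> b \<Longrightarrow> (deriv (\<lambda>x::real. x ^ q) has_integral (b ^ q - a ^ q)) {a..b}"
    by (rule FTC_deriv_off_origin) (metis d real_differentiable_def, auto intro!: continuous_intros)
qed

lemma abs_power_admissible:
  assumes q: "q < m"
  shows "H m (\<lambda>x. \<bar>x\<bar> ^ q) < \<infinity>"
    and "a \<le> b \<Longrightarrow> (deriv (\<lambda>x::real. \<bar>x\<bar> ^ q) has_integral (\<bar>b\<bar> ^ q - \<bar>a\<bar> ^ q)) {a..b}"
proof -
  \<comment> \<open>\<open>0 powr 0\<close> is 0 while \<open>0 ^ 0\<close> is 1, so the exponent 0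
    is treated as an ordinary power.\<close>
  have eq: "(\<lambda>x::real. \<bar>x\<bar> ^ q) = (if q = 0 then (\<lambda>x. x ^ q) else (\<lambda>x. \<bar>x\<bar> powr real q))"
    by (auto simp: fun_eq_iff powr_realpow')
  have eq': "\<bar>x\<bar> ^ q = \<bar>x\<bar> powr real q" if "q \<noteq> 0" for x :: real
    using fun_cong[OF eq, of x] that by simp
  show "H m (\<lambda>x. \<bar>x\<bar> ^ q) < \<infinity>"
    unfolding eq using power_admissible(1)[OF q] abs_powr_admissible(1)[of "real q" m] q by auto
  show "a \<le> b \<Longrightarrow> (deriv (\<lambda>x::real. \<bar>x\<bar> ^ q) has_integral (\<bar>b\<bar> ^ q - \<bar>a\<bar> ^ q)) {a..b}"
    unfolding eq using power_admissible(2)[OF q, of a b] abs_powr_admissible(2)[of "real q" m a b] q eq'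
    by (cases "q = 0") auto
qed

section \<open>The nonuniform Berry--Esseen bound\<close>

text \<open>From some index on \<open>\<sigma>\<close> is at least 1, and the earlier positive
  values are finitely many. This bound is what makes \<open>\<tau>\<close>, the bound on the scales
  \<open>1 / T\<close>, uniform in \<open>n\<close>.\<close>

lemma positive_values_bounded_below:
  fixes \<sigma> :: "nat \<Rightarrow> real"
  assumes "filterlim \<sigma> at_top sequentially"
  shows "\<exists>s>0. \<forall>n. \<sigma> n > 0 \<longrightarrow> s \<le> \<sigma> n"
proof -
  have "eventually (\<lambda>n. 1 \<le> \<sigma> n) sequentially"
    using assms unfolding filterlim_at_top by blast
  then obtain n0 where n0: "\<And>n. n \<ge> n0 \<Longrightarrow> 1 \<le> \<sigma> n" unfolding eventually_sequentially by blast
  let ?V = "insert 1 (\<sigma> ` {n. n < n0 \<and> \<sigma> n > 0})"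
  have "Min ?V > 0" by (subst Min_gr_iff) auto
  moreover have "Min ?V \<le> \<sigma> n" if "\<sigma> n > 0" for n
  proof (cases "n < n0")
    case True
    then show ?thesis using that by (intro Min_le) auto
  next
    case False
    have "Min ?V \<le> 1" by (rule Min_le) auto
    also have "1 \<le> \<sigma> n" using False n0 by simp
    finally show ?thesis .
  qed
  ultimately show ?thesis by blast
qed

theorem nonuniform_Berry_Esseen:
  fixes M :: "'a measure" and S :: "nat \<Rightarrow> 'a \<Rightarrow> real"
  assumes M: "prob_space M"
    and S: "\<And>n. S n \<in> borel_measurable M" "\<And>n. integrable M (\<lambda>\<omega>. (S n \<omega>)\<^sup>2)" "\<And>n. (\<integral>\<omega>. S n \<omega> \<partial>M) = 0"
    and \<sigma>: "\<And>n. \<sigma> n = sqrt (\<integral>\<omega>. (S n \<omega>)\<^sup>2 \<partial>M)"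
    and m: "m \<ge> 2" and g: "growth_condition M S \<sigma> m"
    and s0: "s0 > 0" "\<And>n. \<sigma> n > 0 \<Longrightarrow> s0 \<le> \<sigma> n"
  shows "\<exists>R\<ge>0. \<forall>n. \<sigma> n > 0 \<longrightarrow> (\<forall>x. \<bar>cdf (distr M borel (\<lambda>\<omega>. S n \<omega> / \<sigma> n)) x - std_normal_cdf x\<bar>
    \<le> R / \<sigma> n / (1 + \<bar>x\<bar>) ^ m)"
proof -
  interpret prob_space M by fact
  let ?\<mu> = "\<lambda>n. distr M borel (\<lambda>\<omega>. S n \<omega> / \<sigma> n)"
  obtain \<epsilon> B where \<epsilon>: "\<epsilon> > 0" and B: "B \<ge> 0" and smooth: "\<And>n. \<sigma> n > 0 \<Longrightarrow>
    smooth_bound {- (\<epsilon> * \<sigma> n)..\<epsilon> * \<sigma> n} {} (m + 1) (\<lambda>t. B / \<sigma> n / (1 + \<bar>t\<bar>) ^ 2)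
      (\<lambda>t. char (?\<mu> n) t - char std_normal_distribution t)"
    using growth_condition_char_smooth[OF M S \<sigma> m g s0] by blast
  \<comment> \<open>The kernel decays with exponent \<open>2 N = (2 m + 4) + 2\<close>, and
    \<open>2 m + 4\<close> is at least the \<open>m + 3\<close> asked for by
    \<open>nonuniform_smoothing\<close>. Also \<open>N \<ge> m + 1\<close>, as needed for
    \<open>m + 1\<close> integrations by parts.\<close>
  define N where "N = m + 3"
  define \<tau> where "\<tau> = 1 / (\<epsilon> * s0)"
  have \<tau>: "\<tau> \<ge> 0" using \<epsilon> s0 by (simp add: \<tau>_def)
  obtain C where C: "\<And>v. bump_kernel N v \<le> C / (1 + \<bar>v\<bar>) ^ (2 * N)"
    using bump_kernel_decay[of N] by blast
  have "2 * N = (2 * m + 4) + 2" by (simp add: N_def)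
  with C interpret smoothing_kernel "bump_kernel N" "2 * m + 4" C "(cos 1)\<^sup>2"
    by unfold_locales (use cos_one_pos in \<open>auto simp: bump_kernel_nonneg bump_kernel_lower\<close>)
  obtain R0 where R0: "R0 \<ge> 0" and smoothing: "\<And>T \<eta> \<mu> x. T > 0 \<Longrightarrow> 1 / T \<le> \<tau> \<Longrightarrow> real_distribution \<mu> \<Longrightarrow>
    (\<forall>y. \<bar>smoothed (bump_kernel N) T \<mu> y - smoothed (bump_kernel N) T std_normal_distribution y\<bar> \<le> \<eta> / (1 + \<bar>y\<bar>) ^ (m + 1)) \<Longrightarrow>
    \<bar>cdf \<mu> x - std_normal_cdf x\<bar> \<le> R0 * ((1 + \<eta>) / T + \<eta>) / (1 + \<bar>x\<bar>) ^ m"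
    using nonuniform_smoothing[of m \<tau>] m \<tau> by auto
  define G where "G = 2 ^ (m + 1) * (1 + (2 * (2 * real N * \<tau> + 1)) ^ (m + 1)) * envelope_mass / bump_mass N * B"
  have G: "G \<ge> 0"
    using \<tau> B envelope_mass_nonneg bump_mass_pos[of N] by (simp add: G_def)
  \<comment> \<open>\<open>1 / T\<close> is \<open>1 / (\<epsilon> \<sigma>)\<close> and
    \<open>G / \<sigma>\<close> is at most \<open>G / s0\<close>, so both terms of the smoothing
    inequality become multiples of \<open>1 / \<sigma>\<close>.\<close>
  define R where "R = R0 * ((1 + G / s0) / \<epsilon> + G)"
  have R: "R \<ge> 0" using R0 G s0 \<epsilon> by (simp add: R_def)
  have "\<bar>cdf (?\<mu> n) x - std_normal_cdf x\<bar> \<le> R / \<sigma> n / (1 + \<bar>x\<bar>) ^ m" if pos: "\<sigma> n > 0" for n x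
  proof -
    have [measurable]: "S n \<in> borel_measurable M" by (rule S)
    have rd: "real_distribution (?\<mu> n)" by (rule real_distribution_distr) measurable
    define T where "T = \<epsilon> * \<sigma> n"
    have T: "T > 0" "1 / T \<le> \<tau>"
    proof -
      show "T > 0" using \<epsilon> pos by (simp add: T_def)
      have "\<epsilon> * s0 \<le> \<epsilon> * \<sigma> n" using \<epsilon> s0(2)[OF pos] by simp
      then show "1 / T \<le> \<tau>" unfolding T_def \<tau>_def using \<epsilon> s0(1) pos by (intro divide_left_mono) auto
    qed
    have "\<forall>y. \<bar>smoothed (bump_kernel N) T (?\<mu> n) y - smoothed (bump_kernel N) T std_normal_distribution y\<bar> \<le> G / \<sigma> n / (1 + \<bar>y\<bar>) ^ (m + 1)"
    proof
      fix y
      have "\<bar>smoothed (bump_kernel N) T (?\<mu> n) y - smoothed (bump_kernel N) T std_normal_distribution y\<bar>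
        \<le> 2 ^ (m + 1) * (1 + (2 * (2 * real N * \<tau> + 1)) ^ (m + 1)) * envelope_mass / bump_mass N * (B / \<sigma> n) / (1 + \<bar>y\<bar>) ^ (m + 1)"
        by (rule smoothed_diff_le[OF T rd real_dist_normal_dist])
          (use B pos smooth[OF pos] in \<open>auto simp: N_def T_def\<close>)
      then show "\<bar>smoothed (bump_kernel N) T (?\<mu> n) y - smoothed (bump_kernel N) T std_normal_distribution y\<bar> \<le> G / \<sigma> n / (1 + \<bar>y\<bar>) ^ (m + 1)"
        by (simp add: G_def)
    qed
    from smoothing[OF T rd this, of x]
    have "\<bar>cdf (?\<mu> n) x - std_normal_cdf x\<bar> \<le> R0 * ((1 + G / \<sigma> n) / T + G / \<sigma> n) / (1 + \<bar>x\<bar>) ^ m" .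
    also have "\<dots> \<le> R / \<sigma> n / (1 + \<bar>x\<bar>) ^ m"
    proof (rule divide_right_mono)
      have "G / \<sigma> n \<le> G / s0" using G s0 pos by (intro divide_left_mono) auto
      then have "(1 + G / \<sigma> n) / T \<le> (1 + G / s0) / T" using T by (intro divide_right_mono) auto
      also have "\<dots> = (1 + G / s0) / \<epsilon> / \<sigma> n" by (simp add: T_def)
      finally have "(1 + G / \<sigma> n) / T + G / \<sigma> n \<le> ((1 + G / s0) / \<epsilon> + G) / \<sigma> n" by (simp add: add_divide_distrib)
      then have "R0 * ((1 + G / \<sigma> n) / T + G / \<sigma> n) \<le> R0 * (((1 + G / s0) / \<epsilon> + G) / \<sigma> n)" by (rule mult_left_mono[OF _ R0])
      then show "R0 * ((1 + G / \<sigma> n) / T + G / \<sigma> n) \<le> R / \<sigma> n" by (simp add: R_def)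
    qed simp
    finally show ?thesis .
  qed
  with R show ?thesis by blast
qed

section \<open>Affine change of the random variable\<close>

lemma std_normal_cdf_diff_le:
  assumes "\<And>\<xi>. min x y \<le> \<xi> \<Longrightarrow> \<xi> \<le> max x y \<Longrightarrow> std_normal_density \<xi> \<le> G"
  shows "\<bar>std_normal_cdf y - std_normal_cdf x\<bar> \<le> G * \<bar>y - x\<bar>"
proof -
  interpret real_distribution std_normal_distribution by (rule real_dist_normal_dist)
  have *: "\<bar>std_normal_cdf y - std_normal_cdf x\<bar> \<le> G * \<bar>y - x\<bar>"
    if xy: "x < y" and G: "\<And>\<xi>. x \<le> \<xi> \<Longrightarrow> \<xi> \<le> y \<Longrightarrow> std_normal_density \<xi> \<le> G" for x y
  proof -
    have "std_normal_cdf y - std_normal_cdf x = measure std_normal_distribution {x<..y}"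
      using cdf_diff_eq[OF xy] .
    also have "\<dots> = (\<integral>\<xi>. indicator {x<..y} \<xi> \<partial>std_normal_distribution)" by simp
    also have "\<dots> = (\<integral>\<xi>. indicator {x<..y} \<xi> * std_normal_density \<xi> \<partial>lborel)"
      by (subst integral_density) (auto simp: mult.commute)
    also have "\<dots> \<le> (\<integral>\<xi>. indicator {x..y} \<xi> * G \<partial>lborel)"
    proof (rule integral_mono)
      show "integrable lborel (\<lambda>\<xi>. indicator {x<..y} \<xi> * std_normal_density \<xi>)"
        using integrable_mult_indicator[of "{x<..y}" lborel std_normal_density] integrable_normal_density[of 1 0] by simp
      show "integrable lborel (\<lambda>\<xi>. indicator {x..y} \<xi> * G)"
        using borel_integrable_atLeastAtMost'[of x y "\<lambda>_. G"] by (simp add: set_integrable_def)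
      show "indicator {x<..y} \<xi> * std_normal_density \<xi> \<le> indicator {x..y} \<xi> * G" for \<xi>
        using G[of \<xi>] order_trans[OF _ G[of x], of 0] xy by (auto simp: indicator_def)
    qed
    also have "\<dots> = G * \<bar>y - x\<bar>" using xy by simp
    finally show ?thesis using cdf_nondecreasing[of x y] xy by simp
  qed
  consider "x < y" | "x = y" | "y < x" by linarith
  then show ?thesis
  proof cases
    case 1 then show ?thesis using *[of x y] assms by simp
  next
    case 2 then show ?thesis by simp
  next
    case 3
    then have "\<bar>std_normal_cdf x - std_normal_cdf y\<bar> \<le> G * \<bar>x - y\<bar>"
      using *[of y x] assms by simp
    then show ?thesis by (simp add: abs_minus_commute)
  qed
qed

text \<open>The distribution function of \<open>W\<close> at \<open>x\<close> is that of
  \<open>X\<close> at \<open>y = (b x + a) / \<sigma>\<close>. There are two errors: that of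
  \<open>X\<close> at \<open>y\<close>, and the change of the normal distribution function from
  \<open>y\<close> to \<open>x\<close>. Since \<open>|y - x|\<close> is at most
  \<open>c (1 + |x|) / \<sigma>\<close>, the normal density is bounded with exponent
  \<open>m + 1\<close> to pay for the factor \<open>1 + |x|\<close>.\<close>

lemma cdf_bound_affine:
  fixes X W :: "'a \<Rightarrow> real" and R c \<sigma> a b :: real
  assumes [measurable]: "X \<in> borel_measurable M"
    and W: "\<And>\<omega>. W \<omega> = (\<sigma> * X \<omega> - a) / b"
    and s: "0 < s0" "s0 \<le> \<sigma>" and c: "\<bar>a\<bar> \<le> c" "\<bar>b - \<sigma>\<bar> \<le> c" "\<sigma> / 2 \<le> b" and R: "0 \<le> R"
    and F: "\<And>x. \<bar>cdf (distr M borel X) x - std_normal_cdf x\<bar> \<le> R / \<sigma> / (1 + \<bar>x\<bar>) ^ m"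
  shows "\<bar>cdf (distr M borel W) x - std_normal_cdf x\<bar>
    \<le> (R * (2 + 2 * c / s0) ^ m + c * (fact (m + 1) * exp 2) * (2 + 2 * c / s0) ^ (m + 1)) / \<sigma> / (1 + \<bar>x\<bar>) ^ m"
proof -
  have \<sigma>: "0 < \<sigma>" and b: "0 < b" using s c(3) by auto
  have c0: "0 \<le> c" using c(1) by simp
  \<comment> \<open>As \<open>b \<ge> \<sigma> / 2\<close>, a point between \<open>x\<close> and
    \<open>y\<close> has modulus at least \<open>|x| / 2 - c / s0\<close>; \<open>q\<close> is the
    resulting ratio of the weights.\<close>
  define q where "q = 2 + 2 * c / s0"
  have q: "q \<ge> 2" using c0 s by (simp add: q_def)
  define y where "y = (b * x + a) / \<sigma>"
  have "W \<in> borel_measurable M" unfolding W by measurable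
  then have "cdf (distr M borel W) x = measure M {\<omega> \<in> space M. W \<omega> \<le> x}"
    by (simp add: cdf_def2 measure_distr vimage_def Int_def conj_commute)
  also have "{\<omega> \<in> space M. W \<omega> \<le> x} = {\<omega> \<in> space M. X \<omega> \<le> y}"
    using \<sigma> b by (auto simp: W y_def field_simps)
  also have "measure M \<dots> = cdf (distr M borel X) y"
    by (simp add: cdf_def2 measure_distr vimage_def Int_def conj_commute)
  finally have FW: "cdf (distr M borel W) x = cdf (distr M borel X) y" .
  have ac: "\<bar>a\<bar> / \<sigma> \<le> c / s0" using c c0 s \<sigma> by (intro frac_le) auto
  have yx: "y = (b / \<sigma>) * x + a / \<sigma>" by (simp add: y_def add_divide_distrib)
  have b2: "1 / 2 \<le> b / \<sigma>" using c(3) \<sigma> by (simp add: field_simps)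
  have seg: "1 + \<bar>x\<bar> \<le> q * (1 + \<bar>\<xi>\<bar>)" if \<xi>: "min x y \<le> \<xi>" "\<xi> \<le> max x y" for \<xi>
  proof -
    have a': "\<bar>a / \<sigma>\<bar> \<le> c / s0" using ac \<sigma> by (simp add: abs_divide)
    have "\<bar>x\<bar> \<le> 2 * \<bar>\<xi>\<bar> + 2 * (c / s0)"
    proof (cases "0 \<le> x")
      case True
      have "1 / 2 * x \<le> b / \<sigma> * x" using b2 True by (rule mult_right_mono)
      then have "x / 2 - c / s0 \<le> y" unfolding yx using a' by linarith
      moreover have "0 \<le> c / s0" using c0 s by simp
      then have "x / 2 - c / s0 \<le> x" using True by linarith
      ultimately have "x / 2 - c / s0 \<le> \<xi>" using \<xi>(1) by linarith
      then show ?thesis using True by linarith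
    next
      case False
      have "b / \<sigma> * x \<le> 1 / 2 * x" using b2 False by (intro mult_right_mono_neg) auto
      then have "y \<le> x / 2 + c / s0" unfolding yx using a' by linarith
      moreover have "0 \<le> c / s0" using c0 s by simp
      then have "x \<le> x / 2 + c / s0" using False by linarith
      ultimately have "\<xi> \<le> x / 2 + c / s0" using \<xi>(2) by linarith
      then show ?thesis using False by linarith
    qed
    moreover have "q * (1 + \<bar>\<xi>\<bar>) = 2 + 2 * (c / s0) + 2 * \<bar>\<xi>\<bar> + 2 * (c / s0) * \<bar>\<xi>\<bar>"
      by (simp add: q_def algebra_simps add_divide_distrib)
    moreover have "0 \<le> 2 * (c / s0) * \<bar>\<xi>\<bar>" using c0 s by simp
    ultimately show ?thesis by linarith
  qed
  have seg': "1 / (1 + \<bar>\<xi>\<bar>) ^ k \<le> q ^ k / (1 + \<bar>x\<bar>) ^ k" if "min x y \<le> \<xi>" "\<xi> \<le> max x y" for \<xi> k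
  proof -
    have "(1 + \<bar>x\<bar>) ^ k \<le> (q * (1 + \<bar>\<xi>\<bar>)) ^ k" using seg[OF that] by (intro power_mono) auto
    then have "(1 + \<bar>x\<bar>) ^ k \<le> q ^ k * (1 + \<bar>\<xi>\<bar>) ^ k" by (simp add: power_mult_distrib)
    then show ?thesis by (simp add: divide_simps)
  qed
  have 1: "\<bar>cdf (distr M borel X) y - std_normal_cdf y\<bar> \<le> R * q ^ m / \<sigma> / (1 + \<bar>x\<bar>) ^ m"
  proof -
    have "\<bar>cdf (distr M borel X) y - std_normal_cdf y\<bar> \<le> R / \<sigma> * (1 / (1 + \<bar>y\<bar>) ^ m)"
      using F[of y] by simp
    also have "\<dots> \<le> R / \<sigma> * (q ^ m / (1 + \<bar>x\<bar>) ^ m)"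
      using R \<sigma> by (intro mult_left_mono seg') auto
    finally show ?thesis by (simp add: mult_ac)
  qed
  let ?A = "fact (m + 1) * exp 2 :: real"
  have 2: "\<bar>std_normal_cdf y - std_normal_cdf x\<bar> \<le> ?A * q ^ (m + 1) / (1 + \<bar>x\<bar>) ^ (m + 1) * \<bar>y - x\<bar>"
  proof (rule std_normal_cdf_diff_le)
    fix \<xi> assume "min x y \<le> \<xi>" "\<xi> \<le> max x y"
    note seg'[OF this, of "m + 1"]
    then have "?A * (1 / (1 + \<bar>\<xi>\<bar>) ^ (m + 1)) \<le> ?A * (q ^ (m + 1) / (1 + \<bar>x\<bar>) ^ (m + 1))"
      by (intro mult_left_mono) auto
    with std_normal_density_le[of \<xi> "m + 1"]
    show "std_normal_density \<xi> \<le> ?A * q ^ (m + 1) / (1 + \<bar>x\<bar>) ^ (m + 1)" by simp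
  qed
  have "y - x = ((b - \<sigma>) * x + a) / \<sigma>" using \<sigma> by (simp add: y_def field_simps)
  moreover have "\<bar>(b - \<sigma>) * x + a\<bar> \<le> c * (1 + \<bar>x\<bar>)"
  proof -
    have "\<bar>(b - \<sigma>) * x + a\<bar> \<le> \<bar>b - \<sigma>\<bar> * \<bar>x\<bar> + \<bar>a\<bar>" by (metis abs_mult abs_triangle_ineq)
    also have "\<dots> \<le> c * \<bar>x\<bar> + c" using c by (intro add_mono mult_right_mono) auto
    finally show ?thesis by (simp add: algebra_simps)
  qed
  ultimately have 3: "\<bar>y - x\<bar> \<le> c * (1 + \<bar>x\<bar>) / \<sigma>"
    using \<sigma> by (simp add: divide_right_mono)
  have "?A * q ^ (m + 1) / (1 + \<bar>x\<bar>) ^ (m + 1) * \<bar>y - x\<bar> \<le> ?A * q ^ (m + 1) / (1 + \<bar>x\<bar>) ^ (m + 1) * (c * (1 + \<bar>x\<bar>) / \<sigma>)"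
    using q by (intro mult_left_mono 3) auto
  also have "\<dots> = c * ?A * q ^ (m + 1) / \<sigma> / (1 + \<bar>x\<bar>) ^ m"
  proof -
    have "(1 + \<bar>x\<bar>) / (1 + \<bar>x\<bar>) ^ (m + 1) = 1 / (1 + \<bar>x\<bar>) ^ m" by simp
    then have "?A * q ^ (m + 1) * c / \<sigma> * ((1 + \<bar>x\<bar>) / (1 + \<bar>x\<bar>) ^ (m + 1)) = ?A * q ^ (m + 1) * c / \<sigma> * (1 / (1 + \<bar>x\<bar>) ^ m)"
      by (rule arg_cong)
    then show ?thesis by (simp add: mult_ac)
  qed
  finally have "\<bar>std_normal_cdf y - std_normal_cdf x\<bar> \<le> c * ?A * q ^ (m + 1) / \<sigma> / (1 + \<bar>x\<bar>) ^ m"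
    using 2 by linarith
  with 1 have "\<bar>cdf (distr M borel W) x - std_normal_cdf x\<bar> \<le> R * q ^ m / \<sigma> / (1 + \<bar>x\<bar>) ^ m + c * ?A * q ^ (m + 1) / \<sigma> / (1 + \<bar>x\<bar>) ^ m"
    unfolding FW by linarith
  then show ?thesis by (simp add: q_def add_divide_distrib)
qed

text \<open>A bound with an uncontrolled constant, for the finitely many indices at which \<open>b\<close> is not yet
  comparable with \<open>\<sigma>\<close> (and may even be negative).\<close>

lemma cdf_bound_affine_crude:
  fixes X W :: "'a \<Rightarrow> real" and R \<sigma> a b :: real
  assumes M: "prob_space M" and [measurable]: "X \<in> borel_measurable M"
    and W: "\<And>\<omega>. W \<omega> = (\<sigma> * X \<omega> - a) / b"
    and \<sigma>: "0 < \<sigma>" and b: "b \<noteq> 0" and m: "m \<ge> 1" and R: "0 \<le> R"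
    and F: "\<And>x. \<bar>cdf (distr M borel X) x - std_normal_cdf x\<bar> \<le> R / (1 + \<bar>x\<bar>) ^ m"
  shows "\<exists>C\<ge>0. \<forall>x. \<bar>cdf (distr M borel W) x - std_normal_cdf x\<bar> \<le> C / (1 + \<bar>x\<bar>) ^ m"
proof -
  interpret M: prob_space M by fact
  let ?\<gamma> = std_normal_distribution
  have [measurable]: "W \<in> borel_measurable M" unfolding W by measurable
  have cX: "cdf (distr M borel X) x = M.prob {\<omega> \<in> space M. X \<omega> \<le> x}" for x
    by (simp add: cdf_def2 measure_distr vimage_def Int_def conj_commute)
  have cW: "cdf (distr M borel W) x = M.prob {\<omega> \<in> space M. W \<omega> \<le> x}" for x
    by (simp add: cdf_def2 measure_distr vimage_def Int_def conj_commute)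
  obtain A where A: "0 \<le> A" "\<And>x. (if 0 < x then 1 - cdf ?\<gamma> x else cdf ?\<gamma> x) \<le> A / (1 + \<bar>x\<bar>) ^ m"
    using cdf_std_normal_tail[OF m] by blast
  have X_tail: "M.prob {\<omega> \<in> space M. \<bar>X \<omega>\<bar> > r} \<le> 2 * (A + R) / (1 + r) ^ m" if r: "0 < r" for r
  proof -
    have "M.prob {\<omega> \<in> space M. \<bar>X \<omega>\<bar> > r} \<le> M.prob (space M - {\<omega> \<in> space M. X \<omega> \<le> r}) + M.prob {\<omega> \<in> space M. X \<omega> \<le> - r}"
      by (rule order_trans[OF M.finite_measure_mono measure_Un_le]) auto
    also have "\<dots> = (1 - cdf (distr M borel X) r) + cdf (distr M borel X) (- r)"
      by (subst M.prob_compl) (auto simp: cX)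
    also have "\<dots> \<le> (A / (1 + r) ^ m + R / (1 + r) ^ m) + (A / (1 + r) ^ m + R / (1 + r) ^ m)"
      using A(2)[of r] A(2)[of "- r"] F[of r] F[of "- r"] r by (simp split: if_splits)
    also have "\<dots> = 2 * (A + R) / (1 + r) ^ m" by (simp add: add_divide_distrib)
    finally show ?thesis .
  qed
  define q where "q = 1 + (\<sigma> + \<bar>a\<bar>) / \<bar>b\<bar>"
  have q: "q \<ge> 1" using \<sigma> b by (simp add: q_def)
  \<comment> \<open>The summand 1 serves the \<open>x\<close> with \<open>r \<le> 0\<close>, where
    the probability is bounded by 1 and \<open>1 + |x|\<close> by \<open>q\<close>.\<close>
  define D where "D = (2 * (A + R) + 1) * q ^ m"
  have D: "D \<ge> 0" using A R q by (simp add: D_def)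
  \<comment> \<open>Two-sided tails are estimated, because a negative \<open>b\<close> exchanges
    left and right.\<close>
  have W_tail: "M.prob {\<omega> \<in> space M. \<bar>W \<omega>\<bar> \<ge> \<bar>x\<bar>} \<le> D / (1 + \<bar>x\<bar>) ^ m" for x
  proof -
    \<comment> \<open>\<open>|W| \<ge> |x|\<close> forces \<open>|X| \<ge> r + 1\<close>.
      Subtracting 1 yields the strict inequality of \<open>X_tail\<close>, whose weight
      \<open>1 + r\<close> is then comparable with \<open>1 + |x|\<close>.\<close>
    define r where "r = (\<bar>b\<bar> * \<bar>x\<bar> - \<bar>a\<bar>) / \<sigma> - 1"
    have x: "\<bar>x\<bar> = (\<sigma> * (1 + r) + \<bar>a\<bar>) / \<bar>b\<bar>" using \<sigma> b by (simp add: r_def)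
    show ?thesis
    proof (cases "0 < r")
      case True
      have "{\<omega> \<in> space M. \<bar>W \<omega>\<bar> \<ge> \<bar>x\<bar>} \<subseteq> {\<omega> \<in> space M. \<bar>X \<omega>\<bar> > r}"
      proof safe
        fix \<omega> assume "\<bar>x\<bar> \<le> \<bar>W \<omega>\<bar>"
        then have "\<bar>b\<bar> * \<bar>x\<bar> \<le> \<bar>b\<bar> * \<bar>W \<omega>\<bar>" by (intro mult_left_mono) auto
        also have "\<dots> = \<bar>\<sigma> * X \<omega> - a\<bar>" using b by (simp add: W abs_divide)
        also have "\<dots> \<le> \<sigma> * \<bar>X \<omega>\<bar> + \<bar>a\<bar>" using abs_triangle_ineq4[of "\<sigma> * X \<omega>" a] \<sigma> by (simp add: abs_mult)
        finally have "(\<bar>b\<bar> * \<bar>x\<bar> - \<bar>a\<bar>) / \<sigma> \<le> \<bar>X \<omega>\<bar>" using \<sigma> by (simp add: pos_divide_le_eq mult.commute)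
        then show "r < \<bar>X \<omega>\<bar>" by (simp add: r_def)
      qed
      then have "M.prob {\<omega> \<in> space M. \<bar>W \<omega>\<bar> \<ge> \<bar>x\<bar>} \<le> M.prob {\<omega> \<in> space M. \<bar>X \<omega>\<bar> > r}"
        by (rule M.finite_measure_mono) measurable
      also have "\<dots> \<le> 2 * (A + R) / (1 + r) ^ m" by (rule X_tail[OF True])
      also have "\<dots> \<le> D / (1 + \<bar>x\<bar>) ^ m"
      proof -
        have "\<sigma> * (1 + r) + \<bar>a\<bar> \<le> (\<sigma> + \<bar>a\<bar>) * (1 + r)" using True by (simp add: algebra_simps)
        then have "\<bar>x\<bar> \<le> (\<sigma> + \<bar>a\<bar>) * (1 + r) / \<bar>b\<bar>" unfolding x by (rule divide_right_mono) simp
        then have "1 + \<bar>x\<bar> \<le> q * (1 + r)" using True by (simp add: q_def distrib_right)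
        then have "(1 + \<bar>x\<bar>) ^ m \<le> q ^ m * (1 + r) ^ m"
          unfolding power_mult_distrib[symmetric] by (intro power_mono) auto
        then have "2 * (A + R) * (1 + \<bar>x\<bar>) ^ m \<le> 2 * (A + R) * (q ^ m * (1 + r) ^ m)"
          using A R by (intro mult_left_mono) auto
        also have "\<dots> \<le> D * (1 + r) ^ m" using q True by (simp add: D_def distrib_right mult_ac)
        finally show ?thesis using True by (simp add: divide_simps)
      qed
      finally show ?thesis .
    next
      case False
      have "\<sigma> * (1 + r) \<le> \<sigma> * 1" using False \<sigma> by (intro mult_left_mono) auto
      then have "\<bar>x\<bar> \<le> (\<sigma> + \<bar>a\<bar>) / \<bar>b\<bar>" unfolding x by (intro divide_right_mono) auto
      then have "(1 + \<bar>x\<bar>) ^ m \<le> q ^ m" by (intro power_mono) (auto simp: q_def)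
      also have "\<dots> \<le> D" using A R q by (simp add: D_def mult_le_cancel_right1)
      finally have "1 \<le> D / (1 + \<bar>x\<bar>) ^ m" by (simp add: pos_le_divide_eq)
      then show ?thesis using M.prob_le_1 order_trans by blast
    qed
  qed
  have "\<bar>cdf (distr M borel W) x - cdf ?\<gamma> x\<bar> \<le> (D + A) / (1 + \<bar>x\<bar>) ^ m" for x
  proof -
    interpret G: real_distribution ?\<gamma> by (rule real_dist_normal_dist)
    have pos: "0 \<le> cdf ?\<gamma> x" "cdf ?\<gamma> x \<le> 1" using G.cdf_nonneg G.cdf_bounded_prob by auto
    show ?thesis
    proof (cases "0 < x")
      case True
      have "1 - cdf (distr M borel W) x = M.prob (space M - {\<omega> \<in> space M. W \<omega> \<le> x})"
        by (subst M.prob_compl) (auto simp: cW)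
      also have "\<dots> \<le> M.prob {\<omega> \<in> space M. \<bar>W \<omega>\<bar> \<ge> \<bar>x\<bar>}"
        using True by (intro M.finite_measure_mono) auto
      also note W_tail
      finally have "1 - cdf (distr M borel W) x \<le> D / (1 + \<bar>x\<bar>) ^ m" .
      moreover have "cdf (distr M borel W) x \<le> 1" by (simp add: cW)
      moreover have "1 - cdf ?\<gamma> x \<le> A / (1 + \<bar>x\<bar>) ^ m" using A(2)[of x] True by simp
      ultimately show ?thesis using pos unfolding add_divide_distrib by linarith
    next
      case False
      have "cdf (distr M borel W) x \<le> M.prob {\<omega> \<in> space M. \<bar>W \<omega>\<bar> \<ge> \<bar>x\<bar>}"
        unfolding cW using False by (intro M.finite_measure_mono) auto
      also note W_tail
      finally have "cdf (distr M borel W) x \<le> D / (1 + \<bar>x\<bar>) ^ m" .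
      moreover have "0 \<le> cdf (distr M borel W) x" by (simp add: cW)
      moreover have "cdf ?\<gamma> x \<le> A / (1 + \<bar>x\<bar>) ^ m" using A(2)[of x] False by simp
      ultimately show ?thesis using pos unfolding add_divide_distrib by linarith
    qed
  qed
  moreover have "0 \<le> D + A" using D A by simp
  ultimately show ?thesis by blast
qed

lemma uniform_cdf_bound:
  fixes M :: "'a measure" and S :: "nat \<Rightarrow> 'a \<Rightarrow> real"
    and \<sigma> A B :: "nat \<Rightarrow> real" and W :: "nat \<Rightarrow> 'a \<Rightarrow> real" and m :: nat
  assumes M: "prob_space M"
    and S: "\<And>n. S n \<in> borel_measurable M" "\<And>n. integrable M (\<lambda>\<omega>. (S n \<omega>)\<^sup>2)" "\<And>n. (\<integral>\<omega>. S n \<omega> \<partial>M) = 0"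
    and \<sigma>: "\<And>n. \<sigma> n = sqrt (\<integral>\<omega>. (S n \<omega>)\<^sup>2 \<partial>M)" "filterlim \<sigma> at_top sequentially"
    and A: "bounded (range A)" and B: "(\<lambda>n. B n - \<sigma> n) \<in> O(\<lambda>_. 1)"
    and W: "\<And>n \<omega>. W n \<omega> = (S n \<omega> - A n) / B n"
    and m: "m \<ge> 2" and g: "growth_condition M S \<sigma> m"
  shows "\<exists>R>0. \<forall>n. \<sigma> n > 0 \<and> B n \<noteq> 0 \<longrightarrow>
    (\<forall>x. \<bar>cdf (distr M borel (W n)) x - std_normal_cdf x\<bar> \<le> R / \<sigma> n / (1 + \<bar>x\<bar>) ^ m)"
proof -
  have [measurable]: "S n \<in> borel_measurable M" for n by (rule S)
  obtain s0 where s0: "s0 > 0" "\<And>n. \<sigma> n > 0 \<Longrightarrow> s0 \<le> \<sigma> n"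
    using positive_values_bounded_below[OF \<sigma>(2)] by blast
  let ?X = "\<lambda>n \<omega>. S n \<omega> / \<sigma> n"
  obtain R0 where R0: "R0 \<ge> 0" "\<And>n x. \<sigma> n > 0 \<Longrightarrow>
      \<bar>cdf (distr M borel (?X n)) x - std_normal_cdf x\<bar> \<le> R0 / \<sigma> n / (1 + \<bar>x\<bar>) ^ m"
    using nonuniform_Berry_Esseen[OF M S \<sigma>(1) m g s0] by blast
  have W': "W n \<omega> = (\<sigma> n * ?X n \<omega> - A n) / B n" if "\<sigma> n > 0" for n \<omega>
    using that by (simp add: W)
  obtain cA where cA: "\<And>n. \<bar>A n\<bar> \<le> cA"
    using A unfolding bounded_iff by auto
  obtain cB where cB: "eventually (\<lambda>n. \<bar>B n - \<sigma> n\<bar> \<le> cB) sequentially"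
    using B by (elim landau_o.bigE) auto
  define c where "c = max cA cB"
  define good where "good n \<longleftrightarrow> \<bar>B n - \<sigma> n\<bar> \<le> c \<and> \<sigma> n / 2 \<le> B n" for n
  have "eventually good sequentially"
  proof -
    \<comment> \<open>Once \<open>\<sigma> n\<close> is at least \<open>2 * cB\<close>, the bound
      \<open>cB\<close> on \<open>|B n - \<sigma> n|\<close> entails
      \<open>\<sigma> n / 2 \<le> B n\<close>.\<close>
    have "eventually (\<lambda>n. 2 * cB \<le> \<sigma> n) sequentially" using \<sigma>(2) unfolding filterlim_at_top by blast
    with cB show ?thesis
      by eventually_elim (auto simp: good_def c_def abs_le_iff)
  qed
  then obtain n0 where n0: "\<And>n. n \<ge> n0 \<Longrightarrow> good n" unfolding eventually_sequentially by blast
  define R1 where "R1 = R0 * (2 + 2 * c / s0) ^ m + c * (fact (m + 1) * exp 2) * (2 + 2 * c / s0) ^ (m + 1)"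
  have good_bound: "\<bar>cdf (distr M borel (W n)) x - std_normal_cdf x\<bar> \<le> R1 / \<sigma> n / (1 + \<bar>x\<bar>) ^ m"
    if "good n" "\<sigma> n > 0" for n x
    unfolding R1_def
    by (rule cdf_bound_affine[OF _ W'[OF that(2)] s0(1) s0(2)[OF that(2)] _ _ _ R0(1) R0(2)[OF that(2)]])
      (use that cA[of n] in \<open>auto simp: good_def c_def\<close>)
  have "\<exists>C\<ge>0. \<sigma> n > 0 \<and> B n \<noteq> 0 \<longrightarrow> (\<forall>x. \<bar>cdf (distr M borel (W n)) x - std_normal_cdf x\<bar> \<le> C / (1 + \<bar>x\<bar>) ^ m)" for n
  proof (cases "\<sigma> n > 0 \<and> B n \<noteq> 0")
    case True
    then have n: "\<sigma> n > 0" "B n \<noteq> 0" "R0 / \<sigma> n \<ge> 0" using R0 by auto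
    have "\<exists>C\<ge>0. \<forall>x. \<bar>cdf (distr M borel (W n)) x - std_normal_cdf x\<bar> \<le> C / (1 + \<bar>x\<bar>) ^ m"
      by (rule cdf_bound_affine_crude[OF M _ W'[OF n(1)] n(1,2) _ n(3) R0(2)[OF n(1)]]) (use m in auto)
    then show ?thesis by blast
  qed auto
  then obtain C where C: "\<And>n. C n \<ge> 0" "\<And>n x. \<sigma> n > 0 \<Longrightarrow> B n \<noteq> 0 \<Longrightarrow>
      \<bar>cdf (distr M borel (W n)) x - std_normal_cdf x\<bar> \<le> C n / (1 + \<bar>x\<bar>) ^ m"
    by metis
  \<comment> \<open>The sum repays the factor \<open>1 / \<sigma> n\<close> at the finitely many
    early indices, where the crude bound has its own constant \<open>C n\<close>; the final 1 makes
    \<open>R\<close> positive.\<close>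
  define R where "R = \<bar>R1\<bar> + (\<Sum>n<n0. C n * \<bar>\<sigma> n\<bar>) + 1"
  have sum0: "0 \<le> (\<Sum>n<n0. C n * \<bar>\<sigma> n\<bar>)" using C(1) by (intro sum_nonneg) auto
  have R: "R > 0" using sum0 by (simp add: R_def)
  have "\<bar>cdf (distr M borel (W n)) x - std_normal_cdf x\<bar> \<le> R / \<sigma> n / (1 + \<bar>x\<bar>) ^ m"
    if n: "\<sigma> n > 0" "B n \<noteq> 0" for n x
  proof (cases "n < n0")
    case True
    have "C n * \<bar>\<sigma> n\<bar> \<le> (\<Sum>n<n0. C n * \<bar>\<sigma> n\<bar>)"
      using True C(1) by (intro member_le_sum) auto
    then have "C n * \<sigma> n \<le> R" using n by (simp add: R_def)
    then have "C n \<le> R / \<sigma> n" using n by (simp add: pos_le_divide_eq)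
    then have "C n / (1 + \<bar>x\<bar>) ^ m \<le> R / \<sigma> n / (1 + \<bar>x\<bar>) ^ m" by (intro divide_right_mono) auto
    with C(2)[OF n, of x] show ?thesis by linarith
  next
    case False
    have "R1 / \<sigma> n / (1 + \<bar>x\<bar>) ^ m \<le> R / \<sigma> n / (1 + \<bar>x\<bar>) ^ m"
      using n sum0 by (intro divide_right_mono) (auto simp: R_def)
    with good_bound[of n x] False n0[of n] n show ?thesis by simp
  qed
  with R show ?thesis by blast
qed

text \<open>Local absolute continuity makes precise the regularity of \<open>h\<close>:
  differentiability almost everywhere alone would admit the Cantor function, with
  \<open>H = 0\<close> but in general a nonzero error. Indices with \<open>\<sigma> n = 0\<close> or
  \<open>B n = 0\<close> are excluded, as the quotients there have only their conventional value 0.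
  Real exponents are positive, 0 being covered by the natural ones; for negative ones the derivative
  is not integrable at the origin.\<close>

theorem corollary6:
  fixes M :: "'a measure" and S :: "nat \<Rightarrow> 'a \<Rightarrow> real"
    and \<sigma> A B :: "nat \<Rightarrow> real" and W :: "nat \<Rightarrow> 'a \<Rightarrow> real" and m :: nat
  assumes "prob_space M"
    and "\<And>n. S n \<in> borel_measurable M"
    and "\<And>n. integrable M (\<lambda>\<omega>. (S n \<omega>)\<^sup>2)"
    and "\<And>n. (\<integral>\<omega>. S n \<omega> \<partial>M) = 0"
    and "\<And>n. \<sigma> n = sqrt (\<integral>\<omega>. (S n \<omega>)\<^sup>2 \<partial>M)"
    and "filterlim \<sigma> at_top sequentially"
    and "bounded (range A)"
    and "(\<lambda>n. B n - \<sigma> n) \<in> O(\<lambda>_. 1)"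
    and "\<And>n \<omega>. W n \<omega> = (S n \<omega> - A n) / B n"
    and "m \<ge> 2"
    and "growth_condition M S \<sigma> m"
  shows "\<exists>R>0.
    (\<forall>h :: real \<Rightarrow> real.
       (AE x in lebesgue. h differentiable (at x)) \<and> locally_abs_continuous h \<and> H m h < \<infinity> \<longrightarrow>
       (\<forall>n. \<sigma> n > 0 \<and> B n \<noteq> 0 \<longrightarrow> normal_approx M (W n) h (R * enn2real (H m h) / \<sigma> n))) \<and>
    (\<forall>q :: nat. q < m \<longrightarrow>
       H m (\<lambda>x. x ^ q) < \<infinity> \<and> H m (\<lambda>x. \<bar>x\<bar> ^ q) < \<infinity> \<and>
       (\<forall>n. \<sigma> n > 0 \<and> B n \<noteq> 0 \<longrightarrow>
          normal_approx M (W n) (\<lambda>x. x ^ q) (R * enn2real (H m (\<lambda>x. x ^ q)) / \<sigma> n) \<and>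
          normal_approx M (W n) (\<lambda>x. \<bar>x\<bar> ^ q) (R * enn2real (H m (\<lambda>x. \<bar>x\<bar> ^ q)) / \<sigma> n))) \<and>
    (\<forall>q :: real. 0 < q \<and> q < real m \<longrightarrow>
       H m (\<lambda>x. \<bar>x\<bar> powr q) < \<infinity> \<and>
       (\<forall>n. \<sigma> n > 0 \<and> B n \<noteq> 0 \<longrightarrow>
          normal_approx M (W n) (\<lambda>x. \<bar>x\<bar> powr q)
            (R * enn2real (H m (\<lambda>x. \<bar>x\<bar> powr q)) / \<sigma> n)))"
proof -
  obtain R where R: "R > 0" and cdf: "\<And>n x. \<sigma> n > 0 \<Longrightarrow> B n \<noteq> 0 \<Longrightarrow>
      \<bar>cdf (distr M borel (W n)) x - std_normal_cdf x\<bar> \<le> R / \<sigma> n / (1 + \<bar>x\<bar>) ^ m"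
    using uniform_cdf_bound[OF assms] by blast
  have W_borel: "W n \<in> borel_measurable M" for n
    unfolding assms(9) using assms(2) by measurable
  have approx: "normal_approx M (W n) h (R * enn2real (H m h) / \<sigma> n)"
    if "\<sigma> n > 0 \<and> B n \<noteq> 0" "\<And>a b. a \<le> b \<Longrightarrow> (deriv h has_integral (h b - h a)) {a..b}" "H m h < \<infinity>" for h n
    using normal_approx_of_cdf_bound[OF assms(1) W_borel _ cdf that(2,3)] that(1) assms(10) by simp
  show ?thesis
  proof (rule exI[of _ R], intro conjI allI impI)
    show "R > 0" by (rule R)
  next
    fix h n
    assume "(AE x in lebesgue. h differentiable (at x)) \<and> locally_abs_continuous h \<and> H m h < \<infinity>" "\<sigma> n > 0 \<and> B n \<noteq> 0"
    then show "normal_approx M (W n) h (R * enn2real (H m h) / \<sigma> n)"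
      using locally_abs_continuous_FTC[of h] by (intro approx) auto
  next
    fix q :: nat and n assume q: "q < m" and n: "\<sigma> n > 0 \<and> B n \<noteq> 0"
    show "normal_approx M (W n) (\<lambda>x. x ^ q) (R * enn2real (H m (\<lambda>x. x ^ q)) / \<sigma> n)"
      by (rule approx[OF n power_admissible(2)[OF q] power_admissible(1)[OF q]])
    show "normal_approx M (W n) (\<lambda>x. \<bar>x\<bar> ^ q) (R * enn2real (H m (\<lambda>x. \<bar>x\<bar> ^ q)) / \<sigma> n)"
      by (rule approx[OF n abs_power_admissible(2)[OF q] abs_power_admissible(1)[OF q]])
  next
    fix q :: real and n assume q: "0 < q \<and> q < real m" and n: "\<sigma> n > 0 \<and> B n \<noteq> 0"
    show "normal_approx M (W n) (\<lambda>x. \<bar>x\<bar> powr q) (R * enn2real (H m (\<lambda>x. \<bar>x\<bar> powr q)) / \<sigma> n)"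
      using q by (intro approx[OF n] abs_powr_admissible) auto
  qed (use power_admissible(1) abs_power_admissible(1) abs_powr_admissible(1) in auto)
qed

end
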